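(* Let $1\le n<N$ be integers and let $K\subset\mathbb{R}^N$ be a convex body containing the origin in its interior. Assume that the integer $1\le k<N$ is such that there exists a $k$-codimensional linear subspace $E\subset\mathbb{R}^N$ satisfying $$\ell_*(P_EK)\ge 6\sqrt n\,R(P_EK).$$ Then, with probability at least $1-2e^{-2n}$, one has $$\mathcal{R}_n(K)\ge\left(\frac{1}{R(K\cap E^\perp)}+\frac{6\,\delta_{E,K}\sqrt n}{\ell_*(P_EK)}\right)^{-1}\ge\frac12\min\left\{R(K\cap E^\perp),\ \frac{\ell_*(P_EK)}{6\,\delta_{E,K}\sqrt n}\right\}.$$
   Context: $|\cdot|$ is the Euclidean norm on $\mathbb{R}^N$. A convex body is a compact convex set containing the origin in its interior (not necessarily symmetric). For a compact set $T$, $R(T)=\max_{y\in T}|y|$. $P_E$ is the orthogonal projection onto $E$, and $E^\perp$ the orthogonal complement. For nonempty $T\subset\mathbb{R}^N$, $\ell_*(T)=\mathbb{E}\sup_{x\in T}\langle G,x\rangle$ with $G$ a standard Gaussian vector in $\mathbb{R}^N$. $\delta_{E,K}=\inf\{\lambda>0: P_EK\subset\lambda(K\cap E)\}$. The $n$-th random radius is the random variable $\mathcal{R}_n(K)=\max_{y\in E_n\cap K}|y|$, where $E_n$ is a random $n$-codimensional linear subspace of $\mathbb{R}^N$ distributed according to the normalized Haar measure on the Grassmannian. Probability is with respect to $E_n$. *)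

theory Defs
  imports "HOL-Probability.Probability"
begin

definition convex_body :: "(real ^ 'N) set \<Rightarrow> bool" where
  "convex_body K \<longleftrightarrow> compact K \<and> convex K \<and> 0 \<in> interior K"

definition orth_proj :: "(real ^ 'N) set \<Rightarrow> real ^ 'N \<Rightarrow> real ^ 'N" where
  "orth_proj E x = (THE y. y \<in> E \<and> x - y \<in> E\<^sup>\<bottom>)"

lemma orth_proj_ex1:
  fixes E :: "(real ^ 'N) set"
  assumes "subspace E"
  shows "\<exists>!y. y \<in> E \<and> x - y \<in> E\<^sup>\<bottom>"
proof -
  obtain y z where y: "y \<in> E" and z: "\<And>w. w \<in> E \<Longrightarrow> orthogonal z w" and x: "x = y + z"
    using orthogonal_subspace_decomp_exists[of E x] span_eq_iff[THEN iffD2, OF assms] by metis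
  have "y \<in> E \<and> x - y \<in> E\<^sup>\<bottom>"
    using y z x by (auto simp: orthogonal_comp_def orthogonal_commute)
  moreover have "u = v" if "u \<in> E \<and> x - u \<in> E\<^sup>\<bottom>" "v \<in> E \<and> x - v \<in> E\<^sup>\<bottom>" for u v
  proof -
    have "u - v \<in> E"
      using that assms by (simp add: subspace_diff)
    then have "(u - v) \<bullet> (x - v) = 0" "(u - v) \<bullet> (x - u) = 0"
      using that by (auto simp: orthogonal_comp_def orthogonal_def)
    then have "(u - v) \<bullet> (u - v) = 0"
      by (simp add: inner_diff_right)
    then show ?thesis by simp
  qed
  ultimately show ?thesis by blast
qed

text \<open>The suprema below are over nonempty compact sets in all uses, so they are finite, and in
  \<open>radius\<close> the supremum is the maximum.\<close>

definition radius :: "(real ^ 'N) set \<Rightarrow> real" where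
  "radius T = (SUP y\<in>T. norm y)"

definition std_gaussian :: "(real ^ 'N) measure" where
  "std_gaussian = density lborel (\<lambda>x. ennreal (\<Prod>i\<in>UNIV. std_normal_density (x $ i)))"

definition ell_star :: "(real ^ 'N) set \<Rightarrow> real" where
  "ell_star T = (\<integral>g. (SUP x\<in>T. g \<bullet> x) \<partial>std_gaussian)"

definition section_delta :: "(real ^ 'N) set \<Rightarrow> (real ^ 'N) set \<Rightarrow> real" where
  "section_delta E K = Inf {c. 0 < c \<and> orth_proj E ` K \<subseteq> (*\<^sub>R) c ` (K \<inter> E)}"

definition codim_subspaces :: "nat \<Rightarrow> (real ^ 'N) set set" where
  "codim_subspaces n = {F. subspace F \<and> dim F + n = CARD('N)}"

text \<open>The Grassmannian carries the topology induced by identifying a subspace with the matrix of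
  its orthogonal projection; this is its Borel sigma-algebra.\<close>

definition grassmannian_borel :: "nat \<Rightarrow> (real ^ 'N) set measure" where
  "grassmannian_borel n =
     vimage_algebra (codim_subspaces n) (\<lambda>F. matrix (orth_proj F)) borel"

text \<open>The normalized Haar measure on the Grassmannian is the (unique) Borel probability measure
  that is invariant under the action of the orthogonal group.\<close>

definition grassmannian_haar :: "nat \<Rightarrow> (real ^ 'N) set measure \<Rightarrow> bool" where
  "grassmannian_haar n \<mu> \<longleftrightarrow>
     prob_space \<mu> \<and> sets \<mu> = sets (grassmannian_borel n) \<and>
     (\<forall>U :: real ^ 'N \<Rightarrow> real ^ 'N. orthogonal_transformation U \<longrightarrow>
        distr \<mu> \<mu> (\<lambda>F. U ` F) = \<mu>)"

text \<open>As a function of the random subspace \<open>F\<close>, drawn from a Haar measure on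
  \<open>codim_subspaces n\<close>, this is the \<open>n\<close>-th random radius of \<open>K\<close>.\<close>

definition random_radius :: "(real ^ 'N) set \<Rightarrow> (real ^ 'N) set \<Rightarrow> real" where
  "random_radius K F = radius (F \<inter> K)"

end

theory Submission
  imports Defs
begin

text \<open>Let \<open>T = P\<^sub>E K\<close>, let \<open>e\<close> be the direction of a longest vector of \<open>K \<inter> E\<^sup>\<bottom>\<close>, and shift
  \<open>T\<close> by \<open>(\<ell>(T) / (6 sqrt n)) e\<close>. If a random subspace \<open>F\<close> meets the shifted set \<open>T'\<close>, then a
  convex combination of that longest vector and a point of \<open>K \<inter> E\<close> lies in \<open>F \<inter> K\<close> and has the
  required length. If it does not, separation gives a unit normal vector \<open>u\<close> of \<open>F\<close> at which the
  support function \<open>h\<close> of \<open>T'\<close> is nonpositive. The shift does not change the Gaussian mean width,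
  and \<open>T'\<close> has radius at most \<open>sqrt 2 \<ell>(T) / (6 sqrt n)\<close>, so the mean width of \<open>T'\<close> is at
  least \<open>(6 / sqrt 2) sqrt n\<close> times its radius. This leaves enough room
  to replace Gordon's min-max comparison by sharp concentration and a volumetric argument.

  Concentration of \<open>h\<close> on the sphere is deduced from the Prekopa--Leindler inequality. For the
  volumetric argument take a Gaussian vector \<open>g\<close> independent of \<open>F\<close>. The projection \<open>w\<close> of \<open>g\<close> to
  the normal space of \<open>F\<close> is rotation invariant, so \<open>h(w)\<close> is rarely small compared with \<open>|w|\<close>. On the
  other hand, if \<open>h(u) \<le> 0\<close>, then subadditivity makes \<open>h(w)\<close> small for most \<open>w\<close> in the ball of
  radius \<open>sqrt n / 20\<close> around \<open>(sqrt n) u\<close>, and by Cameron--Martin this ball carries at least a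
  fraction \<open>exp (- n / 2) / 30 ^ n\<close> of the Gaussian measure of the normal space.\<close>

section \<open>The Prekopa--Leindler inequality on the line\<close>

text \<open>An exponent budget forces the sharp constant. Near a bad direction the volumetric
  argument costs \<open>1 / 2\<close> for the shift and \<open>ln 30\<close> for the small ball per
  dimension, and a further 2 is owed to the target \<open>exp (- 2 * real n)\<close>. All of it is
  paid by \<open>t\<^sup>2 / 2\<close> with \<open>t\<close> at least
  \<open>38 / 10 * sqrt n\<close>, that is by 7.22 per dimension. A tail of the form
  \<open>exp (- t\<^sup>2 / 4)\<close>, which equal weights in Prekopa--Leindler would give, pays
  only half of that and is not enough; hence the weights \<open>1\<close> and \<open>k\<close> with
  \<open>k\<close> sent to infinity.

  Concentration is needed for directions rather than for Gaussian vectors: \<open>w\<close> lives in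
  an \<open>n\<close>-dimensional space, so its norm is of order \<open>sqrt n\<close>, whereas its
  direction is uniform on the sphere of the whole space. The values of \<open>h\<close> on the
  sphere are therefore scaled by the mean norm of a Gaussian vector. This mean cancels in the end,
  so only its positivity matters.

  The factor 2 in the failure probability counts two exceptional families: subspaces whose normal
  space has \<open>h\<close> too large on much of a small central ball, and the remaining subspaces
  with a bad normal direction.\<close>

text \<open>Truncation to a bounded interval comes first: it makes the measure finite, so that a
  small difference set can be subtracted, and it makes the approximating closed set compact.\<close>

lemma emeasure_lborel_inner_compact:
  fixes A :: "real set"
  assumes A: "A \<in> sets borel" and less: "ennreal m < emeasure lborel A" and m: "0 \<le> m"
  obtains K where "compact K" "K \<subseteq> A" "ennreal m < emeasure lborel K"
proof -
  have "(\<lambda>n. emeasure lborel (A \<inter> {- real n..real n})) \<longlonglongrightarrow> emeasure lborel (\<Union>n. A \<inter> {- real n..real n})"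
    using A by (intro Lim_emeasure_incseq) (auto simp: incseq_def)
  moreover have "(\<Union>n. A \<inter> {- real n..real n}) = A"
  proof -
    have "\<exists>n. x \<in> {- real n..real n}" for x
    proof -
      obtain n :: nat where "\<bar>x\<bar> \<le> real n" using real_arch_simple by blast
      then have "x \<in> {- real n..real n}" by (simp add: abs_le_iff)
      then show ?thesis by blast
    qed
    then show ?thesis by blast
  qed
  ultimately have "eventually (\<lambda>n. ennreal m < emeasure lborel (A \<inter> {- real n..real n})) sequentially"
    using less by (simp add: order_tendsto_iff)
  then obtain n :: nat where n: "ennreal m < emeasure lborel (A \<inter> {- real n..real n})"
    by (auto simp: eventually_sequentially)
  define B where "B = A \<inter> {- real n..real n}"
  have B: "B \<in> sets borel" using A by (simp add: B_def)
  have fin: "emeasure lborel B < \<infinity>"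
    using emeasure_mono[of B "{- real n..real n}" lborel] by (auto simp: B_def less_top[symmetric] top_unique)
  have mB: "m < measure lborel B"
    using n m fin by (simp add: B_def[symmetric] emeasure_eq_ennreal_measure ennreal_less_iff)
  obtain T where T: "closed T" "T \<subseteq> B" "B - T \<in> lmeasurable" "emeasure lebesgue (B - T) < ennreal (measure lborel B - m)"
    using sets_lebesgue_inner_closed[of B "measure lborel B - m"] B mB by auto
  have "compact T"
    using T(1,2) bounded_subset[of "{- real n..real n}" T] by (auto simp: compact_eq_bounded_closed B_def)
  have "emeasure lborel B = emeasure lborel T + emeasure lborel (B - T)"
    using B T by (subst plus_emeasure) (auto simp: Un_absorb1)
  moreover have "emeasure lebesgue (B - T) = emeasure lborel (B - T)"
    using B T by simp
  moreover have "emeasure lborel T < \<infinity>" "emeasure lborel (B - T) < \<infinity>"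
    using fin B T emeasure_mono[of T B lborel] emeasure_mono[of "B - T" B lborel] by (auto simp: less_top[symmetric] top_unique)
  moreover have "emeasure lborel B = ennreal (measure lborel B)"
    by (rule emeasure_eq_ennreal_measure) (use fin in auto)
  moreover have "emeasure lborel T = ennreal (measure lborel T)"
    by (rule emeasure_eq_ennreal_measure) (use calculation in auto)
  moreover have "emeasure lborel (B - T) = ennreal (measure lborel (B - T))"
    by (rule emeasure_eq_ennreal_measure) (use calculation in auto)
  ultimately have "ennreal (measure lborel B) = ennreal (measure lborel T + measure lborel (B - T))"
     and "ennreal (measure lborel (B - T)) < ennreal (measure lborel B - m)"
    using T(4) by (metis ennreal_plus measure_nonneg, metis)
  then have "measure lborel B = measure lborel T + measure lborel (B - T)"
     "measure lborel (B - T) < measure lborel B - m"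
    by (simp_all add: ennreal_less_iff del: ennreal_plus)
  then have "m < measure lborel T" by simp
  then have "ennreal m < emeasure lborel T"
    using \<open>emeasure lborel T < \<infinity>\<close> m by (simp add: emeasure_eq_ennreal_measure ennreal_less_iff)
  with that[of T] \<open>compact T\<close> T(2) show thesis by (auto simp: B_def)
qed

text \<open>Translate \<open>A\<close> by the minimum \<open>b\<close> of \<open>B\<close>, and
  \<open>B\<close> by the maximum \<open>a\<close> of \<open>A\<close>. Both translates consist of
  sums, the first lies to the left of \<open>a + b\<close> and the second to the right, so they
  share at most one point.\<close>

lemma brunn_minkowski_compact_real:
  fixes A B C :: "real set"
  assumes "compact A" "compact B" "A \<noteq> {}" "B \<noteq> {}" and C: "C \<in> sets borel"
    and sub: "\<And>x y. x \<in> A \<Longrightarrow> y \<in> B \<Longrightarrow> x + y \<in> C"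
  shows "emeasure lborel A + emeasure lborel B \<le> emeasure lborel C"
proof -
  obtain a where a: "a \<in> A" "\<And>x. x \<in> A \<Longrightarrow> x \<le> a" using compact_attains_sup[of A] assms by blast
  obtain b where b: "b \<in> B" "\<And>x. x \<in> B \<Longrightarrow> b \<le> x" using compact_attains_inf[of B] assms by blast
  have tr: "emeasure lborel ((+) c ` S) = emeasure lborel S" if "compact S" for c and S :: "real set"
  proof -
    have "emeasure lborel S = emeasure (distr lborel borel ((+) (-c))) S"
      by (simp add: lborel_distr_plus)
    also have "\<dots> = emeasure lborel ((+) (-c) -` S)"
      using that by (subst emeasure_distr) (auto simp: borel_compact)
    also have "(+) (-c) -` S = (+) c ` S"
      by (force simp: image_iff)
    finally show ?thesis by simp
  qed
  have cp: "compact ((+) b ` A)" "compact ((+) a ` B)"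
    using assms by (auto intro!: compact_continuous_image continuous_intros)
  have null: "(+) b ` A \<inter> (+) a ` B \<subseteq> {a + b}"
    using a b by force
  have "emeasure lborel A + emeasure lborel B = emeasure lborel ((+) b ` A) + emeasure lborel ((+) a ` B)"
    using assms tr by simp
  also have "\<dots> = emeasure lborel ((+) b ` A) + emeasure lborel ((+) a ` B - {a + b})"
    using cp by (subst emeasure_Diff_null_set[of "{a+b}"]) (auto simp: borel_compact)
  also have "\<dots> = emeasure lborel ((+) b ` A \<union> ((+) a ` B - {a + b}))"
    using cp null by (intro plus_emeasure) (auto simp: borel_compact)
  also have "\<dots> \<le> emeasure lborel C"
  proof (rule emeasure_mono)
    show "(+) b ` A \<union> ((+) a ` B - {a + b}) \<subseteq> C"
      using sub[of _ b] sub[of a] a(1) b(1) by (auto simp: add.commute[of b])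
  qed (use C in simp)
  finally show ?thesis .
qed

lemma brunn_minkowski_real:
  fixes A B C :: "real set"
  assumes A: "A \<in> sets borel" "A \<noteq> {}" and B: "B \<in> sets borel" "B \<noteq> {}" and C: "C \<in> sets borel"
    and sub: "\<And>x y. x \<in> A \<Longrightarrow> y \<in> B \<Longrightarrow> x + y \<in> C"
  shows "emeasure lborel A + emeasure lborel B \<le> emeasure lborel C"
proof -
  \<comment> \<open>The value \<open>r = 0\<close> is allowed separately: nothing lies strictly
    below the measure of a null set, yet the compact set must be nonempty for the sumset argument,
    so a single point is taken.\<close>
  have approx: "\<exists>K. compact K \<and> K \<noteq> {} \<and> K \<subseteq> S \<and> r \<le> emeasure lborel K"
    if S: "S \<in> sets borel" "S \<noteq> {}" and r: "r < emeasure lborel S \<or> r = 0" for S :: "real set" and r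
  proof (cases "r = 0")
    case True
    obtain x where "x \<in> S" using S by blast
    then show ?thesis using True by (intro exI[of _ "{x}"]) auto
  next
    case False
    then have less: "r < emeasure lborel S" using r by blast
    then have r': "r = ennreal (enn2real r)" by (metis ennreal_enn2real top.not_eq_extremum order_less_trans less_irrefl not_less_iff_gr_or_eq top.extremum_strict)
    obtain K where "compact K" "K \<subseteq> S" "ennreal (enn2real r) < emeasure lborel K"
      by (rule emeasure_lborel_inner_compact[OF S(1), of "enn2real r"]) (use less r'[symmetric] in simp_all)
    moreover from this have "K \<noteq> {}" by auto
    ultimately show ?thesis using r'[symmetric] by (intro exI[of _ K]) auto
  qed
  have key: "r + s \<le> emeasure lborel C"
    if r: "r < emeasure lborel A \<or> r = 0" and s: "s < emeasure lborel B \<or> s = 0" for r s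
  proof -
    obtain K where K: "compact K" "K \<noteq> {}" "K \<subseteq> A" "r \<le> emeasure lborel K" using approx[OF A r] by blast
    obtain L where L: "compact L" "L \<noteq> {}" "L \<subseteq> B" "s \<le> emeasure lborel L" using approx[OF B s] by blast
    have "r + s \<le> emeasure lborel K + emeasure lborel L" using K L by (intro add_mono)
    also have "\<dots> \<le> emeasure lborel C"
      using K L sub by (intro brunn_minkowski_compact_real C) auto
    finally show ?thesis .
  qed
  have sup: "emeasure lborel S = (SUP r\<in>{r. r < emeasure lborel S \<or> r = 0}. r)" for S :: "real set"
  proof (intro antisym SUP_least)
    show "emeasure lborel S \<le> (SUP r\<in>{r. r < emeasure lborel S \<or> r = 0}. r)"
    proof (rule dense_le)
      fix r assume "r < emeasure lborel S"
      then show "r \<le> (SUP r\<in>{r. r < emeasure lborel S \<or> r = 0}. r)"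
        by (intro SUP_upper2[of r]) auto
    qed
  next
    fix r assume "r \<in> {r. r < emeasure lborel S \<or> r = 0}"
    then show "r \<le> emeasure lborel S" by auto
  qed
  have ne: "{r. r < emeasure lborel S \<or> r = 0} \<noteq> {}" for S :: "real set" by blast
  have "emeasure lborel A + emeasure lborel B =
      (SUP r\<in>{r. r < emeasure lborel A \<or> r = 0}. r + emeasure lborel B)"
    by (subst ennreal_SUP_add_left[OF ne]) (simp only: sup[of A, symmetric])
  also have "\<dots> = (SUP r\<in>{r. r < emeasure lborel A \<or> r = 0}. SUP s\<in>{s. s < emeasure lborel B \<or> s = 0}. r + s)"
  proof (intro SUP_cong refl)
    fix r :: ennreal
    have "(SUP s\<in>{s. s < emeasure lborel B \<or> s = 0}. r + s) = r + (SUP s\<in>{s. s < emeasure lborel B \<or> s = 0}. s)"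
      by (rule ennreal_SUP_add_right[OF ne, symmetric])
    then show "r + emeasure lborel B = (SUP s\<in>{s. s < emeasure lborel B \<or> s = 0}. r + s)"
      by (simp only: sup[of B, symmetric])
  qed
  also have "\<dots> \<le> emeasure lborel C"
    using key by (intro SUP_least) auto
  finally show ?thesis .
qed

lemma emeasure_lborel_scale_real:
  fixes A :: "real set"
  assumes "A \<in> sets borel" "c > 0"
  shows "emeasure lborel {x. x / c \<in> A} = ennreal c * emeasure lborel A"
proof -
  have "emeasure lborel A = (\<integral>\<^sup>+x. indicator A x \<partial>lborel)" using assms by simp
  also have "ennreal c * \<dots> = ennreal c * (ennreal (1/c) * (\<integral>\<^sup>+x. indicator A (x / c) \<partial>lborel))"
    using assms nn_integral_real_affine[of "indicator A" "1/c" 0] by simp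
  also have "\<dots> = (\<integral>\<^sup>+x. indicator A (x / c) \<partial>lborel)"
    using assms(2) by (simp add: mult.assoc[symmetric] ennreal_mult[symmetric])
  also have "\<dots> = (\<integral>\<^sup>+x. indicator {x. x / c \<in> A} x \<partial>lborel)"
    by (intro nn_integral_cong) (simp add: indicator_def)
  also have "\<dots> = emeasure lborel {x. x / c \<in> A}"
  proof (rule nn_integral_indicator)
    have "(\<lambda>x. x / c) -` A \<inter> space borel \<in> sets borel"
      using assms by (intro measurable_sets[of _ borel borel]) auto
    then show "{x. x / c \<in> A} \<in> sets lborel" by (simp add: vimage_def)
  qed
  finally show ?thesis by simp
qed

lemma nn_integral_layer_cake:
  fixes f :: "real \<Rightarrow> real"
  assumes [measurable]: "f \<in> borel_measurable borel" and nn: "\<And>x. 0 \<le> f x"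
  shows "(\<integral>\<^sup>+x. ennreal (f x) \<partial>lborel) = (\<integral>\<^sup>+s. emeasure lborel {x. s < f x} * indicator {0..} s \<partial>lborel)"
proof -
  have "(\<integral>\<^sup>+x. ennreal (f x) \<partial>lborel) = (\<integral>\<^sup>+x. \<integral>\<^sup>+s. indicator {0..<f x} s \<partial>lborel \<partial>lborel)"
    using nn by (intro nn_integral_cong) simp
  also have "\<dots> = (\<integral>\<^sup>+x. \<integral>\<^sup>+s. indicator {p. 0 \<le> snd p \<and> snd p < f (fst p)} (x, s) \<partial>lborel \<partial>lborel)"
    by (intro nn_integral_cong) (auto simp: indicator_def)
  also have "\<dots> = (\<integral>\<^sup>+s. \<integral>\<^sup>+x. indicator {p. 0 \<le> snd p \<and> snd p < f (fst p)} (x, s) \<partial>lborel \<partial>lborel)"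
    by (rule lborel_pair.Fubini') measurable
  also have "\<dots> = (\<integral>\<^sup>+s. emeasure lborel {x. s < f x} * indicator {0..} s \<partial>lborel)"
  proof (intro nn_integral_cong)
    fix s :: real
    have "(\<integral>\<^sup>+x. indicator {p. 0 \<le> snd p \<and> snd p < f (fst p)} (x, s) \<partial>lborel)
      = (\<integral>\<^sup>+x. indicator {x. s < f x} x * indicator {0..} s \<partial>lborel)"
      by (intro nn_integral_cong) (auto simp: indicator_def)
    also have "\<dots> = emeasure lborel {x. s < f x} * indicator {0..} s"
      by (subst nn_integral_multc) auto
    finally show "(\<integral>\<^sup>+x. indicator {p. 0 \<le> snd p \<and> snd p < f (fst p)} (x, s) \<partial>lborel) = \<dots>" .
  qed
  finally show ?thesis .
qed

text \<open>Bernoulli's inequality for the \<open>x\<close> with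
  \<open>1 + (k + 1) * x = a / b\<close>, multiplied by \<open>b ^ (k + 1)\<close>. It converts the
  additive bound for normalised functions into a bound for the product of the integrals.\<close>

lemma weighted_am_gm_nat:
  fixes a b :: real
  assumes "0 \<le> a" "0 \<le> b"
  shows "a * b ^ k \<le> ((a + real k * b) / (real k + 1)) ^ (k + 1)"
proof (cases "b = 0")
  case True
  then show ?thesis using assms by (cases k) (auto intro!: zero_le_power divide_nonneg_nonneg)
next
  case False
  then have b: "b > 0" using assms by simp
  define x where "x = (a / b - 1) / (real k + 1)"
  have "- 1 \<le> - 1 / (real k + 1)" by (simp add: field_simps)
  also have "\<dots> \<le> x" unfolding x_def using assms b by (intro divide_right_mono) auto
  finally have x: "-1 \<le> x" .
  have "1 + real (k + 1) * x \<le> (1 + x) ^ (k + 1)"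
    using x by (rule Bernoulli_inequality)
  also have "1 + real (k + 1) * x = a / b" by (simp add: x_def add.commute[of 1])
  finally have "a / b * b ^ (k + 1) \<le> (1 + x) ^ (k + 1) * b ^ (k + 1)"
    using b by (intro mult_right_mono) auto
  also have "\<dots> = ((1 + x) * b) ^ (k + 1)" by (simp only: power_mult_distrib)
  also have "(1 + x) * b = b + (a - b) / (real k + 1)"
    using b by (simp add: x_def distrib_right left_diff_distrib)
  also have "\<dots> = (a + real k * b) / (real k + 1)"
    by (simp add: field_simps)
  finally show ?thesis using b by simp
qed

text \<open>The suprema of both functions are normalised to 1, so that all superlevel sets
  below level 1 are nonempty and the one-dimensional Brunn--Minkowski inequality applies.\<close>

lemma prekopa_leindler_normalized:
  fixes u v w :: "real \<Rightarrow> real"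
  assumes [measurable]: "u \<in> borel_measurable borel" "v \<in> borel_measurable borel" "w \<in> borel_measurable borel"
    and nn: "\<And>x. 0 \<le> u x" "\<And>x. 0 \<le> v x" "\<And>x. 0 \<le> w x"
    and le1: "\<And>x. u x \<le> 1" "\<And>x. v x \<le> 1"
    and sup1: "\<And>s. s < 1 \<Longrightarrow> \<exists>x. s < u x" "\<And>s. s < 1 \<Longrightarrow> \<exists>x. s < v x"
    and w: "\<And>x y. u x * v y ^ k \<le> w ((x + real k * y) / (real k + 1)) ^ (k + 1)"
    and k: "k > 0"
  shows "(\<integral>\<^sup>+x. ennreal (u x) \<partial>lborel) + of_nat k * (\<integral>\<^sup>+x. ennreal (v x) \<partial>lborel)
      \<le> of_nat (k + 1) * (\<integral>\<^sup>+x. ennreal (w x) \<partial>lborel)"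
proof -
  have level: "emeasure lborel {x. s < u x} + of_nat k * emeasure lborel {x. s < v x}
      \<le> of_nat (k + 1) * emeasure lborel {x. s < w x}" if s: "0 \<le> s" for s
  proof (cases "s < 1")
    case False
    then have "{x. s < u x} = {}" "{x. s < v x} = {}"
      using le1 by (auto simp: not_less intro: order_trans)
    then show ?thesis by simp
  next
    case True
    \<comment> \<open>The weights enter as dilations: a point of the superlevel set of
      \<open>u\<close> plus \<open>k\<close> times a point of that of \<open>v\<close> is
      \<open>k + 1\<close> times their barycenter, at which \<open>w\<close> exceeds
      \<open>s\<close>.\<close>
    have "emeasure lborel {x. s < u x} + emeasure lborel {x. x / real k \<in> {x. s < v x}}
      \<le> emeasure lborel {x. x / real (k + 1) \<in> {x. s < w x}}"
    proof (rule brunn_minkowski_real)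
      show "{x. s < u x} \<noteq> {}" using sup1(1)[OF True] by auto
      obtain y where "s < v y" using sup1(2)[OF True] by blast
      then have "real k * y \<in> {x. x / real k \<in> {x. s < v x}}" using k by simp
      then show "{x. x / real k \<in> {x. s < v x}} \<noteq> {}" by blast
      fix x y assume x: "x \<in> {x. s < u x}" and y: "y \<in> {x. x / real k \<in> {x. s < v x}}"
      have "s ^ (k + 1) = s * s ^ k" by simp
      also have "\<dots> < u x * v (y / real k) ^ k"
        using x y s k by (intro mult_strict_mono) (auto intro!: power_strict_mono zero_less_power order_le_less_trans[OF s])
      also have "\<dots> \<le> w ((x + real k * (y / real k)) / (real k + 1)) ^ (k + 1)" by (rule w)
      also have "(x + real k * (y / real k)) / (real k + 1) = (x + y) / real (k + 1)"
        using k by (simp add: add.commute)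
      finally have "s < w ((x + y) / real (k + 1))"
        using nn(3) power_less_imp_less_base by blast
      then show "x + y \<in> {x. x / real (k + 1) \<in> {x. s < w x}}" by simp
    qed (simp_all, measurable)
    also have "emeasure lborel {x. x / real k \<in> {x. s < v x}} = of_nat k * emeasure lborel {x. s < v x}"
      using k by (subst emeasure_lborel_scale_real) (auto simp: ennreal_of_nat_eq_real_of_nat)
    also have "emeasure lborel {x. x / real (k + 1) \<in> {x. s < w x}} = of_nat (k + 1) * emeasure lborel {x. s < w x}"
      by (subst emeasure_lborel_scale_real) (auto simp: ennreal_of_nat_eq_real_of_nat)
    finally show ?thesis .
  qed
  have [measurable]: "(\<lambda>s. emeasure lborel {x. s < f x}) \<in> borel_measurable borel"
    if [measurable]: "f \<in> borel_measurable borel" for f :: "real \<Rightarrow> real"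
  proof -
    have "{p \<in> space (borel \<Otimes>\<^sub>M borel). fst p < f (snd p)} \<in> sets (borel \<Otimes>\<^sub>M lborel)"
      by measurable
    then have "{p. fst p < f (snd p)} \<in> sets (borel \<Otimes>\<^sub>M lborel)"
      by (simp add: space_pair_measure)
    then have "(\<lambda>s. emeasure lborel (Pair s -` {p. fst p < f (snd p)})) \<in> borel_measurable borel"
      by (rule lborel.measurable_emeasure_Pair)
    then show ?thesis by (simp add: vimage_def)
  qed
  have "(\<integral>\<^sup>+x. ennreal (u x) \<partial>lborel) + of_nat k * (\<integral>\<^sup>+x. ennreal (v x) \<partial>lborel) =
    (\<integral>\<^sup>+s. (emeasure lborel {x. s < u x} + of_nat k * emeasure lborel {x. s < v x}) * indicator {0..} s \<partial>lborel)"
    using nn by (simp add: nn_integral_layer_cake nn_integral_add nn_integral_cmult[symmetric] distrib_right mult.assoc)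
  also have "\<dots> \<le> (\<integral>\<^sup>+s. of_nat (k + 1) * (emeasure lborel {x. s < w x} * indicator {0..} s) \<partial>lborel)"
    using level by (intro nn_integral_mono) (auto simp: indicator_def)
  also have "\<dots> = of_nat (k + 1) * (\<integral>\<^sup>+x. ennreal (w x) \<partial>lborel)"
    using nn by (subst nn_integral_cmult) (auto simp: nn_integral_layer_cake)
  finally show ?thesis .
qed

text \<open>Divide \<open>u\<close> and \<open>v\<close> by their suprema \<open>a\<close> and
  \<open>b\<close>. The matching scale for \<open>w\<close> is \<open>d\<close> with
  \<open>d ^ (k + 1) = a * b ^ k\<close>, since it preserves the pointwise hypothesis. The
  normalised inequality bounds a weighted arithmetic mean by \<open>1 / d\<close>, and after passing
  to the geometric mean the scales cancel.\<close>

lemma prekopa_leindler_real: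
  fixes u v w :: "real \<Rightarrow> real"
  assumes [measurable]: "u \<in> borel_measurable borel" "v \<in> borel_measurable borel" "w \<in> borel_measurable borel"
    and nn: "\<And>x. 0 \<le> u x" "\<And>x. 0 \<le> v x" "\<And>x. 0 \<le> w x"
    and bdd: "\<And>x. u x \<le> c" "\<And>x. v x \<le> c"
    and w: "\<And>x y. u x * v y ^ k \<le> w ((x + real k * y) / (real k + 1)) ^ (k + 1)"
    and k: "k > 0"
    and int: "(\<integral>\<^sup>+x. ennreal (w x) \<partial>lborel) = 1"
    and fin: "(\<integral>\<^sup>+x. ennreal (u x) \<partial>lborel) < \<infinity>" "(\<integral>\<^sup>+x. ennreal (v x) \<partial>lborel) < \<infinity>"
  shows "(\<integral>\<^sup>+x. ennreal (u x) \<partial>lborel) * (\<integral>\<^sup>+x. ennreal (v x) \<partial>lborel) ^ k \<le> 1"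
proof -
  define a where "a = (SUP x. u x)"
  define b where "b = (SUP x. v x)"
  have ba: "bdd_above (range u)" "bdd_above (range v)" using bdd by (auto intro!: bdd_aboveI2)
  have ua: "u x \<le> a" and vb: "v x \<le> b" for x
    using ba by (auto simp: a_def b_def intro!: cSUP_upper)
  have ab: "0 \<le> a" "0 \<le> b" using ua[of 0] vb[of 0] nn(1,2)[of 0] by linarith+
  show ?thesis
  proof (cases "a = 0 \<or> b = 0")
    case True
    then have "(\<forall>x. u x = 0) \<or> (\<forall>x. v x = 0)"
      using ua vb nn by (metis antisym)
    then show ?thesis using k by (auto simp: power_0_left)
  next
    case False
    then have pos: "a > 0" "b > 0" using ab by auto
    define d where "d = root (k + 1) (a * b ^ k)"
    have d: "d > 0" "d ^ (k + 1) = a * b ^ k" using pos by (auto simp: d_def simp del: power_Suc)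
    have gt: "\<exists>x. s < f x / m" if "s < 1" and m: "m > 0" "m = (SUP x. f x)" and f: "bdd_above (range f)" for s m and f :: "real \<Rightarrow> real"
    proof -
      have "s * m < (SUP x. f x)" using that by simp
      then obtain x where "s * m < f x" using less_cSUP_iff[OF _ f, of "s * m"] by auto
      then show ?thesis using m(1) by (auto simp: field_simps)
    qed
    have eq: "(\<integral>\<^sup>+x. ennreal (f x) \<partial>lborel) = ennreal m * (\<integral>\<^sup>+x. ennreal (f x / m) \<partial>lborel)"
      if "m > 0" "f \<in> borel_measurable borel" "\<And>x. 0 \<le> f x" for m and f :: "real \<Rightarrow> real"
      using that by (subst nn_integral_cmult[symmetric]) (auto simp: ennreal_mult[symmetric])
    define U where "U = (\<integral>\<^sup>+x. ennreal (u x / a) \<partial>lborel)"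
    define V where "V = (\<integral>\<^sup>+x. ennreal (v x / b) \<partial>lborel)"
    define W where "W = (\<integral>\<^sup>+x. ennreal (w x / d) \<partial>lborel)"
    have UV: "U + of_nat k * V \<le> of_nat (k + 1) * W"
      unfolding U_def V_def W_def
    proof (rule prekopa_leindler_normalized)
      fix x y
      have "u x / a * (v y / b) ^ k = u x * v y ^ k / d ^ (k + 1)"
        by (simp only: d(2) power_divide times_divide_times_eq)
      also have "\<dots> \<le> w ((x + real k * y) / (real k + 1)) ^ (k + 1) / d ^ (k + 1)"
        using d(1) by (intro divide_right_mono w) auto
      finally show "u x / a * (v y / b) ^ k \<le> (w ((x + real k * y) / (real k + 1)) / d) ^ (k + 1)"
        by (simp only: power_divide)
    qed (use nn pos d(1) ua vb k ba gt[OF _ pos(1) a_def] gt[OF _ pos(2) b_def] in auto)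
    have W: "W = ennreal (1 / d)"
      using eq[OF d(1), of w] nn int d(1) W_def
      by (metis assms(3) ennreal_1 ennreal_divide_times divide_ennreal ennreal_mult_divide_eq ennreal_times_divide less_eq_real_def mult.commute mult.right_neutral not_less ennreal_eq_0_iff ennreal_neq_top zero_le_one)
    have Ufin: "U < \<infinity>" "V < \<infinity>"
      using fin eq[OF pos(1), of u] eq[OF pos(2), of v] nn pos
      by (auto simp: U_def V_def ennreal_mult_less_top)
    define u' where "u' = enn2real U"
    define v' where "v' = enn2real V"
    have U': "U = ennreal u'" "V = ennreal v'" "u' \<ge> 0" "v' \<ge> 0"
      using Ufin by (auto simp: u'_def v'_def)
    have "ennreal (u' + real k * v') \<le> ennreal (real (k + 1) * (1 / d))"
      using UV U' d(1) unfolding W by (simp add: ennreal_of_nat_eq_real_of_nat ennreal_mult[symmetric] ennreal_plus[symmetric] del: ennreal_plus)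
    then have le: "(u' + real k * v') / (real k + 1) \<le> 1 / d"
      using d(1) by (subst (asm) ennreal_le_iff) (auto simp: field_simps)
    have "u' * v' ^ k \<le> ((u' + real k * v') / (real k + 1)) ^ (k + 1)"
      using U' by (intro weighted_am_gm_nat)
    also have "\<dots> \<le> (1 / d) ^ (k + 1)" using U' by (intro power_mono le) auto
    also have "\<dots> = 1 / (a * b ^ k)" by (simp add: d(2)[symmetric] power_divide del: power_Suc)
    finally have "(a * u') * (b * v') ^ k \<le> 1" using pos by (simp add: field_simps power_mult_distrib)
    moreover have "(\<integral>\<^sup>+x. ennreal (u x) \<partial>lborel) = ennreal (a * u')" "(\<integral>\<^sup>+x. ennreal (v x) \<partial>lborel) = ennreal (b * v')"
      using eq[OF pos(1), of u] eq[OF pos(2), of v] nn pos U' by (auto simp: U_def[symmetric] V_def[symmetric] ennreal_mult)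
    ultimately show ?thesis
      using pos U' by (simp add: ennreal_power ennreal_mult[symmetric])
  qed
qed

section \<open>Transport inequality and invariance of the Gaussian measure\<close>

abbreviation std_normal_measure :: "real measure" where
  "std_normal_measure \<equiv> density lborel (\<lambda>x. ennreal (std_normal_density x))"

lemma prob_space_std_normal_measure: "prob_space std_normal_measure"
  by (rule prob_space_normal_density) simp

lemma std_normal_density_le_1: "std_normal_density x \<le> 1"
proof -
  have "std_normal_density x \<le> 1 / sqrt (2 * pi)"
    by (simp add: std_normal_density_def divide_right_mono)
  also have "\<dots> \<le> 1" using pi_gt3 by simp
  finally show ?thesis .
qed

text \<open>The weighted sum \<open>x\<^sup>2 + k * y\<^sup>2\<close> exceeds \<open>k + 1\<close>
  times the squared barycenter by exactly \<open>k / (k + 1) * (x - y)\<^sup>2\<close>. Hence, if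
  \<open>u\<close> and \<open>v\<close> obey the quadratic cost bound, then after multiplying both
  by the Gaussian density the density itself is an admissible \<open>w\<close>, of total mass
  1.\<close>

lemma std_normal_density_barycenter:
  "std_normal_density x * std_normal_density y ^ k * exp (real k / (real k + 1) * (x - y)\<^sup>2 / 2)
    = std_normal_density ((x + real k * y) / (real k + 1)) ^ (k + 1)"
proof -
  define c where "c = 1 / sqrt (2 * pi)"
  have d: "std_normal_density z = c * exp (- z\<^sup>2 / 2)" for z
    by (simp add: std_normal_density_def c_def)
  have e: "- x\<^sup>2 / 2 + real k * (- y\<^sup>2 / 2) + real k / (real k + 1) * (x - y)\<^sup>2 / 2
     = real (k + 1) * (- ((x + real k * y) / (real k + 1))\<^sup>2 / 2)"
  proof -
    define m where "m = real k + 1"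
    have m: "m \<noteq> 0" "real k = m - 1" by (auto simp: m_def)
    show ?thesis
      using m(1) unfolding of_nat_add of_nat_1 m(2)
      by (simp add: divide_simps power2_eq_square) (simp add: algebra_simps)
  qed
  have "std_normal_density x * std_normal_density y ^ k * exp (real k / (real k + 1) * (x - y)\<^sup>2 / 2)
    = c ^ (k + 1) * exp (- x\<^sup>2 / 2 + real k * (- y\<^sup>2 / 2) + real k / (real k + 1) * (x - y)\<^sup>2 / 2)"
    by (simp only: d exp_add exp_of_nat_mult power_mult_distrib power_add power_one_right mult_ac)
  also have "\<dots> = (c * exp (- ((x + real k * y) / (real k + 1))\<^sup>2 / 2)) ^ (k + 1)"
    unfolding e exp_of_nat_mult power_mult_distrib ..
  finally show ?thesis by (simp only: d)
qed

lemma ennreal_tendsto_power: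
  fixes f :: "nat \<Rightarrow> ennreal"
  assumes "f \<longlonglongrightarrow> a" "a \<noteq> 0"
  shows "(\<lambda>n. f n ^ k) \<longlonglongrightarrow> a ^ k"
proof (induction k)
  case (Suc k)
  then show ?case using assms by (auto intro!: tendsto_mult_ennreal)
qed simp

lemma nn_integral_min_tendsto:
  fixes u :: "'a \<Rightarrow> ennreal"
  assumes [measurable]: "u \<in> borel_measurable M"
  shows "(\<lambda>n. \<integral>\<^sup>+x. min (u x) (of_nat n) \<partial>M) \<longlonglongrightarrow> (\<integral>\<^sup>+x. u x \<partial>M)"
proof (rule nn_integral_LIMSEQ)
  show "incseq (\<lambda>n x. min (u x) (of_nat n))"
    by (auto simp: incseq_def le_fun_def intro: min.coboundedI2)
  show "(\<lambda>n. min (u x) (of_nat n)) \<longlonglongrightarrow> u x" for x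
    using tendsto_min[OF tendsto_const[of "u x"] of_nat_tendsto_top_ennreal] by simp
qed simp

text \<open>An infimum-convolution form of the Prekopa--Leindler inequality for the Gaussian measure,
  stated with natural number exponents because it then tensorises without any integrability
  side conditions.\<close>

lemma std_normal_transport_real:
  fixes u v :: "real \<Rightarrow> ennreal"
  assumes [measurable]: "u \<in> borel_measurable borel" "v \<in> borel_measurable borel"
    and le: "\<And>x y. u x * v y ^ k \<le> ennreal (exp (real k / (real k + 1) * (x - y)\<^sup>2 / 2))"
    and k: "k > 0"
  shows "(\<integral>\<^sup>+x. u x \<partial>std_normal_measure) * (\<integral>\<^sup>+x. v x \<partial>std_normal_measure) ^ k \<le> 1"
proof -
  interpret N: prob_space std_normal_measure by (rule prob_space_std_normal_measure)
  \<comment> \<open>Truncation at \<open>n\<close> supplies the upper bound that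
    \<open>prekopa_leindler_real\<close> requires; the cost bound survives because both functions
    only decrease.\<close>
  have trunc: "(\<integral>\<^sup>+x. min (u x) (of_nat n) \<partial>std_normal_measure) *
     (\<integral>\<^sup>+x. min (v x) (of_nat n) \<partial>std_normal_measure) ^ k \<le> 1" for n
  proof -
    define U where "U x = enn2real (min (u x) (of_nat n))" for x
    define V where "V x = enn2real (min (v x) (of_nat n))" for x
    have [measurable]: "U \<in> borel_measurable borel" "V \<in> borel_measurable borel"
      unfolding U_def V_def by measurable
    have lt: "min a (of_nat n) < \<top>" for a :: ennreal
      by (metis min_less_iff_disj of_nat_less_top)
    have UV: "ennreal (U x) = min (u x) (of_nat n)" "ennreal (V x) = min (v x) (of_nat n)" for x
      using lt by (simp_all add: U_def V_def)
    have bnd: "0 \<le> U x" "0 \<le> V x" "U x \<le> real n" "V x \<le> real n" for x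
    proof -
      show "0 \<le> U x" "0 \<le> V x" by (simp_all add: U_def V_def)
      have "ennreal (U x) \<le> ennreal (real n)" "ennreal (V x) \<le> ennreal (real n)"
        by (simp_all add: UV ennreal_of_nat_eq_real_of_nat[symmetric])
      then show "U x \<le> real n" "V x \<le> real n" by simp_all
    qed
    have eq: "(\<integral>\<^sup>+x. ennreal (f x) \<partial>std_normal_measure) = (\<integral>\<^sup>+x. ennreal (f x * std_normal_density x) \<partial>lborel)"
      if "f \<in> borel_measurable borel" "\<And>x. 0 \<le> f x" for f
      using that by (subst nn_integral_density) (auto simp: ennreal_mult[symmetric] mult.commute)
    have fin: "(\<integral>\<^sup>+x. ennreal (f x * std_normal_density x) \<partial>lborel) < \<infinity>"
      if "f \<in> borel_measurable borel" "\<And>x. 0 \<le> f x" "\<And>x. f x \<le> real n" for f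
    proof -
      have "(\<integral>\<^sup>+x. ennreal (f x) \<partial>std_normal_measure) \<le> (\<integral>\<^sup>+x. ennreal (real n) \<partial>std_normal_measure)"
        using that by (intro nn_integral_mono ennreal_leI)
      also have "\<dots> < \<infinity>" using N.emeasure_space_1 by (simp add: ennreal_mult_less_top)
      finally show ?thesis using eq[of f] that by simp
    qed
    have "(\<integral>\<^sup>+x. ennreal (U x * std_normal_density x) \<partial>lborel) *
        (\<integral>\<^sup>+x. ennreal (V x * std_normal_density x) \<partial>lborel) ^ k \<le> 1"
    proof (rule prekopa_leindler_real[where w = std_normal_density and c = "real n"])
      show "U x * std_normal_density x \<le> real n" "V x * std_normal_density x \<le> real n" for x
        using mult_mono[of "U x" "real n" "std_normal_density x" 1] mult_mono[of "V x" "real n" "std_normal_density x" 1]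
          bnd std_normal_density_le_1 by auto
      fix x y
      have "ennreal (U x * V y ^ k) = ennreal (U x) * ennreal (V y) ^ k"
        using bnd by (simp add: ennreal_mult ennreal_power)
      also have "\<dots> \<le> u x * v y ^ k"
        unfolding UV by (intro mult_mono power_mono) auto
      also have "\<dots> \<le> ennreal (exp (real k / (real k + 1) * (x - y)\<^sup>2 / 2))" by (rule le)
      finally have "U x * V y ^ k \<le> exp (real k / (real k + 1) * (x - y)\<^sup>2 / 2)" by simp
      then have "(std_normal_density x * std_normal_density y ^ k) * (U x * V y ^ k)
        \<le> (std_normal_density x * std_normal_density y ^ k) * exp (real k / (real k + 1) * (x - y)\<^sup>2 / 2)"
        by (intro mult_left_mono) auto
      then show "U x * std_normal_density x * (V y * std_normal_density y) ^ k
        \<le> std_normal_density ((x + real k * y) / (real k + 1)) ^ (k + 1)"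
        unfolding std_normal_density_barycenter by (simp add: power_mult_distrib mult_ac)
      show "(\<integral>\<^sup>+x. ennreal (std_normal_density x) \<partial>lborel) = 1"
        using N.emeasure_space_1 by (simp add: emeasure_density)
    qed (use bnd k fin in auto)
    then show ?thesis using bnd by (simp add: eq UV[symmetric])
  qed
  let ?U = "\<integral>\<^sup>+x. u x \<partial>std_normal_measure" and ?V = "\<integral>\<^sup>+x. v x \<partial>std_normal_measure"
  show ?thesis
  \<comment> \<open>Multiplication on \<open>ennreal\<close> is discontinuous at zero times
    infinity, so the limit argument is kept away from zero factors; with a zero factor the product
    vanishes, for \<open>?V\<close> because \<open>k > 0\<close>.\<close>
  proof (cases "?U = 0 \<or> ?V = 0")
    case True
    then show ?thesis using k by (auto simp: power_0_left)
  next
    case False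
    then have "(\<lambda>n. (\<integral>\<^sup>+x. min (u x) (of_nat n) \<partial>std_normal_measure) *
       (\<integral>\<^sup>+x. min (v x) (of_nat n) \<partial>std_normal_measure) ^ k) \<longlonglongrightarrow> ?U * ?V ^ k"
      by (intro tendsto_mult_ennreal ennreal_tendsto_power nn_integral_min_tendsto) auto
    then show ?thesis using trunc by (intro LIMSEQ_le_const2) auto
  qed
qed

text \<open>The quadratic cost is additive over coordinates. For fixed values \<open>y\<close> and
  \<open>z\<close> of the new coordinate, the induction hypothesis applies to the sections once
  \<open>exp (- e)\<close>, which cancels the cost of that coordinate, is moved into the first
  function. The section integrals \<open>U\<close> and \<open>V\<close> then satisfy the
  one-dimensional hypothesis.\<close>

lemma std_normal_transport_PiM:
  fixes u v :: "('i \<Rightarrow> real) \<Rightarrow> ennreal"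
  assumes "finite I" and k: "k > 0"
    and "u \<in> borel_measurable (PiM I (\<lambda>_. std_normal_measure))"
    and "v \<in> borel_measurable (PiM I (\<lambda>_. std_normal_measure))"
    and "\<And>x y. x \<in> space (PiM I (\<lambda>_. std_normal_measure)) \<Longrightarrow> y \<in> space (PiM I (\<lambda>_. std_normal_measure)) \<Longrightarrow>
      u x * v y ^ k \<le> ennreal (exp (real k / (real k + 1) * (\<Sum>i\<in>I. (x i - y i)\<^sup>2) / 2))"
  shows "(\<integral>\<^sup>+x. u x \<partial>PiM I (\<lambda>_. std_normal_measure)) * (\<integral>\<^sup>+x. v x \<partial>PiM I (\<lambda>_. std_normal_measure)) ^ k \<le> 1"
  using assms(1,3-)
proof (induction I arbitrary: u v)
  case empty
  then show ?case
    by (simp add: PiM_empty nn_integral_count_space_finite)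
next
  case (insert i I)
  interpret N: prob_space std_normal_measure by (rule prob_space_std_normal_measure)
  interpret P: product_sigma_finite "\<lambda>_::'i. std_normal_measure" by standard
  interpret PI: sigma_finite_measure "PiM I (\<lambda>_. std_normal_measure)" by (rule P.sigma_finite) fact
  have upd: "(\<lambda>(y, x). f (x(i := y))) \<in> borel_measurable (borel \<Otimes>\<^sub>M PiM I (\<lambda>_. std_normal_measure))"
    if [measurable]: "f \<in> borel_measurable (PiM (insert i I) (\<lambda>_. std_normal_measure))" for f :: "_ \<Rightarrow> ennreal"
  proof -
    have "(\<lambda>p. (\<lambda>(x, y). x(i := y)) (snd p, fst p)) \<in> measurable (borel \<Otimes>\<^sub>M PiM I (\<lambda>_. std_normal_measure)) (PiM (insert i I) (\<lambda>_. std_normal_measure))"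
      by (rule measurable_compose[OF _ measurable_add_dim]) measurable
    then have "(\<lambda>p. f ((\<lambda>(x, y). x(i := y)) (snd p, fst p))) \<in> borel_measurable (borel \<Otimes>\<^sub>M PiM I (\<lambda>_. std_normal_measure))"
      by (rule measurable_compose) fact
    then show ?thesis by (simp add: case_prod_beta)
  qed
  define U where "U y = (\<integral>\<^sup>+x. u (x(i := y)) \<partial>PiM I (\<lambda>_. std_normal_measure))" for y
  define V where "V y = (\<integral>\<^sup>+x. v (x(i := y)) \<partial>PiM I (\<lambda>_. std_normal_measure))" for y
  have mUV: "U \<in> borel_measurable borel" "V \<in> borel_measurable borel"
    unfolding U_def[abs_def] V_def[abs_def]
    by (rule PI.borel_measurable_nn_integral, rule upd, fact insert.prems)+
  have sec: "(\<lambda>x. f (x(i := y))) \<in> borel_measurable (PiM I (\<lambda>_. std_normal_measure))"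
    if "f \<in> borel_measurable (PiM (insert i I) (\<lambda>_. std_normal_measure))" for f :: "_ \<Rightarrow> ennreal" and y
    using measurable_compose[OF measurable_Pair1' upd[OF that], of y] by simp
  have "U y * V z ^ k \<le> ennreal (exp (real k / (real k + 1) * (y - z)\<^sup>2 / 2))" for y z
  proof -
    define e where "e = real k / (real k + 1) * (y - z)\<^sup>2 / 2"
    have "(\<integral>\<^sup>+x. ennreal (exp (- e)) * u (x(i := y)) \<partial>PiM I (\<lambda>_. std_normal_measure)) * V z ^ k \<le> 1"
      unfolding V_def
    proof (rule insert.IH)
      fix x x' assume x: "x \<in> space (PiM I (\<lambda>_. std_normal_measure))" "x' \<in> space (PiM I (\<lambda>_. std_normal_measure))"
      have "u (x(i := y)) * v (x'(i := z)) ^ k \<le>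
         ennreal (exp (real k / (real k + 1) * (\<Sum>j\<in>insert i I. ((x(i := y)) j - (x'(i := z)) j)\<^sup>2) / 2))"
        using x by (intro insert.prems) (auto simp: space_PiM PiE_def extensional_def)
      also have "(\<Sum>j\<in>insert i I. ((x(i := y)) j - (x'(i := z)) j)\<^sup>2) = (y - z)\<^sup>2 + (\<Sum>j\<in>I. (x j - x' j)\<^sup>2)"
        using insert.hyps by (auto intro!: sum.cong)
      also have "real k / (real k + 1) * ((y - z)\<^sup>2 + (\<Sum>j\<in>I. (x j - x' j)\<^sup>2)) / 2
         = e + real k / (real k + 1) * (\<Sum>j\<in>I. (x j - x' j)\<^sup>2) / 2"
        by (simp add: e_def algebra_simps add_divide_distrib)
      finally have "ennreal (exp (- e)) * (u (x(i := y)) * v (x'(i := z)) ^ k)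
         \<le> ennreal (exp (- e)) * ennreal (exp (e + real k / (real k + 1) * (\<Sum>j\<in>I. (x j - x' j)\<^sup>2) / 2))"
        by (rule mult_left_mono) simp
      also have "\<dots> = ennreal (exp (real k / (real k + 1) * (\<Sum>j\<in>I. (x j - x' j)\<^sup>2) / 2))"
        by (simp add: ennreal_mult[symmetric] exp_add[symmetric])
      finally show "ennreal (exp (- e)) * u (x(i := y)) * v (x'(i := z)) ^ k
         \<le> ennreal (exp (real k / (real k + 1) * (\<Sum>j\<in>I. (x j - x' j)\<^sup>2) / 2))"
        by (simp add: mult.assoc)
    qed (rule borel_measurable_times_ennreal[OF borel_measurable_const sec[OF insert.prems(1)]],
         rule sec[OF insert.prems(2)])
    then have "ennreal (exp (- e)) * (U y * V z ^ k) \<le> 1"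
      using sec insert.prems by (simp add: nn_integral_cmult U_def mult.assoc)
    then have "ennreal (exp e) * (ennreal (exp (- e)) * (U y * V z ^ k)) \<le> ennreal (exp e) * 1"
      by (rule mult_left_mono) simp
    then show ?thesis
      by (simp add: mult.assoc[symmetric] ennreal_mult[symmetric] exp_add[symmetric] e_def)
  qed
  then have "(\<integral>\<^sup>+x. U x \<partial>std_normal_measure) * (\<integral>\<^sup>+x. V x \<partial>std_normal_measure) ^ k \<le> 1"
    using mUV k by (intro std_normal_transport_real)
  then show ?case
    using insert.prems insert.hyps
    by (simp add: P.product_nn_integral_insert_rev U_def V_def)
qed

lemma prod_Basis_vec_real:
  "(\<Prod>b\<in>(Basis :: (real ^ 'N) set). f b) = (\<Prod>i\<in>UNIV. f (axis i 1))"
proof -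
  have "(Basis :: (real ^ 'N) set) = range (\<lambda>i. axis i 1)"
    by (auto simp: Basis_vec_def)
  moreover have "inj (\<lambda>i. axis i 1 :: real ^ 'N)"
    by (auto simp: inj_def axis_eq_axis)
  ultimately show ?thesis using prod.reindex[of "\<lambda>i. axis i 1" UNIV f] by (simp add: o_def)
qed

text \<open>Two views of the Gaussian are needed: tensorisation works with the product measure,
  while rotation invariance is read off the density. Agreement on boxes identifies them.\<close>

lemma nn_integral_std_gaussian_PiM:
  fixes f :: "real ^ 'N \<Rightarrow> ennreal"
  assumes [measurable]: "f \<in> borel_measurable borel"
  shows "(\<integral>\<^sup>+x. f x \<partial>std_gaussian) = (\<integral>\<^sup>+x. f (\<chi> i. x i) \<partial>PiM UNIV (\<lambda>_. std_normal_measure))"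
proof -
  interpret N: prob_space std_normal_measure by (rule prob_space_std_normal_measure)
  interpret P: product_sigma_finite "\<lambda>_::'N. std_normal_measure" by standard
  have sg: "sets (std_gaussian :: (real ^ 'N) measure) = sets borel" by (simp add: std_gaussian_def)
  have [measurable]: "(\<lambda>x i. x $ i) \<in> measurable borel (PiM UNIV (\<lambda>_::'N. std_normal_measure))"
    by (rule measurable_PiM_single') (auto simp: space_PiM)
  have [measurable]: "(\<lambda>x. \<chi> i. x i) \<in> borel_measurable (PiM UNIV (\<lambda>_::'N. std_normal_measure))"
    by (subst borel_measurable_euclidean_space) (auto simp: Basis_vec_def inner_axis)
  have "PiM UNIV (\<lambda>_::'N. std_normal_measure) = distr std_gaussian (PiM UNIV (\<lambda>_::'N. std_normal_measure)) (\<lambda>x i. x $ i)"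
  proof (rule P.PiM_eqI[symmetric])
    fix A :: "'N \<Rightarrow> real set" assume "\<And>i. i \<in> UNIV \<Longrightarrow> A i \<in> sets std_normal_measure"
    then have A [measurable]: "A i \<in> sets borel" for i by simp
    have [measurable]: "(\<lambda>x::real^'N. \<Prod>i\<in>UNIV. indicator (A i) (x $ i) :: ennreal) \<in> borel_measurable borel"
      by measurable
    have "emeasure (distr std_gaussian (PiM UNIV (\<lambda>_::'N. std_normal_measure)) (\<lambda>x i. x $ i)) (Pi\<^sub>E UNIV A)
      = (\<integral>\<^sup>+x. (\<Prod>i\<in>UNIV. indicator (A i) (x $ i)) \<partial>std_gaussian)"
    proof -
      have "(\<integral>\<^sup>+x. (\<Prod>i\<in>UNIV. indicator (A i) (x $ i)) \<partial>std_gaussian)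
        = (\<integral>\<^sup>+x. indicator {x. \<forall>i. x $ i \<in> A i} x \<partial>std_gaussian)"
        by (intro nn_integral_cong) (auto simp: indicator_def prod_zero_iff intro!: prod.neutral)
      also have "\<dots> = emeasure std_gaussian {x. \<forall>i. x $ i \<in> A i}"
        by (intro nn_integral_indicator) (simp add: sg)
      also have "\<dots> = emeasure (distr std_gaussian (PiM UNIV (\<lambda>_::'N. std_normal_measure)) (\<lambda>x i. x $ i)) (Pi\<^sub>E UNIV A)"
      proof -
        have PE: "Pi\<^sub>E UNIV A \<in> sets (PiM UNIV (\<lambda>_::'N. std_normal_measure))"
          by (rule sets_PiM_I_finite) auto
        have "{x. \<forall>i. x $ i \<in> A i} = (\<lambda>x i. x $ i) -` Pi\<^sub>E UNIV A \<inter> space std_gaussian"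
          by (auto simp: sets_eq_imp_space_eq[OF sg] PiE_UNIV_domain)
        then show ?thesis
          by (subst emeasure_distr[OF _ PE]) (simp_all add: measurable_cong_sets[OF sg refl])
      qed
      finally show ?thesis by simp
    qed
    also have "\<dots> = (\<integral>\<^sup>+x. (\<Prod>i\<in>UNIV. ennreal (std_normal_density (x $ i)) * indicator (A i) (x $ i)) \<partial>lborel)"
      unfolding std_gaussian_def
      by (subst nn_integral_density) (auto simp: prod.distrib prod_ennreal)
    \<comment> \<open>The product formula for \<open>lborel\<close> is indexed by
      \<open>Basis\<close>; \<open>THE i. b = axis i 1\<close> recovers the coordinate belonging to
      a basis vector.\<close>
    also have "\<dots> = (\<integral>\<^sup>+x. (\<Prod>b\<in>(Basis :: (real^'N) set). (\<lambda>b t. ennreal (std_normal_density t) * indicator (A (THE i. b = axis i 1)) t) b (x \<bullet> b)) \<partial>lborel)"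
      by (simp add: prod_Basis_vec_real inner_axis axis_eq_axis)
    also have "\<dots> = (\<Prod>b\<in>(Basis :: (real^'N) set). \<integral>\<^sup>+t. ennreal (std_normal_density t) * indicator (A (THE i. b = axis i 1)) t \<partial>lborel)"
      by (rule nn_integral_lborel_prod) auto
    also have "\<dots> = (\<Prod>i\<in>UNIV. emeasure std_normal_measure (A i))"
      by (simp add: prod_Basis_vec_real axis_eq_axis emeasure_density)
    finally show "emeasure (distr std_gaussian (PiM UNIV (\<lambda>_::'N. std_normal_measure)) (\<lambda>x i. x $ i)) (Pi\<^sub>E UNIV A)
      = (\<Prod>i\<in>UNIV. emeasure std_normal_measure (A i))" .
  qed auto
  then have "(\<integral>\<^sup>+x. f (\<chi> i. x i) \<partial>PiM UNIV (\<lambda>_. std_normal_measure)) =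
     (\<integral>\<^sup>+x. f (\<chi> i. x i) \<partial>distr std_gaussian (PiM UNIV (\<lambda>_::'N. std_normal_measure)) (\<lambda>x i. x $ i))"
    by simp
  also have "\<dots> = (\<integral>\<^sup>+x. f x \<partial>std_gaussian)"
    by (subst nn_integral_distr) (auto simp: measurable_cong_sets[OF sg refl])
  finally show ?thesis by simp
qed

lemma std_gaussian_transport:
  fixes u v :: "real ^ 'N \<Rightarrow> ennreal"
  assumes [measurable]: "u \<in> borel_measurable borel" "v \<in> borel_measurable borel" and k: "k > 0"
    and le: "\<And>x y. u x * v y ^ k \<le> ennreal (exp (real k / (real k + 1) * (norm (x - y))\<^sup>2 / 2))"
  shows "(\<integral>\<^sup>+x. u x \<partial>std_gaussian) * (\<integral>\<^sup>+x. v x \<partial>std_gaussian) ^ k \<le> 1"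
proof -
  have [measurable]: "(\<lambda>x. \<chi> i. x i) \<in> borel_measurable (PiM UNIV (\<lambda>_::'N. std_normal_measure))"
    by (subst borel_measurable_euclidean_space) (auto simp: Basis_vec_def inner_axis)
  show ?thesis
    unfolding nn_integral_std_gaussian_PiM[OF assms(1)] nn_integral_std_gaussian_PiM[OF assms(2)]
  proof (rule std_normal_transport_PiM)
    fix x y :: "'N \<Rightarrow> real"
    have "(norm ((\<chi> i. x i) - (\<chi> i. y i) :: real ^ 'N))\<^sup>2 = (\<Sum>i\<in>UNIV. (x i - y i)\<^sup>2)"
      by (simp add: norm_vec_def L2_set_def sum_nonneg)
    then show "u (\<chi> i. x i) * v (\<chi> i. y i) ^ k
      \<le> ennreal (exp (real k / (real k + 1) * (\<Sum>i\<in>UNIV. (x i - y i)\<^sup>2) / 2))"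
      using le[of "\<chi> i. x i" "\<chi> i. y i"] by simp
  qed (use k in auto)
qed

section \<open>Translation and rotation invariance of Lebesgue and Gaussian integrals\<close>

lemma nn_integral_lborel_translation:
  fixes f :: "'a::euclidean_space \<Rightarrow> ennreal"
  assumes [measurable]: "f \<in> borel_measurable borel"
  shows "(\<integral>\<^sup>+x. f (c + x) \<partial>lborel) = (\<integral>\<^sup>+x. f x \<partial>lborel)"
proof -
  have "(\<integral>\<^sup>+x. f x \<partial>lborel) = (\<integral>\<^sup>+x. f x \<partial>distr lborel borel ((+) c))"
    by (simp add: lborel_distr_plus)
  also have "\<dots> = (\<integral>\<^sup>+x. f (c + x) \<partial>lborel)"
    by (subst nn_integral_distr) auto
  finally show ?thesis by simp
qed

lemma emeasure_lborel_ball_translation: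
  fixes x :: "'a::euclidean_space"
  shows "emeasure lborel (ball x r) = emeasure lborel (ball (0 :: 'a) r)"
proof -
  have shift: "(\<lambda>y. indicator (ball x r) (x + y) :: ennreal) = indicator (ball (0 :: 'a) r)"
    by (auto simp: indicator_def dist_norm)
  have "emeasure lborel (ball x r) = (\<integral>\<^sup>+y. indicator (ball x r) y \<partial>lborel)" by simp
  also have "\<dots> = (\<integral>\<^sup>+y. indicator (ball x r) (x + y) \<partial>lborel)"
    by (rule nn_integral_lborel_translation[symmetric]) (intro borel_measurable_indicator, simp)
  finally show ?thesis unfolding shift by simp
qed

text \<open>Both sides are compared by
  averaging over the unit ball, whose translates and rotations all have the same volume.\<close>

lemma nn_integral_lborel_orthogonal:
  fixes U :: "'a::euclidean_space \<Rightarrow> 'a" and f :: "'a \<Rightarrow> ennreal"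
  assumes U: "orthogonal_transformation U" and [measurable]: "f \<in> borel_measurable borel"
  shows "(\<integral>\<^sup>+x. f (U x) \<partial>lborel) = (\<integral>\<^sup>+x. f x \<partial>lborel)"
proof -
  have lin: "linear U" using U by (rule orthogonal_transformation_linear)
  then have [measurable]: "U \<in> borel_measurable borel"
    by (intro borel_measurable_continuous_onI linear_continuous_on linear_conv_bounded_linear[THEN iffD1])
  define B :: "'a set" where "B = ball 0 1"
  have [measurable]: "B \<in> sets borel" by (simp add: B_def)
  have surjU: "\<exists>z. U z = y" for y
    using orthogonal_transformation_surj[OF U] by (metis surjD)
  have "(\<integral>\<^sup>+x. f (U x) \<partial>lborel) * emeasure lborel B = (\<integral>\<^sup>+y. (\<integral>\<^sup>+x. f (U x) \<partial>lborel) * indicator B y \<partial>lborel)"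
    by (simp add: nn_integral_cmult)
  also have "\<dots> = (\<integral>\<^sup>+y. \<integral>\<^sup>+x. f (U x + y) * indicator B y \<partial>lborel \<partial>lborel)"
  proof (intro nn_integral_cong)
    fix y
    obtain z where z: "U z = y" using surjU by blast
    have "(\<integral>\<^sup>+x. f (U x) \<partial>lborel) = (\<integral>\<^sup>+x. f (U (z + x)) \<partial>lborel)"
      by (rule nn_integral_lborel_translation[symmetric]) measurable
    also have "\<dots> = (\<integral>\<^sup>+x. f (U x + y) \<partial>lborel)"
      using lin z by (simp add: linear_add add.commute)
    finally show "(\<integral>\<^sup>+x. f (U x) \<partial>lborel) * indicator B y = (\<integral>\<^sup>+x. f (U x + y) * indicator B y \<partial>lborel)"
      by (simp add: nn_integral_multc)
  qed
  also have "\<dots> = (\<integral>\<^sup>+x. \<integral>\<^sup>+y. f (U x + y) * indicator B y \<partial>lborel \<partial>lborel)"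
    by (rule lborel_pair.Fubini') measurable
  also have "\<dots> = (\<integral>\<^sup>+x. \<integral>\<^sup>+y. f y * indicator B (y - U x) \<partial>lborel \<partial>lborel)"
  proof (rule nn_integral_cong)
    fix x
    have "(\<integral>\<^sup>+y. f (U x + y) * indicator B (U x + y - U x) \<partial>lborel) = (\<integral>\<^sup>+y. f y * indicator B (y - U x) \<partial>lborel)"
      by (rule nn_integral_lborel_translation) measurable
    then show "(\<integral>\<^sup>+y. f (U x + y) * indicator B y \<partial>lborel) = (\<integral>\<^sup>+y. f y * indicator B (y - U x) \<partial>lborel)"
      by simp
  qed
  also have "\<dots> = (\<integral>\<^sup>+y. \<integral>\<^sup>+x. f y * indicator B (y - U x) \<partial>lborel \<partial>lborel)"
    by (rule lborel_pair.Fubini'[symmetric]) measurable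
  also have "\<dots> = (\<integral>\<^sup>+y. f y * emeasure lborel B \<partial>lborel)"
  proof (intro nn_integral_cong)
    fix y
    obtain z where z: "U z = y" using surjU by blast
    have "norm (U x - y) = norm (z - x)" for x
      using lin U z by (metis linear_diff orthogonal_transformation_norm norm_minus_commute)
    then have "indicator B (y - U x) = (indicator (ball z 1) x :: ennreal)" for x
      by (simp add: B_def indicator_def dist_norm norm_minus_commute)
    then show "(\<integral>\<^sup>+x. f y * indicator B (y - U x) \<partial>lborel) = f y * emeasure lborel B"
      using emeasure_lborel_ball_translation[of z 1] by (simp add: nn_integral_cmult_indicator B_def)
  qed
  also have "\<dots> = (\<integral>\<^sup>+y. f y \<partial>lborel) * emeasure lborel B"
    by (rule nn_integral_multc) auto
  finally have "(\<integral>\<^sup>+x. f (U x) \<partial>lborel) * emeasure lborel B = (\<integral>\<^sup>+y. f y \<partial>lborel) * emeasure lborel B" .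
  moreover have "unit_ball_vol (real DIM('a)) \<noteq> 0"
    by (rule less_imp_neq[symmetric]) simp
  then have "emeasure lborel B \<noteq> 0" "emeasure lborel B \<noteq> \<top>"
    using emeasure_ball[of 1 "0::'a"] by (simp_all add: B_def)
  ultimately show ?thesis
    by (metis ennreal_mult_divide_eq)
qed

lemma std_gaussian_density:
  "(\<Prod>i\<in>UNIV. std_normal_density ((x :: real ^ 'N) $ i)) = (1 / sqrt (2 * pi)) ^ CARD('N) * exp (- (norm x)\<^sup>2 / 2)"
proof -
  have "(\<Prod>i\<in>UNIV. std_normal_density (x $ i)) = (1 / sqrt (2 * pi)) ^ CARD('N) * exp (\<Sum>i\<in>UNIV. - (x $ i)\<^sup>2 / 2)"
    unfolding std_normal_density_def prod.distrib exp_sum[OF finite] by simp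
  also have "(\<Sum>i\<in>UNIV. - (x $ i)\<^sup>2 / 2) = - (norm x)\<^sup>2 / 2"
    by (simp add: norm_vec_def L2_set_def sum_nonneg sum_negf sum_divide_distrib)
  finally show ?thesis .
qed

lemma sets_std_gaussian [simp, measurable_cong]: "sets std_gaussian = sets borel"
  by (simp add: std_gaussian_def)

lemma space_std_gaussian [simp]: "space std_gaussian = UNIV"
  by (simp add: std_gaussian_def)

lemma nn_integral_std_gaussian:
  fixes f :: "real ^ 'N \<Rightarrow> ennreal"
  assumes [measurable]: "f \<in> borel_measurable borel"
  shows "(\<integral>\<^sup>+x. f x \<partial>std_gaussian) =
    (\<integral>\<^sup>+x. ennreal ((1 / sqrt (2 * pi)) ^ CARD('N) * exp (- (norm x)\<^sup>2 / 2)) * f x \<partial>lborel)"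
  unfolding std_gaussian_def std_gaussian_density by (subst nn_integral_density) auto

lemma nn_integral_std_gaussian_orthogonal:
  fixes U :: "real ^ 'N \<Rightarrow> real ^ 'N" and f :: "real ^ 'N \<Rightarrow> ennreal"
  assumes U: "orthogonal_transformation U" and [measurable]: "f \<in> borel_measurable borel"
  shows "(\<integral>\<^sup>+x. f (U x) \<partial>std_gaussian) = (\<integral>\<^sup>+x. f x \<partial>std_gaussian)"
proof -
  have [measurable]: "U \<in> borel_measurable borel"
    using orthogonal_transformation_linear[OF U]
    by (intro borel_measurable_continuous_onI linear_continuous_on linear_conv_bounded_linear[THEN iffD1])
  let ?g = "\<lambda>x::real^'N. ennreal ((1 / sqrt (2 * pi)) ^ CARD('N) * exp (- (norm x)\<^sup>2 / 2)) * f x"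
  have "(\<integral>\<^sup>+x. f (U x) \<partial>std_gaussian) = (\<integral>\<^sup>+x. ?g (U x) \<partial>lborel)"
    by (subst nn_integral_std_gaussian) (auto simp: orthogonal_transformation_norm[OF U])
  also have "\<dots> = (\<integral>\<^sup>+x. ?g x \<partial>lborel)"
    by (rule nn_integral_lborel_orthogonal[OF U]) measurable
  finally show ?thesis by (simp add: nn_integral_std_gaussian)
qed

lemma distr_std_gaussian_orthogonal:
  fixes U :: "real ^ 'N \<Rightarrow> real ^ 'N"
  assumes U: "orthogonal_transformation U"
  shows "distr std_gaussian borel U = std_gaussian"
proof (rule measure_eqI)
  have [measurable]: "U \<in> borel_measurable borel"
    using orthogonal_transformation_linear[OF U]
    by (intro borel_measurable_continuous_onI linear_continuous_on linear_conv_bounded_linear[THEN iffD1])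
  fix A assume "A \<in> sets (distr std_gaussian borel U)"
  then have [measurable]: "A \<in> sets borel" by simp
  have "emeasure (distr std_gaussian borel U) A = (\<integral>\<^sup>+x. indicator A x \<partial>distr std_gaussian borel U)" by simp
  also have "\<dots> = (\<integral>\<^sup>+x. indicator A (U x) \<partial>std_gaussian)" by (rule nn_integral_distr) auto
  also have "\<dots> = (\<integral>\<^sup>+x. indicator A x \<partial>std_gaussian)"
    by (rule nn_integral_std_gaussian_orthogonal[OF U]) simp
  also have "\<dots> = emeasure std_gaussian A" by (rule nn_integral_indicator) simp
  finally show "emeasure (distr std_gaussian borel U) A = emeasure std_gaussian A" .
qed simp

section \<open>Gaussian and spherical concentration\<close>

lemma prob_space_std_gaussian: "prob_space (std_gaussian :: (real ^ 'N) measure)"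
proof
  interpret N: prob_space std_normal_measure by (rule prob_space_std_normal_measure)
  interpret P: product_prob_space "\<lambda>_::'N. std_normal_measure" UNIV by standard
  have "emeasure std_gaussian (UNIV :: (real ^ 'N) set) = (\<integral>\<^sup>+x. indicator (UNIV :: (real ^ 'N) set) x \<partial>std_gaussian)" by simp
  also have "\<dots> = (\<integral>\<^sup>+x. indicator (UNIV :: (real ^ 'N) set) (\<chi> i. x i) \<partial>PiM UNIV (\<lambda>_::'N. std_normal_measure))"
    by (rule nn_integral_std_gaussian_PiM) simp
  also have "\<dots> = 1" using P.emeasure_space_1 by simp
  finally show "emeasure (std_gaussian :: (real ^ 'N) measure) (space std_gaussian) = 1" by simp
qed

interpretation std_gaussian: prob_space "std_gaussian :: (real ^ 'N) measure"
  by (rule prob_space_std_gaussian)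

lemma nn_integral_std_gaussian_component:
  assumes [measurable]: "f \<in> borel_measurable borel"
  shows "(\<integral>\<^sup>+x. f (x $ i) \<partial>(std_gaussian :: (real ^ 'N) measure)) = (\<integral>\<^sup>+t. f t \<partial>std_normal_measure)"
proof -
  interpret N: prob_space std_normal_measure by (rule prob_space_std_normal_measure)
  have "(\<integral>\<^sup>+x. f (x $ i) \<partial>(std_gaussian :: (real ^ 'N) measure))
    = (\<integral>\<^sup>+x. f (x i) \<partial>PiM UNIV (\<lambda>_. std_normal_measure))"
    by (subst nn_integral_std_gaussian_PiM) auto
  also have "\<dots> = (\<integral>\<^sup>+t. f t \<partial>distr (PiM UNIV (\<lambda>_. std_normal_measure)) std_normal_measure (\<lambda>x. x i))"
    by (subst nn_integral_distr) auto
  also have "distr (PiM UNIV (\<lambda>_. std_normal_measure)) std_normal_measure (\<lambda>x. x i) = std_normal_measure"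
    by (rule distr_PiM_component) (auto intro: prob_space_std_normal_measure)
  finally show ?thesis .
qed

lemma integrable_std_gaussian_norm: "integrable std_gaussian (\<lambda>x :: real ^ 'N. norm x)"
proof -
  have comp: "integrable std_gaussian (\<lambda>x :: real ^ 'N. \<bar>x $ i\<bar>)" for i
  proof (rule integrableI_nonneg)
    have "(\<integral>\<^sup>+x. ennreal \<bar>x $ i\<bar> \<partial>(std_gaussian :: (real ^ 'N) measure)) = (\<integral>\<^sup>+t. ennreal \<bar>t\<bar> \<partial>std_normal_measure)"
      by (rule nn_integral_std_gaussian_component) simp
    also have "\<dots> = (\<integral>\<^sup>+t. ennreal (std_normal_density t * \<bar>t\<bar> ^ 1) \<partial>lborel)"
      by (subst nn_integral_density) (auto simp: ennreal_mult)
    also have "\<dots> < \<infinity>"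
      using integrable_std_normal_moment_abs[of 1] by (simp add: integrable_iff_bounded abs_mult)
    finally show "(\<integral>\<^sup>+x. ennreal \<bar>x $ i\<bar> \<partial>(std_gaussian :: (real ^ 'N) measure)) < \<infinity>" .
  qed auto
  show ?thesis
  proof (rule Bochner_Integration.integrable_bound)
    show "integrable std_gaussian (\<lambda>x :: real ^ 'N. \<Sum>i\<in>UNIV. \<bar>x $ i\<bar>)" using comp by auto
    show "AE x in (std_gaussian :: (real ^ 'N) measure). norm (norm x) \<le> norm (\<Sum>i\<in>UNIV. \<bar>x $ i\<bar>)"
      using norm_le_l1_cart by (intro AE_I2) (simp add: sum_nonneg)
  qed simp
qed

lemma integrable_std_gaussian_norm_bound:
  fixes f :: "real ^ 'N \<Rightarrow> real"
  assumes "f \<in> borel_measurable borel" "\<And>x. \<bar>f x\<bar> \<le> c * norm x"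
  shows "integrable std_gaussian f"
proof (rule Bochner_Integration.integrable_bound)
  show "integrable std_gaussian (\<lambda>x :: real ^ 'N. c * norm x)"
    by (intro integrable_mult_right integrable_std_gaussian_norm)
  show "AE x in (std_gaussian :: (real ^ 'N) measure). norm (f x) \<le> norm (c * norm x)"
  proof (rule AE_I2)
    show "norm (f x) \<le> norm (c * norm x)" for x
      using assms(2)[of x] by (metis abs_ge_self order_trans real_norm_def)
  qed
qed (use assms in simp)

lemma integral_std_gaussian_odd:
  fixes f :: "real ^ 'N \<Rightarrow> real"
  assumes [measurable]: "f \<in> borel_measurable borel" and odd: "\<And>x. f (- x) = - f x"
  shows "(\<integral>x. f x \<partial>std_gaussian) = 0"
proof -
  have U: "orthogonal_transformation (uminus :: real ^ 'N \<Rightarrow> real ^ 'N)"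
    by (simp add: orthogonal_transformation linear_uminus)
  have "(\<integral>x. f x \<partial>std_gaussian) = (\<integral>x. f x \<partial>distr std_gaussian borel uminus)"
    by (simp add: distr_std_gaussian_orthogonal[OF U])
  also have "\<dots> = (\<integral>x. - f x \<partial>std_gaussian)"
    by (subst integral_distr) (auto simp: odd)
  finally show ?thesis by simp
qed

lemma ennreal_integral_le_nn_integral:
  fixes f :: "'a \<Rightarrow> real"
  assumes "integrable M f"
  shows "ennreal (\<integral>x. f x \<partial>M) \<le> (\<integral>\<^sup>+x. ennreal (f x) \<partial>M)"
proof -
  have "ennreal (\<integral>x. f x \<partial>M) \<le> ennreal (\<integral>x. max 0 (f x) \<partial>M)"
    using assms by (intro ennreal_leI integral_mono) auto
  also have "\<dots> = (\<integral>\<^sup>+x. ennreal (max 0 (f x)) \<partial>M)"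
    using assms by (intro nn_integral_eq_integral[symmetric]) auto
  also have "\<dots> = (\<integral>\<^sup>+x. ennreal (f x) \<partial>M)"
    by (intro nn_integral_cong) (simp add: max_def ennreal_neg)
  finally show ?thesis .
qed

text \<open>Integrate the tangent line of \<open>exp\<close> at the mean \<open>m\<close>. The
  right-hand side is a \<open>nn_integral\<close>, so it may be infinite.\<close>

lemma ennreal_integral_exp_Jensen:
  assumes "prob_space M" "integrable M f"
  shows "ennreal (exp (\<integral>x. f x \<partial>M)) \<le> (\<integral>\<^sup>+x. ennreal (exp (f x)) \<partial>M)"
proof -
  interpret prob_space M by fact
  define m where "m = (\<integral>x. f x \<partial>M)"
  have "exp m = (\<integral>x. exp m * (1 + (f x - m)) \<partial>M)"
    using assms by (simp add: m_def prob_space)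
  also have "ennreal \<dots> \<le> (\<integral>\<^sup>+x. ennreal (exp m * (1 + (f x - m))) \<partial>M)"
    using assms by (intro ennreal_integral_le_nn_integral) auto
  also have "\<dots> \<le> (\<integral>\<^sup>+x. ennreal (exp (f x)) \<partial>M)"
  proof (intro nn_integral_mono ennreal_leI)
    fix x
    have "exp m * (1 + (f x - m)) \<le> exp m * exp (f x - m)"
      using exp_ge_add_one_self[of "f x - m"] by (intro mult_left_mono) auto
    then show "exp m * (1 + (f x - m)) \<le> exp (f x)" by (simp add: exp_add[symmetric])
  qed
  finally show ?thesis by (simp add: m_def)
qed

text \<open>Gaussian concentration with the optimal constant: the choice
  \<open>u = exp (l f - c)\<close>, \<open>v = exp (- l f / k)\<close> in the transport inequality gives the bound with
  \<open>(k + 1) / k\<close> in front of the variance term, and \<open>k\<close> is then sent to infinity.\<close>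

lemma std_gaussian_lipschitz_mgf:
  fixes f :: "real ^ 'N \<Rightarrow> real"
  assumes lip: "\<And>x y. \<bar>f x - f y\<bar> \<le> norm (x - y)"
    and [measurable]: "f \<in> borel_measurable borel" and int: "integrable std_gaussian f" and l: "0 \<le> l"
  shows "(\<integral>\<^sup>+x. ennreal (exp (l * f x)) \<partial>std_gaussian)
     \<le> ennreal (exp (l * (\<integral>x. f x \<partial>std_gaussian) + l\<^sup>2 / 2))"
proof -
  define m where "m = (\<integral>x. f x \<partial>std_gaussian)"
  have step: "(\<integral>\<^sup>+x. ennreal (exp (l * f x)) \<partial>std_gaussian) \<le> ennreal (exp (l * m + l\<^sup>2 / 2 * (1 + 1 / real (Suc j))))" for j
  proof -
    define k where "k = Suc j"
    have k: "k > 0" by (simp add: k_def)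
    define c where "c = l\<^sup>2 / 2 * (1 + 1 / real k)"
    let ?I = "\<integral>\<^sup>+x. ennreal (exp (l * f x)) \<partial>std_gaussian"
    let ?V = "\<integral>\<^sup>+x. ennreal (exp (- l / real k * f x)) \<partial>std_gaussian"
    have "(\<integral>\<^sup>+x. ennreal (exp (- c)) * ennreal (exp (l * f x)) \<partial>std_gaussian) * ?V ^ k \<le> 1"
    proof (rule std_gaussian_transport[OF _ _ k])
      fix x y :: "real ^ 'N"
      define d where "d = norm (x - y)"
      have "l * (f x - f y) \<le> l * d"
        using lip[of x y] l by (intro mult_left_mono) (auto simp: d_def)
      then have "l * f x - l * f y \<le> l * d" by (simp only: right_diff_distrib)
      \<comment> \<open>Completing the square shows that \<open>c\<close> is the maximum over
        \<open>d\<close> of \<open>l * d\<close> minus the transport cost, so \<open>c\<close> is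
        the best constant for this choice of functions.\<close>
      moreover have "0 \<le> (real k * d - (real k + 1) * l)\<^sup>2 / (2 * real k * (real k + 1))"
        by simp
      moreover have "(real k * d - (real k + 1) * l)\<^sup>2 / (2 * real k * (real k + 1))
          = real k / (real k + 1) * d\<^sup>2 / 2 + c - l * d"
        using k by (simp add: c_def divide_simps power2_eq_square) (simp add: algebra_simps)
      ultimately have "- c + l * f x - l * f y \<le> real k / (real k + 1) * d\<^sup>2 / 2"
        by linarith
      moreover have "ennreal (exp (- c)) * ennreal (exp (l * f x)) * ennreal (exp (- l / real k * f y)) ^ k
          = ennreal (exp (- c + l * f x - l * f y))"
        using k by (simp add: ennreal_power ennreal_mult[symmetric] exp_of_nat_mult[symmetric] exp_add[symmetric])
      ultimately show "ennreal (exp (- c)) * ennreal (exp (l * f x)) * ennreal (exp (- l / real k * f y)) ^ k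
         \<le> ennreal (exp (real k / (real k + 1) * (norm (x - y))\<^sup>2 / 2))"
        by (simp add: d_def)
    qed auto
    then have le1: "ennreal (exp (- c)) * ?I * ?V ^ k \<le> 1"
      by (simp add: nn_integral_cmult)
    \<comment> \<open>Jensen bounds \<open>?V ^ k\<close> below by \<open>exp (- l * m)\<close> for
      every \<open>k\<close>; this is how the mean of \<open>f\<close> enters the bound.\<close>
    have "ennreal (exp (- l / real k * m)) \<le> ?V"
      using ennreal_integral_exp_Jensen[OF prob_space_std_gaussian, of "\<lambda>x. - l / real k * f x"] int
      by (simp add: m_def)
    then have "ennreal (exp (- l / real k * m)) ^ k \<le> ?V ^ k"
      by (rule power_mono) simp
    also have "ennreal (exp (- l / real k * m)) ^ k = ennreal (exp (- l * m))"
      using k by (simp add: ennreal_power exp_of_nat_mult[symmetric])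
    finally have "ennreal (exp (- c)) * ?I * ennreal (exp (- l * m)) \<le> 1"
      using le1 by (meson mult_left_mono order_trans zero_le)
    then have "ennreal (exp (c + l * m)) * (ennreal (exp (- c)) * ?I * ennreal (exp (- l * m))) \<le> ennreal (exp (c + l * m)) * 1"
      by (rule mult_left_mono) simp
    also have "ennreal (exp (c + l * m)) * (ennreal (exp (- c)) * ?I * ennreal (exp (- l * m)))
       = (ennreal (exp (c + l * m)) * ennreal (exp (- c)) * ennreal (exp (- l * m))) * ?I"
      by (simp only: mult_ac)
    also have "ennreal (exp (c + l * m)) * ennreal (exp (- c)) * ennreal (exp (- l * m)) = 1"
      by (simp add: ennreal_mult[symmetric] exp_add[symmetric])
    finally show ?thesis by (simp add: c_def k_def add.commute)
  qed
  have "(\<lambda>j. l * m + l\<^sup>2 / 2 * (1 + 1 / real (Suc j))) \<longlonglongrightarrow> l * m + l\<^sup>2 / 2 * (1 + 0)"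
    by (intro tendsto_intros LIMSEQ_Suc[OF lim_1_over_n])
  then have "(\<lambda>j. ennreal (exp (l * m + l\<^sup>2 / 2 * (1 + 1 / real (Suc j))))) \<longlonglongrightarrow> ennreal (exp (l * m + l\<^sup>2 / 2))"
    by (intro tendsto_ennrealI tendsto_exp) simp
  from LIMSEQ_le_const[OF this, of "\<integral>\<^sup>+x. ennreal (exp (l * f x)) \<partial>std_gaussian"] step
  show ?thesis by (auto simp only: m_def)
qed

section \<open>Directions of rotation invariant random vectors\<close>

lemma borel_measurable_orthogonal:
  fixes U :: "real ^ 'N \<Rightarrow> real ^ 'N"
  assumes "orthogonal_transformation U"
  shows "U \<in> borel_measurable borel"
  using orthogonal_transformation_linear[OF assms]
  by (intro borel_measurable_continuous_onI linear_continuous_on linear_conv_bounded_linear[THEN iffD1])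

lemma sgn_orthogonal:
  fixes U :: "real ^ 'N \<Rightarrow> real ^ 'N"
  assumes "orthogonal_transformation U"
  shows "sgn (U x) = U (sgn x)"
  using assms by (simp add: sgn_div_norm orthogonal_transformation_norm linear_scale[OF orthogonal_transformation_linear])

lemma borel_measurable_sgn_vec [measurable]: "(sgn :: real ^ 'N \<Rightarrow> real ^ 'N) \<in> borel_measurable borel"
  unfolding sgn_div_norm[abs_def] by measurable

lemma std_gaussian_ball_pos:
  fixes x :: "real ^ 'N"
  assumes "r > 0"
  shows "emeasure std_gaussian (ball x r) \<noteq> 0"
proof
  have [measurable]: "ball x r \<in> sets borel" by simp
  assume "emeasure std_gaussian (ball x r) = 0"
  then have "(\<integral>\<^sup>+y. indicator (ball x r) y \<partial>std_gaussian) = 0" by simp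
  then have "(\<integral>\<^sup>+y. ennreal ((1 / sqrt (2 * pi)) ^ CARD('N) * exp (- (norm y)\<^sup>2 / 2)) * indicator (ball x r) y \<partial>lborel) = 0"
    by (subst (asm) nn_integral_std_gaussian) measurable
  then have "AE y in lborel. ennreal ((1 / sqrt (2 * pi)) ^ CARD('N) * exp (- (norm y)\<^sup>2 / 2)) * indicator (ball x r) y = 0"
    by (subst (asm) nn_integral_0_iff_AE) auto
  then have "AE y in lborel. y \<notin> ball x r"
  proof (rule AE_mp, intro AE_I2 impI notI)
    fix y assume y: "y \<in> ball x r"
      and z: "ennreal ((1 / sqrt (2 * pi)) ^ CARD('N) * exp (- (norm y)\<^sup>2 / 2)) * indicator (ball x r) y = 0"
    have "0 < (1 / sqrt (2 * pi)) ^ CARD('N) * exp (- (norm y)\<^sup>2 / 2)"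
      by (intro mult_pos_pos zero_less_power) auto
    moreover have "ennreal ((1 / sqrt (2 * pi)) ^ CARD('N) * exp (- (norm y)\<^sup>2 / 2)) = 0"
      using z unfolding indicator_simps(1)[OF y] mult_1_right .
    ultimately show False unfolding ennreal_eq_0_iff by linarith
  qed
  then have "emeasure lborel (ball x r) = 0"
    by (subst (asm) AE_iff_null_sets[symmetric]) auto
  moreover have "unit_ball_vol (real CARD('N)) \<noteq> 0"
    by (rule less_imp_neq[symmetric]) simp
  ultimately show False
    using assms by (simp add: emeasure_ball)
qed

lemma std_gaussian_AE_nonzero: "AE x in (std_gaussian :: (real ^ 'N) measure). x \<noteq> 0"
proof -
  have "emeasure std_gaussian {0 :: real ^ 'N} = (\<integral>\<^sup>+y. indicator {0 :: real ^ 'N} y \<partial>std_gaussian)" by simp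
  also have "\<dots> = (\<integral>\<^sup>+y. ennreal ((1 / sqrt (2 * pi)) ^ CARD('N) * exp (- (norm y)\<^sup>2 / 2)) * indicator {0 :: real ^ 'N} y \<partial>lborel)"
    by (rule nn_integral_std_gaussian) simp
  also have "\<dots> = (\<integral>\<^sup>+y. 0 \<partial>(lborel :: (real ^ 'N) measure))"
    by (rule nn_integral_cong_AE) (use AE_lborel_singleton[of 0] in \<open>auto simp: indicator_def\<close>)
  finally have "{0 :: real ^ 'N} \<in> null_sets std_gaussian" by (auto simp: null_sets_def)
  then show ?thesis by (rule AE_I'[of "{0}"]) auto
qed

text \<open>Common to the standard Gaussian and to the random normal component of a Gaussian. Both
  have uniformly distributed directions away from the origin, so concentration proved for the first
  transfers to the second.\<close>

definition rotation_invariant :: "(real ^ 'N) measure \<Rightarrow> bool" where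
  "rotation_invariant \<rho> \<longleftrightarrow> prob_space \<rho> \<and> sets \<rho> = sets borel \<and>
     (\<forall>U. orthogonal_transformation U \<longrightarrow> distr \<rho> borel U = \<rho>)"

lemma rotation_invariant_std_gaussian: "rotation_invariant std_gaussian"
  by (simp add: rotation_invariant_def prob_space_std_gaussian distr_std_gaussian_orthogonal)

lemma rotation_invariant_integral:
  fixes f :: "real ^ 'N \<Rightarrow> real"
  assumes "rotation_invariant \<rho>" "orthogonal_transformation U" "f \<in> borel_measurable borel"
  shows "(\<integral>x. f (U x) \<partial>\<rho>) = (\<integral>x. f x \<partial>\<rho>)"
proof -
  have s: "sets \<rho> = sets borel" and d: "distr \<rho> borel U = \<rho>"
    using assms by (auto simp: rotation_invariant_def)
  have "(\<integral>x. f x \<partial>\<rho>) = (\<integral>x. f x \<partial>distr \<rho> borel U)" by (simp add: d)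
  also have "\<dots> = (\<integral>x. f (U x) \<partial>\<rho>)"
    using assms borel_measurable_orthogonal[OF assms(2)] by (subst integral_distr) (auto simp: measurable_cong_sets[OF s refl])
  finally show ?thesis by simp
qed

text \<open>Uniqueness of the rotation invariant distribution on the sphere, in integrated form and with a
  radial weight. The two measures are compared through the kernel
  \<open>indicator (norm (sgn x - sgn y) < e)\<close>, whose marginals are constant by invariance.\<close>

lemma rotation_invariant_polar:
  fixes \<rho> :: "(real ^ 'N) measure" and \<Phi> :: "real ^ 'N \<Rightarrow> real" and \<psi> :: "real \<Rightarrow> real"
  assumes \<rho>: "rotation_invariant \<rho>"
    and [measurable]: "\<psi> \<in> borel_measurable borel" and \<psi>0: "\<psi> 0 = 0" "\<And>r. 0 \<le> \<psi> r"
    and int: "integrable \<rho> (\<lambda>x. \<psi> (norm x))"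
    and cont: "continuous_on UNIV \<Phi>"
  shows "(\<integral>x. \<psi> (norm x) * \<Phi> (sgn x) \<partial>\<rho>) = (\<integral>x. \<psi> (norm x) \<partial>\<rho>) * (\<integral>y. \<Phi> (sgn y) \<partial>std_gaussian)"
proof -
  have s [measurable_cong]: "sets \<rho> = sets borel" using \<rho> by (simp add: rotation_invariant_def)
  interpret R: prob_space \<rho> using \<rho> by (simp add: rotation_invariant_def)
  interpret RG: pair_prob_space \<rho> "std_gaussian :: (real ^ 'N) measure" by standard
  have [measurable]: "\<Phi> \<in> borel_measurable borel" using cont by (rule borel_measurable_continuous_onI)
  have cpt: "compact (\<Phi> ` cball 0 1)"
    using cont by (intro compact_continuous_image) (auto intro: continuous_on_subset)
  obtain C where "\<forall>y\<in>\<Phi> ` cball 0 1. norm y \<le> C"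
    using compact_imp_bounded[OF cpt] unfolding bounded_iff by blast
  then have C: "\<bar>\<Phi> x\<bar> \<le> C" if "norm x \<le> 1" for x
    using that by auto
  have ns: "norm (sgn (x :: real ^ 'N)) \<le> 1" for x by (simp add: norm_sgn)
  define \<Psi> where "\<Psi> = (\<integral>x. \<psi> (norm x) \<partial>\<rho>)"
  define A where "A = (\<integral>x. \<psi> (norm x) * \<Phi> (sgn x) \<partial>\<rho>)"
  define B where "B = (\<integral>y. \<Phi> (sgn y) \<partial>std_gaussian)"
  have \<Psi>nn: "0 \<le> \<Psi>" unfolding \<Psi>_def using \<psi>0 by simp
  have intA: "integrable \<rho> (\<lambda>x. \<psi> (norm x) * \<Phi> (sgn x))"
  proof (rule Bochner_Integration.integrable_bound)
    show "integrable \<rho> (\<lambda>x. C * \<psi> (norm x))" using int by simp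
    show "AE x in \<rho>. norm (\<psi> (norm x) * \<Phi> (sgn x)) \<le> norm (C * \<psi> (norm x))"
    proof (rule AE_I2)
      fix x
      have "\<bar>\<Phi> (sgn x)\<bar> * \<bar>\<psi> (norm x)\<bar> \<le> \<bar>C\<bar> * \<bar>\<psi> (norm x)\<bar>"
        using C[OF ns[of x]] by (intro mult_right_mono) auto
      then show "norm (\<psi> (norm x) * \<Phi> (sgn x)) \<le> norm (C * \<psi> (norm x))"
        by (simp add: abs_mult mult.commute)
    qed
  qed simp
  have close: "\<bar>A - \<Psi> * B\<bar> \<le> w * \<Psi>" if w: "w > 0" for w
  proof -
    have "uniformly_continuous_on (cball 0 1) \<Phi>"
      using cont by (intro compact_uniformly_continuous) (auto intro: continuous_on_subset)
    then obtain e0 where e0: "e0 > 0" "\<And>x y. norm x \<le> 1 \<Longrightarrow> norm y \<le> 1 \<Longrightarrow> norm (x - y) < e0 \<Longrightarrow> \<bar>\<Phi> x - \<Phi> y\<bar> < w"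
      using w unfolding uniformly_continuous_on_def dist_norm by (metis mem_cball_0 real_norm_def norm_minus_commute)
    define e where "e = min e0 (1/2)"
    have e: "e > 0" "e < 1" using e0 by (auto simp: e_def)
    have osc: "\<bar>\<Phi> (sgn x) - \<Phi> (sgn y)\<bar> \<le> w" if "norm (sgn x - sgn y) < e" for x y
      using e0(2)[OF ns ns, of x y] that by (simp add: e_def)
    define K :: "real ^ 'N \<Rightarrow> real ^ 'N \<Rightarrow> real" where "K x y = indicator {p. norm (sgn (fst p) - sgn (snd p)) < e} (x, y)" for x y
    have Kdef: "K x y = (if norm (sgn x - sgn y) < e then 1 else 0)" for x y by (simp add: K_def)
    have Km [measurable]: "(\<lambda>p. K (fst p) (snd p)) \<in> borel_measurable (borel \<Otimes>\<^sub>M borel)"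
      unfolding Kdef by measurable
    have Km1 [measurable]: "(\<lambda>x. K x y) \<in> borel_measurable borel" "(\<lambda>y. K x y) \<in> borel_measurable borel" for x y
      unfolding Kdef by measurable
    have K01: "0 \<le> K x y" "K x y \<le> 1" for x y by (auto simp: Kdef)
    have KU: "K (U x) (U y) = K x y" if "orthogonal_transformation U" for U x y
      using that by (simp add: Kdef sgn_orthogonal linear_diff[OF orthogonal_transformation_linear, symmetric] orthogonal_transformation_norm)
    have ss: "sgn (sgn x) = sgn x" for x :: "real ^ 'N" by (cases "x = 0") (simp_all add: sgn_div_norm)
    have Ksgn: "K (sgn x) y = K x y" "K x (sgn y) = K x y" for x y by (simp_all add: Kdef ss)
    obtain \<theta> :: "real ^ 'N" where \<theta>: "norm \<theta> = 1" using vector_choose_size[of 1] by auto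
    \<comment> \<open>Rotations act transitively on unit vectors, so neither marginal depends on the
      reference point \<open>\<theta>\<close>. The origin is exceptional, since
      \<open>sgn 0 = 0\<close> is not a unit vector: \<open>\<psi> 0 = 0\<close> removes it on the
      side of \<open>\<rho>\<close>, and it is null for the Gaussian.\<close>
    define p where "p = (\<integral>y. K \<theta> y \<partial>std_gaussian)"
    define q where "q = (\<integral>x. \<psi> (norm x) * K x \<theta> \<partial>\<rho>)"
    have p: "(\<integral>y. K x y \<partial>std_gaussian) = p" if x0: "x \<noteq> 0" for x
    proof -
      obtain U where U: "orthogonal_transformation U" "U \<theta> = sgn x"
        by (rule orthogonal_transformation_exists[of \<theta> "sgn x"]) (use \<theta> x0 in \<open>simp_all add: norm_sgn\<close>)
      have "(\<integral>y. K (sgn x) y \<partial>std_gaussian) = (\<integral>y. K (sgn x) (U y) \<partial>std_gaussian)"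
        by (rule rotation_invariant_integral[OF rotation_invariant_std_gaussian U(1), symmetric]) simp
      then show ?thesis using KU[OF U(1)] by (simp add: p_def U(2)[symmetric] Ksgn) (simp add: U Ksgn)
    qed
    have q: "(\<integral>x. \<psi> (norm x) * K x y \<partial>\<rho>) = q" if x0: "y \<noteq> 0" for y
    proof -
      obtain U where U: "orthogonal_transformation U" "U \<theta> = sgn y"
        by (rule orthogonal_transformation_exists[of \<theta> "sgn y"]) (use \<theta> x0 in \<open>simp_all add: norm_sgn\<close>)
      have "(\<integral>x. \<psi> (norm x) * K x y \<partial>\<rho>) = (\<integral>x. \<psi> (norm x) * K x (sgn y) \<partial>\<rho>)" by (simp add: Ksgn)
      also have "\<dots> = (\<integral>x. \<psi> (norm (U x)) * K (U x) (U \<theta>) \<partial>\<rho>)"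
        unfolding U(2) by (rule rotation_invariant_integral[OF \<rho> U(1), symmetric]) simp
      also have "\<dots> = q"
        by (simp only: q_def KU[OF U(1)] orthogonal_transformation_norm[OF U(1)])
      finally show ?thesis .
    qed
    have p_pos: "p > 0"
    proof -
      have "isCont (sgn :: real ^ 'N \<Rightarrow> real ^ 'N) \<theta>" using \<theta> by (intro continuous_intros) auto
      then obtain r where r: "r > 0" "\<And>y. dist y \<theta> < r \<Longrightarrow> dist (sgn y) (sgn \<theta>) < e"
        using e(1) unfolding continuous_at_eps_delta by blast
      have sub: "ball \<theta> r \<subseteq> {y. norm (sgn \<theta> - sgn y) < e}"
        using r by (auto simp: dist_norm norm_minus_commute)
      have m: "{y. norm (sgn \<theta> - sgn y) < e} \<in> sets borel" by measurable
      have "p = measure std_gaussian {y. norm (sgn \<theta> - sgn y) < e}"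
      proof -
        have "K \<theta> y = indicator {y. norm (sgn \<theta> - sgn y) < e} y" for y by (simp add: Kdef)
        then show ?thesis using m by (simp add: p_def)
      qed
      moreover have "0 < measure std_gaussian (ball \<theta> r)"
        using std_gaussian_ball_pos[OF r(1), of \<theta>] by (simp add: measure_def enn2real_positive_iff zero_less_iff_neq_zero less_top[symmetric])
      moreover have "measure std_gaussian (ball \<theta> r) \<le> measure std_gaussian {y. norm (sgn \<theta> - sgn y) < e}"
        using sub m by (intro std_gaussian.finite_measure_mono) auto
      ultimately show ?thesis by simp
    qed
    have fub: "(\<integral>x. \<psi> (norm x) * (\<integral>y. g (sgn y) * K x y \<partial>std_gaussian) \<partial>\<rho>)
        = (\<integral>y. g (sgn y) * (\<integral>x. \<psi> (norm x) * K x y \<partial>\<rho>) \<partial>std_gaussian)"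
      if [measurable]: "g \<in> borel_measurable borel" and bnd: "\<And>x. norm x \<le> 1 \<Longrightarrow> \<bar>g x\<bar> \<le> D" for g :: "real ^ 'N \<Rightarrow> real" and D
    proof -
      have D: "\<bar>g (sgn y) * K x y\<bar> \<le> D" for x y
        using mult_mono[OF bnd[OF ns[of y]], of "K x y" 1] K01[of x y] bnd[of 0] by (simp add: abs_mult)
      have "integrable (\<rho> \<Otimes>\<^sub>M (std_gaussian :: (real ^ 'N) measure)) (\<lambda>p. D * \<psi> (norm (fst p)))"
      proof -
        have "integrable (distr (\<rho> \<Otimes>\<^sub>M (std_gaussian :: (real ^ 'N) measure)) \<rho> fst) (\<lambda>x. \<psi> (norm x))"
          using int by (simp add: std_gaussian.distr_pair_fst)
        then have "integrable (\<rho> \<Otimes>\<^sub>M (std_gaussian :: (real ^ 'N) measure)) (\<lambda>p. \<psi> (norm (fst p)))"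
          by (subst (asm) integrable_distr_eq) auto
        then show ?thesis by simp
      qed
      then have "integrable (\<rho> \<Otimes>\<^sub>M (std_gaussian :: (real ^ 'N) measure)) (\<lambda>p. \<psi> (norm (fst p)) * (g (sgn (snd p)) * K (fst p) (snd p)))"
      proof (rule Bochner_Integration.integrable_bound)
        show "AE p in \<rho> \<Otimes>\<^sub>M (std_gaussian :: (real ^ 'N) measure). norm (\<psi> (norm (fst p)) * (g (sgn (snd p)) * K (fst p) (snd p))) \<le> norm (D * \<psi> (norm (fst p)))"
        proof (rule AE_I2)
          fix p :: "(real ^ 'N) \<times> (real ^ 'N)"
          have "\<bar>\<psi> (norm (fst p))\<bar> * \<bar>g (sgn (snd p)) * K (fst p) (snd p)\<bar> \<le> \<bar>\<psi> (norm (fst p))\<bar> * \<bar>D\<bar>"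
            using D[of "snd p" "fst p"] by (intro mult_left_mono) auto
          then show "norm (\<psi> (norm (fst p)) * (g (sgn (snd p)) * K (fst p) (snd p))) \<le> norm (D * \<psi> (norm (fst p)))"
            by (simp add: abs_mult mult.commute)
        qed
      qed measurable
      then have i: "integrable (\<rho> \<Otimes>\<^sub>M (std_gaussian :: (real ^ 'N) measure)) (\<lambda>(x, y). \<psi> (norm x) * (g (sgn y) * K x y))"
        by (simp add: case_prod_beta')
      have "(\<integral>x. \<psi> (norm x) * (g (sgn y) * K x y) \<partial>\<rho>) = g (sgn y) * (\<integral>x. \<psi> (norm x) * K x y \<partial>\<rho>)" for y
        unfolding integral_mult_right_zero[symmetric] by (simp only: mult.left_commute)
      then show ?thesis using RG.Fubini_integral[OF i] by simp
    qed
    have [measurable]: "(\<lambda>y. \<integral>x. \<psi> (norm x) * K x y \<partial>\<rho>) \<in> borel_measurable borel"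
      unfolding Kdef by (rule R.borel_measurable_lebesgue_integral) measurable
    \<comment> \<open>Fubini with the constant test function 1 fixes the ratio of the two
      marginals.\<close>
    have q_eq: "p * \<Psi> = q"
    proof -
      have "p * \<Psi> = (\<integral>x. \<psi> (norm x) * p \<partial>\<rho>)" by (simp add: \<Psi>_def)
      also have "\<dots> = (\<integral>x. \<psi> (norm x) * (\<integral>y. 1 * K x y \<partial>std_gaussian) \<partial>\<rho>)"
      proof (rule Bochner_Integration.integral_cong[OF refl])
        show "\<psi> (norm x) * p = \<psi> (norm x) * (\<integral>y. 1 * K x y \<partial>std_gaussian)" for x
          by (cases "x = 0") (simp_all add: p \<psi>0)
      qed
      also have "\<dots> = (\<integral>y. 1 * (\<integral>x. \<psi> (norm x) * K x y \<partial>\<rho>) \<partial>std_gaussian)"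
        by (rule fub[of "\<lambda>_. 1" 1]) auto
      also have "\<dots> = (\<integral>y. q \<partial>(std_gaussian :: (real ^ 'N) measure))"
        by (rule integral_cong_AE) (use std_gaussian_AE_nonzero q in \<open>auto elim!: AE_mp\<close>)
      also have "\<dots> = q" by (simp add: std_gaussian.prob_space[unfolded space_std_gaussian])
      finally show ?thesis .
    qed
    have B_eq: "(\<integral>x. \<psi> (norm x) * (\<integral>y. \<Phi> (sgn y) * K x y \<partial>std_gaussian) \<partial>\<rho>) = q * B"
    proof -
      have "(\<integral>x. \<psi> (norm x) * (\<integral>y. \<Phi> (sgn y) * K x y \<partial>std_gaussian) \<partial>\<rho>)
          = (\<integral>y. \<Phi> (sgn y) * (\<integral>x. \<psi> (norm x) * K x y \<partial>\<rho>) \<partial>std_gaussian)"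
        by (rule fub[of \<Phi> C]) (use C in auto)
      also have "\<dots> = (\<integral>y. \<Phi> (sgn y) * q \<partial>std_gaussian)"
        by (rule integral_cong_AE) (use std_gaussian_AE_nonzero q in \<open>auto elim!: AE_mp\<close>)
      finally show ?thesis by (simp add: B_def)
    qed
    \<comment> \<open>For nonzero \<open>x\<close>, \<open>T x / p\<close> is the average of
      \<open>\<Phi>\<close> over directions within \<open>e\<close> of \<open>sgn x\<close>, hence
      within \<open>w\<close> of \<open>\<Phi> (sgn x)\<close>.\<close>
    define T where "T x = (\<integral>y. \<Phi> (sgn y) * K x y \<partial>std_gaussian)" for x
    have [measurable]: "T \<in> borel_measurable borel"
      unfolding T_def[abs_def] by (rule std_gaussian.borel_measurable_lebesgue_integral) simp
    have diff: "\<bar>p * \<Phi> (sgn x) - T x\<bar> \<le> w * p" if "x \<noteq> 0" for x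
    proof -
      have bint: "integrable std_gaussian (\<lambda>y. f y)" if "f \<in> borel_measurable borel" "\<And>y. \<bar>f y\<bar> \<le> D" for f :: "real ^ 'N \<Rightarrow> real" and D
        by (rule std_gaussian.integrable_const_bound[of _ D]) (use that in auto)
      have iK: "integrable std_gaussian (\<lambda>y. K x y)" by (rule bint[of _ 1]) (use K01 in auto)
      have iT: "integrable std_gaussian (\<lambda>y. \<Phi> (sgn y) * K x y)"
      proof (rule bint)
        show "\<bar>\<Phi> (sgn y) * K x y\<bar> \<le> C" for y
          using mult_mono[OF C[OF ns[of y]], of "K x y" 1] K01[of x y] C[of 0] by (simp add: abs_mult)
      qed simp
      have "p * \<Phi> (sgn x) - T x = (\<integral>y. \<Phi> (sgn x) * K x y - \<Phi> (sgn y) * K x y \<partial>std_gaussian)"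
        using iK iT p[OF that] by (simp add: T_def)
      also have "\<bar>\<dots>\<bar> \<le> (\<integral>y. \<bar>\<Phi> (sgn x) * K x y - \<Phi> (sgn y) * K x y\<bar> \<partial>std_gaussian)"
        by (rule integral_abs_bound)
      also have "\<dots> \<le> (\<integral>y. w * K x y \<partial>std_gaussian)"
      proof (rule integral_mono)
        show "\<bar>\<Phi> (sgn x) * K x y - \<Phi> (sgn y) * K x y\<bar> \<le> w * K x y" for y
          using osc[of x y] by (simp add: Kdef)
      qed (use iK iT in auto)
      also have "\<dots> = w * p" using p[OF that] by simp
      finally show ?thesis .
    qed
    have iT: "integrable \<rho> (\<lambda>x. \<psi> (norm x) * T x)"
    proof (rule Bochner_Integration.integrable_bound)
      show "integrable \<rho> (\<lambda>x. \<bar>p * (\<psi> (norm x) * \<Phi> (sgn x))\<bar> + w * p * \<psi> (norm x))" using int intA by auto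
      show "AE x in \<rho>. norm (\<psi> (norm x) * T x) \<le> norm (\<bar>p * (\<psi> (norm x) * \<Phi> (sgn x))\<bar> + w * p * \<psi> (norm x))"
      proof (rule AE_I2)
        fix x
        show "norm (\<psi> (norm x) * T x) \<le> norm (\<bar>p * (\<psi> (norm x) * \<Phi> (sgn x))\<bar> + w * p * \<psi> (norm x))"
        proof (cases "x = 0")
          case False
          have "\<bar>T x\<bar> \<le> \<bar>p * \<Phi> (sgn x)\<bar> + w * p" using diff[OF False] by linarith
          then have "\<psi> (norm x) * \<bar>T x\<bar> \<le> \<psi> (norm x) * (\<bar>p * \<Phi> (sgn x)\<bar> + w * p)"
            using \<psi>0 by (intro mult_left_mono) auto
          then show ?thesis using \<psi>0(2)[of "norm x"] by (simp add: abs_mult algebra_simps)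
        qed (simp add: \<psi>0)
      qed
    qed simp
    have "p * \<bar>A - \<Psi> * B\<bar> = \<bar>p * A - q * B\<bar>"
    proof -
      have "p * A - q * B = p * (A - \<Psi> * B)" by (simp add: q_eq[symmetric] algebra_simps)
      then show ?thesis using p_pos by (simp add: abs_mult)
    qed
    also have "p * A - q * B = (\<integral>x. \<psi> (norm x) * (p * \<Phi> (sgn x) - T x) \<partial>\<rho>)"
    proof -
      have "(\<integral>x. \<psi> (norm x) * (p * \<Phi> (sgn x) - T x) \<partial>\<rho>) = (\<integral>x. p * (\<psi> (norm x) * \<Phi> (sgn x)) - \<psi> (norm x) * T x \<partial>\<rho>)"
        by (simp add: algebra_simps)
      also have "\<dots> = p * A - (\<integral>x. \<psi> (norm x) * T x \<partial>\<rho>)"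
        using intA iT by (simp add: A_def)
      finally show ?thesis using B_eq by (simp add: T_def)
    qed
    also have "\<bar>\<dots>\<bar> \<le> (\<integral>x. \<bar>\<psi> (norm x) * (p * \<Phi> (sgn x) - T x)\<bar> \<partial>\<rho>)" by (rule integral_abs_bound)
    also have "\<dots> \<le> (\<integral>x. w * p * \<psi> (norm x) \<partial>\<rho>)"
    proof (rule integral_mono)
      have "integrable \<rho> (\<lambda>x. p * (\<psi> (norm x) * \<Phi> (sgn x)) - \<psi> (norm x) * T x)" using intA iT by auto
      then have "integrable \<rho> (\<lambda>x. \<psi> (norm x) * (p * \<Phi> (sgn x) - T x))" by (simp add: algebra_simps)
      then show "integrable \<rho> (\<lambda>x. \<bar>\<psi> (norm x) * (p * \<Phi> (sgn x) - T x)\<bar>)" by auto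
      show "\<bar>\<psi> (norm x) * (p * \<Phi> (sgn x) - T x)\<bar> \<le> w * p * \<psi> (norm x)" for x
      proof (cases "x = 0")
        case False
        then show ?thesis using mult_left_mono[OF diff[OF False] \<psi>0(2)[of "norm x"]] \<psi>0(2)[of "norm x"]
          by (simp add: abs_mult mult_ac)
      qed (simp add: \<psi>0)
    qed (use int in simp)
    also have "\<dots> = p * (w * \<Psi>)" by (simp add: \<Psi>_def)
    finally show ?thesis using p_pos by simp
  qed
  have "\<bar>A - \<Psi> * B\<bar> \<le> 0"
  proof (rule field_le_epsilon)
    fix d :: real assume d: "d > 0"
    have "\<bar>A - \<Psi> * B\<bar> \<le> d / (\<Psi> + 1) * \<Psi>" using d \<Psi>nn by (intro close) auto
    also have "\<dots> \<le> d" using d \<Psi>nn by (simp add: field_simps)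
    finally show "\<bar>A - \<Psi> * B\<bar> \<le> 0 + d" by simp
  qed
  then show ?thesis by (simp add: A_def B_def \<Psi>_def)
qed

locale homogeneous_lipschitz =
  fixes f :: "real ^ 'N \<Rightarrow> real"
  assumes homogeneous: "\<And>c x. 0 \<le> c \<Longrightarrow> f (c *\<^sub>R x) = c * f x"
    and lipschitz: "\<And>x y. \<bar>f x - f y\<bar> \<le> norm (x - y)"
begin

lemma zero [simp]: "f 0 = 0"
  using homogeneous[of 0 0] by simp

lemma abs_le_norm: "\<bar>f x\<bar> \<le> norm x"
  using lipschitz[of x 0] by simp

lemma continuous: "continuous_on UNIV f"
  unfolding continuous_on_iff dist_norm real_norm_def
  using lipschitz by (meson le_less_trans)

lemma measurable [measurable]: "f \<in> borel_measurable borel"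
  using continuous by (rule borel_measurable_continuous_onI)

lemma integrable: "integrable std_gaussian f"
  by (rule integrable_std_gaussian_norm_bound[of _ 1]) (simp_all add: abs_le_norm)

lemma sgn_eq: "f x = norm x * f (sgn x)"
proof -
  have "x = norm x *\<^sub>R sgn x" by (cases "x = 0") (simp_all add: sgn_div_norm)
  then show ?thesis using homogeneous[of "norm x" "sgn x"] by simp
qed

lemma uminus: "homogeneous_lipschitz (\<lambda>x. - f x)"
  by unfold_locales (use homogeneous lipschitz in \<open>auto simp: abs_minus_commute\<close>)

text \<open>The direction and the norm of a Gaussian vector are independent, so by Jensen's
  inequality replacing the norm by its mean decreases the exponential moment.\<close>

lemma spherical_mgf:
  assumes l: "0 \<le> l"
  shows "(\<integral>x. exp (l * ((\<integral>y. norm y \<partial>(std_gaussian :: (real ^ 'N) measure)) * f (sgn x))) \<partial>std_gaussian)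
    \<le> exp (l * (\<integral>x. f x \<partial>std_gaussian) + l\<^sup>2 / 2)"
proof -
  define a where "a = (\<integral>y. norm y \<partial>(std_gaussian :: (real ^ 'N) measure))"
  \<comment> \<open>The tangent line of \<open>exp\<close> at \<open>l * a * f (sgn x)\<close>,
    evaluated at \<open>l * f x\<close>, equals
    \<open>norm x * \<Phi> (sgn x) + \<Psi> (sgn x)\<close>. It is affine in the norm, so
    integration may replace \<open>norm x\<close> by its mean \<open>a\<close>, and this returns
    exactly \<open>exp (l * a * f (sgn x))\<close>.\<close>
  define \<Phi> where "\<Phi> x = l * f x * exp (l * (a * f x))" for x
  define \<Psi> where "\<Psi> x = exp (l * (a * f x)) * (1 - l * (a * f x))" for x
  have cont: "continuous_on UNIV \<Phi>" "continuous_on UNIV \<Psi>"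
    unfolding \<Phi>_def \<Psi>_def by (intro continuous_intros continuous)+
  have [measurable]: "\<Phi> \<in> borel_measurable borel" "\<Psi> \<in> borel_measurable borel"
    using cont by (auto intro: borel_measurable_continuous_onI)
  have ns: "sgn (x :: real ^ 'N) \<in> cball 0 1" for x by (simp add: norm_sgn)
  have bdd: "\<exists>C. \<forall>x. \<bar>g (sgn x)\<bar> \<le> C" if "continuous_on UNIV g" for g :: "real ^ 'N \<Rightarrow> real"
  proof -
    have "compact (g ` cball 0 1)"
      using that by (intro compact_continuous_image) (auto intro: continuous_on_subset)
    from compact_imp_bounded[OF this] obtain C where "\<forall>y\<in>g ` cball 0 1. norm y \<le> C"
      unfolding bounded_iff by blast
    then show ?thesis using ns by (intro exI[of _ C]) auto
  qed
  obtain C1 where "\<forall>x. \<bar>\<Phi> (sgn x)\<bar> \<le> C1" using bdd[OF cont(1)] ..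
  then have C1: "\<bar>\<Phi> (sgn x)\<bar> \<le> C1" for x by blast
  obtain C2 where "\<forall>x. \<bar>\<Psi> (sgn x)\<bar> \<le> C2" using bdd[OF cont(2)] ..
  then have C2: "\<bar>\<Psi> (sgn x)\<bar> \<le> C2" for x by blast
  have i1: "integrable std_gaussian (\<lambda>x. norm x * \<Phi> (sgn x))"
    by (rule integrable_std_gaussian_norm_bound[of _ C1])
       (use C1 mult_right_mono[OF C1 norm_ge_zero] in \<open>auto simp: abs_mult mult.commute\<close>)
  have i2: "integrable std_gaussian (\<lambda>x. \<Psi> (sgn x))" and i3: "integrable std_gaussian (\<lambda>x. \<Phi> (sgn x))"
    by (rule std_gaussian.integrable_const_bound[of _ C2], use C2 in auto)
       (rule std_gaussian.integrable_const_bound[of _ C1], use C1 in auto)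
  have "(\<integral>x. norm x * \<Phi> (sgn x) \<partial>std_gaussian) = a * (\<integral>x. \<Phi> (sgn x) \<partial>std_gaussian)"
    unfolding a_def
    using rotation_invariant_polar[OF rotation_invariant_std_gaussian, of "\<lambda>r. max 0 r" \<Phi>] cont(1)
    by (simp add: integrable_std_gaussian_norm)
  then have "(\<integral>x. norm x * \<Phi> (sgn x) + \<Psi> (sgn x) \<partial>std_gaussian) = (\<integral>x. a * \<Phi> (sgn x) + \<Psi> (sgn x) \<partial>std_gaussian)"
    using i1 i2 i3 by simp
  also have "\<dots> = (\<integral>x. exp (l * (a * f (sgn x))) \<partial>std_gaussian)"
    by (intro Bochner_Integration.integral_cong) (auto simp: \<Phi>_def \<Psi>_def algebra_simps)
  finally have eq: "(\<integral>x. exp (l * (a * f (sgn x))) \<partial>std_gaussian) = (\<integral>x. norm x * \<Phi> (sgn x) + \<Psi> (sgn x) \<partial>std_gaussian)" ..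
  have "ennreal \<dots> \<le> (\<integral>\<^sup>+x. ennreal (norm x * \<Phi> (sgn x) + \<Psi> (sgn x)) \<partial>std_gaussian)"
    using i1 i2 by (intro ennreal_integral_le_nn_integral) auto
  also have "\<dots> \<le> (\<integral>\<^sup>+x. ennreal (exp (l * f x)) \<partial>std_gaussian)"
  proof (intro nn_integral_mono ennreal_leI)
    fix x :: "real ^ 'N"
    have "norm x * \<Phi> (sgn x) + \<Psi> (sgn x) = exp (l * (a * f (sgn x))) * (1 + (l * f x - l * (a * f (sgn x))))"
      by (simp add: \<Phi>_def \<Psi>_def sgn_eq[of x] algebra_simps)
    also have "\<dots> \<le> exp (l * (a * f (sgn x))) * exp (l * f x - l * (a * f (sgn x)))"
      by (intro mult_left_mono exp_ge_add_one_self) auto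
    also have "\<dots> = exp (l * f x)" by (simp add: exp_add[symmetric])
    finally show "norm x * \<Phi> (sgn x) + \<Psi> (sgn x) \<le> exp (l * f x)" .
  qed
  also have "\<dots> \<le> ennreal (exp (l * (\<integral>x. f x \<partial>std_gaussian) + l\<^sup>2 / 2))"
    by (intro std_gaussian_lipschitz_mgf lipschitz integrable l) simp
  finally show ?thesis unfolding eq[symmetric] by (simp add: a_def)
qed

text \<open>Chernoff's bound with exponential parameter \<open>t\<close>. The weight
  \<open>\<psi>\<close> depends on the norm only and factors out by the polar identity, so the tail
  estimate holds relative to any range of norms and whatever the law of the norm is.\<close>

lemma spherical_tail:
  fixes \<psi> :: "real \<Rightarrow> real"
  assumes \<rho>: "rotation_invariant \<rho>"
    and [measurable]: "\<psi> \<in> borel_measurable borel" and \<psi>0: "\<psi> 0 = 0" "\<And>r. 0 \<le> \<psi> r"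
    and int: "integrable \<rho> (\<lambda>x. \<psi> (norm x))" and t: "0 \<le> t"
  shows "(\<integral>x. \<psi> (norm x) * indicator {x. (\<integral>y. norm y \<partial>(std_gaussian :: (real ^ 'N) measure)) * f (sgn x) \<ge> (\<integral>x. f x \<partial>std_gaussian) + t} x \<partial>\<rho>)
    \<le> exp (- t\<^sup>2 / 2) * (\<integral>x. \<psi> (norm x) \<partial>\<rho>)"
proof -
  have s [measurable_cong]: "sets \<rho> = sets borel" using \<rho> by (simp add: rotation_invariant_def)
  define a where "a = (\<integral>y. norm y \<partial>(std_gaussian :: (real ^ 'N) measure))"
  define m where "m = (\<integral>x. f x \<partial>std_gaussian)"
  define \<Phi> where "\<Phi> x = exp (t * (a * f x - m - t))" for x
  have cont: "continuous_on UNIV \<Phi>"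
    unfolding \<Phi>_def by (intro continuous_intros continuous)
  have [measurable]: "\<Phi> \<in> borel_measurable borel" using cont by (rule borel_measurable_continuous_onI)
  have \<Phi>_le: "\<bar>\<Phi> (sgn x)\<bar> \<le> exp (t * (\<bar>a\<bar> - m - t))" for x
  proof -
    have "\<bar>a\<bar> * \<bar>f (sgn x)\<bar> \<le> \<bar>a\<bar> * 1"
      using order_trans[OF abs_le_norm[of "sgn x"], of 1] by (intro mult_left_mono) (auto simp: norm_sgn)
    then have "a * f (sgn x) \<le> \<bar>a\<bar>" by (metis abs_ge_self abs_mult mult.right_neutral order_trans)
    then show ?thesis using t unfolding \<Phi>_def by (simp add: mult_left_mono)
  qed
  have i: "integrable \<rho> (\<lambda>x. \<psi> (norm x) * \<Phi> (sgn x))"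
  proof (rule Bochner_Integration.integrable_bound)
    show "integrable \<rho> (\<lambda>x. exp (t * (\<bar>a\<bar> - m - t)) * \<psi> (norm x))" using int by simp
    show "AE x in \<rho>. norm (\<psi> (norm x) * \<Phi> (sgn x)) \<le> norm (exp (t * (\<bar>a\<bar> - m - t)) * \<psi> (norm x))"
    proof (rule AE_I2)
      fix x
      show "norm (\<psi> (norm x) * \<Phi> (sgn x)) \<le> norm (exp (t * (\<bar>a\<bar> - m - t)) * \<psi> (norm x))"
        using mult_right_mono[OF \<Phi>_le[of x] abs_ge_zero[of "\<psi> (norm x)"]] by (simp add: abs_mult mult.commute)
    qed
  qed simp
  have ind: "indicator {x. a * f (sgn x) \<ge> m + t} x \<le> \<Phi> (sgn x)" for x
    using t by (auto simp: indicator_def \<Phi>_def)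
  have "(\<integral>x. \<psi> (norm x) * indicator {x. a * f (sgn x) \<ge> m + t} x \<partial>\<rho>) \<le> (\<integral>x. \<psi> (norm x) * \<Phi> (sgn x) \<partial>\<rho>)"
  proof (rule integral_mono)
    show "integrable \<rho> (\<lambda>x. \<psi> (norm x) * indicator {x. a * f (sgn x) \<ge> m + t} x)"
    proof (rule Bochner_Integration.integrable_bound[OF int])
      show "AE x in \<rho>. norm (\<psi> (norm x) * indicator {x. a * f (sgn x) \<ge> m + t} x) \<le> norm (\<psi> (norm x))"
        by (intro AE_I2) (simp add: indicator_def)
    qed simp
    show "\<psi> (norm x) * indicator {x. a * f (sgn x) \<ge> m + t} x \<le> \<psi> (norm x) * \<Phi> (sgn x)" for x
      by (intro mult_left_mono ind \<psi>0)
  qed (rule i)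
  also have "\<dots> = (\<integral>x. \<psi> (norm x) \<partial>\<rho>) * (\<integral>x. \<Phi> (sgn x) \<partial>std_gaussian)"
    by (rule rotation_invariant_polar[OF \<rho> _ \<psi>0 int cont]) simp
  also have "(\<integral>x. \<Phi> (sgn x) \<partial>std_gaussian) = exp (- t * m - t\<^sup>2) * (\<integral>x. exp (t * (a * f (sgn x))) \<partial>std_gaussian)"
  proof -
    have "\<Phi> (sgn x) = exp (- t * m - t\<^sup>2) * exp (t * (a * f (sgn x)))" for x
      by (simp add: \<Phi>_def exp_add[symmetric] algebra_simps power2_eq_square)
    then show ?thesis by simp
  qed
  also have "(\<integral>x. \<psi> (norm x) \<partial>\<rho>) * (exp (- t * m - t\<^sup>2) * (\<integral>x. exp (t * (a * f (sgn x))) \<partial>std_gaussian))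
     \<le> (\<integral>x. \<psi> (norm x) \<partial>\<rho>) * (exp (- t * m - t\<^sup>2) * exp (t * m + t\<^sup>2 / 2))"
    using spherical_mgf[OF t] \<psi>0 by (intro mult_left_mono) (auto simp: a_def m_def)
  also have "exp (- t * m - t\<^sup>2) * exp (t * m + t\<^sup>2 / 2) = exp (- t\<^sup>2 / 2)"
    by (simp add: exp_add[symmetric])
  finally show ?thesis by (simp add: a_def m_def mult.commute)
qed

end

section \<open>Orthogonal projections and the Grassmannian\<close>

lemma orth_proj_mem: "subspace F \<Longrightarrow> orth_proj F x \<in> F"
  and orth_proj_diff_mem: "subspace F \<Longrightarrow> x - orth_proj F x \<in> F\<^sup>\<bottom>"
  unfolding orth_proj_def using theI'[OF orth_proj_ex1] by blast+

lemma orth_proj_eqI: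
  assumes "subspace F" "y \<in> F" "x - y \<in> F\<^sup>\<bottom>"
  shows "orth_proj F x = y"
  unfolding orth_proj_def using orth_proj_ex1[OF assms(1), of x] assms(2,3) by (intro the1_equality) auto

lemma inner_orth_comp: "x \<in> F \<Longrightarrow> y \<in> F\<^sup>\<bottom> \<Longrightarrow> x \<bullet> y = 0"
  by (auto simp: orthogonal_comp_def orthogonal_def)

lemma linear_orth_proj:
  assumes F: "subspace F"
  shows "linear (orth_proj F)"
proof
  fix x y c
  have "(x + y) - (orth_proj F x + orth_proj F y) = (x - orth_proj F x) + (y - orth_proj F y)" by simp
  also have "\<dots> \<in> F\<^sup>\<bottom>"
    using F by (intro subspace_add subspace_orthogonal_comp orth_proj_diff_mem)
  finally show "orth_proj F (x + y) = orth_proj F x + orth_proj F y"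
    using F by (intro orth_proj_eqI subspace_add orth_proj_mem)
  have "c *\<^sub>R x - c *\<^sub>R orth_proj F x = c *\<^sub>R (x - orth_proj F x)" by (simp add: scaleR_diff_right)
  also have "\<dots> \<in> F\<^sup>\<bottom>"
    using F by (intro subspace_scale subspace_orthogonal_comp orth_proj_diff_mem)
  finally show "orth_proj F (c *\<^sub>R x) = c *\<^sub>R orth_proj F x"
    using F by (intro orth_proj_eqI subspace_scale orth_proj_mem)
qed

lemma orth_proj_id: "subspace F \<Longrightarrow> x \<in> F \<Longrightarrow> orth_proj F x = x"
  by (rule orth_proj_eqI) (auto simp: subspace_0 subspace_orthogonal_comp)

lemma orth_proj_comp_0: "subspace F \<Longrightarrow> x \<in> F\<^sup>\<bottom> \<Longrightarrow> orth_proj F x = 0"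
  by (rule orth_proj_eqI) (auto simp: subspace_0)

lemma norm_orth_proj_pythagoras:
  assumes "subspace F"
  shows "(norm x)\<^sup>2 = (norm (orth_proj F x))\<^sup>2 + (norm (x - orth_proj F x))\<^sup>2"
  using norm_add_Pythagorean[of "orth_proj F x" "x - orth_proj F x"]
    inner_orth_comp[OF orth_proj_mem[OF assms] orth_proj_diff_mem[OF assms]] by (simp add: orthogonal_def)

lemma orthogonal_transformation_image_subspace:
  assumes "orthogonal_transformation U" "subspace F"
  shows "subspace (U ` F)"
  using assms by (intro linear_subspace_image orthogonal_transformation_linear)

lemma orth_proj_image:
  fixes U :: "real ^ 'N \<Rightarrow> real ^ 'N"
  assumes U: "orthogonal_transformation U" and F: "subspace F"
  shows "orth_proj (U ` F) (U x) = U (orth_proj F x)"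
proof (rule orth_proj_eqI)
  have "U x - U (orth_proj F x) = U (x - orth_proj F x)"
    by (simp add: linear_diff[OF orthogonal_transformation_linear[OF U]])
  moreover have "U y \<bullet> U (x - orth_proj F x) = 0" if "y \<in> F" for y
    using U inner_orth_comp[OF that orth_proj_diff_mem[OF F]] by (simp add: orthogonal_transformation_def)
  ultimately show "U x - U (orth_proj F x) \<in> (U ` F)\<^sup>\<bottom>"
    by (auto simp: orthogonal_comp_def orthogonal_def)
qed (use assms orth_proj_mem in \<open>auto simp: orthogonal_transformation_image_subspace\<close>)

lemma codim_subspaces_image:
  fixes U :: "real ^ 'N \<Rightarrow> real ^ 'N"
  assumes U: "orthogonal_transformation U" and F: "F \<in> codim_subspaces n"
  shows "U ` F \<in> codim_subspaces n"
  using F orthogonal_transformation_inj[OF U] orthogonal_transformation_linear[OF U]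
  by (auto simp: codim_subspaces_def linear_subspace_image dim_image_eq inj_on_subset)

lemma dim_orthogonal_comp_codim:
  fixes F :: "(real ^ 'N) set"
  assumes "F \<in> codim_subspaces n"
  shows "dim (F\<^sup>\<bottom>) = n"
  using dim_subspace_orthogonal_to_vectors[of F UNIV] assms
  by (simp add: codim_subspaces_def orthogonal_comp_def)

lemma subspace_coordinates: "subspace {x :: real ^ 'N. \<forall>i. i \<notin> I \<longrightarrow> x $ i = 0}"
  by (auto simp: subspace_def)

text \<open>Glue an isometry from \<open>F\<^sup>\<bottom>\<close> onto the coordinates in
  \<open>I\<close> to one from \<open>F\<close> onto the other coordinates; the images are
  orthogonal, so the sum is an isometry. Gaussian measures of sets defined by the normal component
  of \<open>F\<close> thereby become independent of \<open>F\<close>.\<close>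

lemma exists_orthogonal_coordinates:
  fixes F :: "(real ^ 'N) set"
  assumes F: "F \<in> codim_subspaces n" and I: "card (I :: 'N set) = n"
  obtains U where "orthogonal_transformation U"
    "\<And>x. (norm (x - orth_proj F x))\<^sup>2 = (\<Sum>i\<in>I. (U x $ i)\<^sup>2)"
proof -
  define S :: "(real ^ 'N) set" where "S = {x. \<forall>i. i \<notin> I \<longrightarrow> x $ i = 0}"
  define S' :: "(real ^ 'N) set" where "S' = {x. \<forall>i. i \<notin> - I \<longrightarrow> x $ i = 0}"
  have sF: "subspace F" and dF: "dim F + n = CARD('N)" using F by (auto simp: codim_subspaces_def)
  have sS: "subspace S" "subspace S'" unfolding S_def S'_def by (rule subspace_coordinates)+
  have dS: "dim S = n" unfolding S_def using dim_substandard_cart[of I] I by (simp flip: dim_vec_eq)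
  have "dim S' = card (- I)" unfolding S'_def using dim_substandard_cart[of "- I"] by (simp flip: dim_vec_eq)
  then have dS': "dim S' = dim F" using dF I by (simp add: Compl_eq_Diff_UNIV card_Diff_subset)
  obtain f where f: "linear f" "f ` (F\<^sup>\<bottom>) = S" "\<And>x. x \<in> F\<^sup>\<bottom> \<Longrightarrow> norm (f x) = norm x"
    using isometry_subspaces[OF subspace_orthogonal_comp sS(1), of F] dS dim_orthogonal_comp_codim[OF F] by metis
  obtain g where g: "linear g" "g ` F = S'" "\<And>x. x \<in> F \<Longrightarrow> norm (g x) = norm x"
    using isometry_subspaces[OF sF sS(2)] dS' by metis
  define U where "U x = f (x - orth_proj F x) + g (orth_proj F x)" for x
  have linU: "linear U"
  proof -
    note lp = linear_orth_proj[OF sF]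
    show ?thesis
      by (rule linearI)
         (simp_all add: U_def linear_add[OF lp] linear_add[OF f(1)] linear_add[OF g(1)] linear_diff[OF f(1)]
           linear_scale[OF lp] linear_scale[OF f(1)] linear_scale[OF g(1)] algebra_simps)
  qed
  have fS: "f (x - orth_proj F x) \<in> S" and gS: "g (orth_proj F x) \<in> S'" for x
    using f(2) g(2) orth_proj_diff_mem[OF sF] orth_proj_mem[OF sF] by blast+
  have "(norm (U x))\<^sup>2 = (norm x)\<^sup>2" for x
  proof -
    have "f (x - orth_proj F x) \<bullet> g (orth_proj F x) = 0"
      using fS[of x] gS[of x] unfolding inner_vec_def S_def S'_def by (intro sum.neutral) auto
    then have "(norm (U x))\<^sup>2 = (norm (f (x - orth_proj F x)))\<^sup>2 + (norm (g (orth_proj F x)))\<^sup>2"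
      unfolding U_def by (intro norm_add_Pythagorean) (simp add: orthogonal_def)
    also have "\<dots> = (norm x)\<^sup>2"
      using norm_orth_proj_pythagoras[OF sF, of x] f(3) g(3) orth_proj_diff_mem[OF sF] orth_proj_mem[OF sF] by simp
    finally show ?thesis .
  qed
  then have U: "orthogonal_transformation U"
    using linU by (simp add: orthogonal_transformation)
  moreover have "(norm (x - orth_proj F x))\<^sup>2 = (\<Sum>i\<in>I. (U x $ i)\<^sup>2)" for x
  proof -
    have "(norm (x - orth_proj F x))\<^sup>2 = (norm (f (x - orth_proj F x)))\<^sup>2"
      using f(3) orth_proj_diff_mem[OF sF] by simp
    also have "\<dots> = (\<Sum>i\<in>UNIV. (f (x - orth_proj F x) $ i)\<^sup>2)"
      by (simp add: norm_vec_def L2_set_def sum_nonneg)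
    also have "\<dots> = (\<Sum>i\<in>I. (f (x - orth_proj F x) $ i)\<^sup>2)"
      using fS[of x] by (intro sum.mono_neutral_right) (auto simp: S_def)
    also have "\<dots> = (\<Sum>i\<in>I. (U x $ i)\<^sup>2)"
      using gS[of x] by (intro sum.cong) (auto simp: U_def S'_def)
    finally show ?thesis .
  qed
  ultimately show thesis by (rule that)
qed

section \<open>Gaussian measure of a small ball in the normal space\<close>

lemma exp_neg_ge_one_minus: "1 - x \<le> exp (- x)" for x :: real
  using exp_ge_add_one_self[of "- x"] by simp

text \<open>Length \<open>1 / 10\<close> times a density of at least \<open>1 / 3\<close>. The
  half-width \<open>1 / 20\<close> is chosen so that the \<open>n\<close>-dimensional cube fits into
  the ball of radius \<open>sqrt n / 20\<close>.\<close>

lemma std_normal_interval: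
  "emeasure std_normal_measure {- 1 / 20 .. 1 / 20} \<ge> ennreal (1 / 30)"
proof -
  have "sqrt (2 * pi) \<le> 2.9"
  proof (rule real_le_lsqrt)
    show "2 * pi \<le> 2.9\<^sup>2" using pi_less_4 pi_approx by (simp add: power2_eq_square)
  qed auto
  then have c: "1 / 2.9 \<le> 1 / sqrt (2 * pi)" by (intro divide_left_mono) auto
  have "1 / 3 \<le> std_normal_density x" if "x \<in> {- 1 / 20 .. 1 / 20}" for x
  proof -
    have "x\<^sup>2 \<le> (1 / 20)\<^sup>2" using that by (subst abs_le_square_iff[symmetric]) (auto simp: abs_le_iff)
    then have "1 - (1 / 800) \<le> 1 - x\<^sup>2 / 2" by (simp add: power2_eq_square)
    also have "\<dots> \<le> exp (- x\<^sup>2 / 2)" using exp_neg_ge_one_minus[of "x\<^sup>2 / 2"] by simp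
    finally have e: "1 - (1 / 800) \<le> exp (- x\<^sup>2 / 2)" .
    have "1 / 3 \<le> (1 / 2.9) * (1 - (1 / 800) :: real)" by simp
    also have "\<dots> \<le> (1 / sqrt (2 * pi)) * exp (- x\<^sup>2 / 2)"
      using c e by (intro mult_mono) auto
    finally show ?thesis by (simp add: std_normal_density_def)
  qed
  then have "(\<integral>\<^sup>+x. ennreal (1 / 3) * indicator {- 1 / 20 .. 1 / 20 :: real} x \<partial>lborel) \<le>
      (\<integral>\<^sup>+x. ennreal (std_normal_density x) * indicator {- 1 / 20 .. 1 / 20 :: real} x \<partial>lborel)"
    by (intro nn_integral_mono) (auto simp: indicator_def intro!: ennreal_leI)
  also have "\<dots> = emeasure std_normal_measure {- 1 / 20 .. 1 / 20}"
    by (simp add: emeasure_density)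
  also have "(\<integral>\<^sup>+x. ennreal (1 / 3) * indicator {- 1 / 20 .. 1 / 20 :: real} x \<partial>lborel) = ennreal (1 / 3) * ennreal (1 / 20 - (- 1 / 20))"
    by (subst nn_integral_cmult_indicator) (auto simp del: minus_divide_left)
  finally show ?thesis by (simp add: ennreal_mult[symmetric])
qed

lemma std_gaussian_cube:
  fixes I :: "'N::finite set"
  shows "emeasure std_gaussian {x :: real ^ 'N. \<forall>i\<in>I. \<bar>x $ i\<bar> \<le> 1 / 20} \<ge> ennreal ((1 / 30) ^ card I)"
proof -
  interpret N: prob_space std_normal_measure by (rule prob_space_std_normal_measure)
  interpret P: product_sigma_finite "\<lambda>_::'N. std_normal_measure" by standard
  define A :: "'N \<Rightarrow> real set" where "A i = (if i \<in> I then {- 1 / 20 .. 1 / 20} else UNIV)" for i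
  have [measurable]: "A i \<in> sets borel" for i by (simp add: A_def)
  have eq: "{x :: real ^ 'N. \<forall>i\<in>I. \<bar>x $ i\<bar> \<le> 1 / 20} = {x. \<forall>i. x $ i \<in> A i}"
    by (auto simp: A_def abs_le_iff split: if_splits)
  have [measurable]: "{x :: real ^ 'N. \<forall>i. x $ i \<in> A i} \<in> sets borel" by measurable
  have "emeasure std_gaussian {x :: real ^ 'N. \<forall>i. x $ i \<in> A i} = (\<integral>\<^sup>+x. indicator {x :: real ^ 'N. \<forall>i. x $ i \<in> A i} x \<partial>std_gaussian)"
    by simp
  also have "\<dots> = (\<integral>\<^sup>+x. indicator {x :: real ^ 'N. \<forall>i. x $ i \<in> A i} (\<chi> i. x i) \<partial>PiM UNIV (\<lambda>_. std_normal_measure))"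
    by (rule nn_integral_std_gaussian_PiM) measurable
  also have "\<dots> = (\<integral>\<^sup>+x. (\<Prod>i\<in>UNIV. indicator (A i) (x i)) \<partial>PiM UNIV (\<lambda>_. std_normal_measure))"
    by (intro nn_integral_cong) (auto simp: indicator_def prod_zero_iff intro!: prod.neutral[symmetric])
  also have "\<dots> = (\<Prod>i\<in>UNIV. emeasure std_normal_measure (A i))"
    by (subst P.product_nn_integral_prod) auto
  also have "\<dots> = (\<Prod>i\<in>I. emeasure std_normal_measure (A i))"
    using N.emeasure_space_1 by (intro prod.mono_neutral_right) (auto simp: A_def)
  also have "\<dots> = emeasure std_normal_measure {- 1 / 20 .. 1 / 20} ^ card I"
    by (simp add: A_def)
  also have "\<dots> \<ge> ennreal (1 / 30) ^ card I"
    by (intro power_mono std_normal_interval) auto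
  finally show ?thesis unfolding eq by (simp add: ennreal_power)
qed

lemma orthogonal_preserves_std_gaussian:
  fixes U :: "real ^ 'N \<Rightarrow> real ^ 'N"
  assumes "orthogonal_transformation U" "A \<in> sets borel"
  shows "emeasure std_gaussian (U -` A) = emeasure std_gaussian A"
proof -
  have "emeasure std_gaussian A = emeasure (distr std_gaussian borel U) A"
    by (simp add: distr_std_gaussian_orthogonal[OF assms(1)])
  also have "\<dots> = emeasure std_gaussian (U -` A)"
    using assms borel_measurable_orthogonal[OF assms(1)]
    by (subst emeasure_distr) (auto simp: measurable_cong_sets[OF sets_std_gaussian refl])
  finally show ?thesis by simp
qed

text \<open>After rotation to coordinates the set is the same for all subspaces. A common exact
  value \<open>p\<close>, rather than a mere lower bound, lets \<open>p\<close> cancel in the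
  estimate for the central ball; only the ball around a bad direction pays for
  \<open>(1 / 30) ^ n\<close>.\<close>

lemma std_gaussian_proj_ball:
  fixes n :: nat
  assumes n: "n \<le> CARD('N)"
  obtains p where "p \<ge> (1 / 30) ^ n"
    "\<And>F :: (real ^ 'N) set. F \<in> codim_subspaces n \<Longrightarrow>
       measure std_gaussian {x. norm (x - orth_proj F x) \<le> sqrt (real n) / 20} = p"
proof -
  obtain I :: "'N set" where I: "card I = n" using n obtain_subset_with_card_n by metis
  define D :: "(real ^ 'N) set" where "D = {x. (\<Sum>i\<in>I. (x $ i)\<^sup>2) \<le> real n / 400}"
  have D: "D \<in> sets borel" unfolding D_def by measurable
  have eq: "measure std_gaussian {x. norm (x - orth_proj F x) \<le> sqrt (real n) / 20} = measure std_gaussian D"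
    if F: "F \<in> codim_subspaces n" for F :: "(real ^ 'N) set"
  proof -
    obtain U :: "real ^ 'N \<Rightarrow> real ^ 'N" where U: "orthogonal_transformation U"
      "\<And>x. (norm (x - orth_proj F x))\<^sup>2 = (\<Sum>i\<in>I. (U x $ i)\<^sup>2)"
      using exists_orthogonal_coordinates[OF F I] by blast
    have "norm (x - orth_proj F x) \<le> sqrt (real n) / 20 \<longleftrightarrow> U x \<in> D" for x
    proof -
      have "norm (x - orth_proj F x) \<le> sqrt (real n) / 20 \<longleftrightarrow> (norm (x - orth_proj F x))\<^sup>2 \<le> (sqrt (real n) / 20)\<^sup>2"
        by (simp add: power2_le_iff_abs_le)
      then show ?thesis by (simp add: U(2) D_def power_divide)
    qed
    then have "{x. norm (x - orth_proj F x) \<le> sqrt (real n) / 20} = U -` D" by auto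
    then show ?thesis using orthogonal_preserves_std_gaussian[OF U(1) D] by (simp add: measure_def)
  qed
  have "{x :: real ^ 'N. \<forall>i\<in>I. \<bar>x $ i\<bar> \<le> 1 / 20} \<subseteq> D"
  proof
    fix x :: "real ^ 'N" assume x: "x \<in> {x. \<forall>i\<in>I. \<bar>x $ i\<bar> \<le> 1 / 20}"
    have "(\<Sum>i\<in>I. (x $ i)\<^sup>2) \<le> (\<Sum>i\<in>I. 1 / 400)"
    proof (rule sum_mono)
      fix i assume "i \<in> I"
      then have "\<bar>x $ i\<bar> \<le> \<bar>1 / 20\<bar>" using x by simp
      then have "(x $ i)\<^sup>2 \<le> (1 / 20)\<^sup>2" by (rule abs_le_square_iff[THEN iffD1])
      then show "(x $ i)\<^sup>2 \<le> 1 / 400" by (simp add: power2_eq_square)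
    qed
    then show "x \<in> D" by (simp add: D_def I)
  qed
  then have "ennreal ((1 / 30) ^ n) \<le> emeasure std_gaussian D"
    using std_gaussian_cube[of I] emeasure_mono[of _ D std_gaussian] D I
    by (auto intro: order_trans)
  then have "(1 / 30) ^ n \<le> measure std_gaussian D"
    by (simp add: std_gaussian.emeasure_eq_measure)
  with eq show thesis by (intro that[of "measure std_gaussian D"])
qed

section \<open>Measurability on the Grassmannian and the projected Gaussian\<close>

lemma borel_measurable_vec_nthI:
  "(\<lambda>x. (x :: 'a::euclidean_space ^ 'N) $ i) \<in> borel_measurable borel"
  by (intro borel_measurable_continuous_onI continuous_intros)

lemma borel_measurable_vec_vecI:
  fixes f :: "'a \<Rightarrow> real ^ 'N ^ 'M"
  assumes "\<And>i j. (\<lambda>x. f x $ i $ j) \<in> borel_measurable M"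
  shows "f \<in> borel_measurable M"
  using assms by (subst borel_measurable_euclidean_space) (auto simp: Basis_vec_def inner_axis)

lemma borel_measurable_matrix_vector_mult:
  fixes A :: "'a \<Rightarrow> real ^ 'N ^ 'M"
  assumes "A \<in> borel_measurable M" "b \<in> borel_measurable M"
  shows "(\<lambda>x. A x *v b x) \<in> borel_measurable M"
proof -
  have [measurable]: "(\<lambda>x. A x $ i $ j) \<in> borel_measurable M" "(\<lambda>x. b x $ j) \<in> borel_measurable M" for i j
    using measurable_compose[OF measurable_compose[OF assms(1) borel_measurable_vec_nthI] borel_measurable_vec_nthI]
      measurable_compose[OF assms(2) borel_measurable_vec_nthI] by auto
  show ?thesis
    by (subst borel_measurable_euclidean_space)
       (auto simp: Basis_vec_def inner_axis matrix_vector_mult_def)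
qed

locale grassmannian =
  fixes n :: nat and \<mu> :: "(real ^ 'N) set measure"
  assumes haar: "grassmannian_haar n \<mu>"
begin

sublocale prob_space \<mu>
  using haar by (simp add: grassmannian_haar_def)

lemma sets_eq: "sets \<mu> = sets (grassmannian_borel n)"
  using haar by (simp add: grassmannian_haar_def)

lemma space_eq: "space \<mu> = codim_subspaces n"
  using sets_eq_imp_space_eq[OF sets_eq] by (simp add: grassmannian_borel_def)

lemma subspace_space: "F \<in> space \<mu> \<Longrightarrow> subspace F"
  by (simp add: space_eq codim_subspaces_def)

lemma measurable_matrix_orth_proj: "(\<lambda>F. matrix (orth_proj F)) \<in> borel_measurable \<mu>"
  unfolding measurable_cong_sets[OF sets_eq refl] grassmannian_borel_def
  by (rule measurable_vimage_algebra1) simp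

text \<open>The sigma-algebra is generated by the projection matrix, so a projection whose subspace
  and argument both vary is a matrix-vector product of measurable factors.\<close>

lemma measurable_orth_proj:
  assumes f: "f \<in> measurable M \<mu>" and g: "g \<in> borel_measurable M"
  shows "(\<lambda>x. orth_proj (f x) (g x)) \<in> borel_measurable M"
proof -
  have "(\<lambda>x. matrix (orth_proj (f x)) *v g x) \<in> borel_measurable M"
    by (intro borel_measurable_matrix_vector_mult g measurable_compose[OF f measurable_matrix_orth_proj])
  also have "?this \<longleftrightarrow> ?thesis"
    using measurable_space[OF f] by (intro measurable_cong) (simp add: matrix_works linear_orth_proj subspace_space)
  finally show ?thesis .
qed

text \<open>Projections transform by conjugation, so the \<open>(i, j)\<close> entry of the new
  projection matrix is the coordinate \<open>i\<close> of
  \<open>U (orth_proj F (inv U (axis j 1)))\<close>.\<close>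

lemma measurable_image:
  fixes U :: "real ^ 'N \<Rightarrow> real ^ 'N"
  assumes U: "orthogonal_transformation U"
  shows "(\<lambda>F. U ` F) \<in> measurable \<mu> \<mu>"
  unfolding measurable_cong_sets[OF refl sets_eq] grassmannian_borel_def
proof (rule measurable_vimage_algebra2)
  show "(\<lambda>F. U ` F) \<in> space \<mu> \<rightarrow> codim_subspaces n"
    using codim_subspaces_image[OF U] by (auto simp: space_eq)
  show "(\<lambda>F. matrix (orth_proj (U ` F))) \<in> borel_measurable \<mu>"
  proof (rule borel_measurable_vec_vecI)
    fix i j
    have "(\<lambda>F. U (orth_proj F (inv U (axis j 1))) $ i) \<in> borel_measurable \<mu>"
      by (intro measurable_compose[OF measurable_compose[OF measurable_orth_proj borel_measurable_orthogonal[OF U]] borel_measurable_vec_nthI])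
         simp_all
    also have "?this \<longleftrightarrow> (\<lambda>F. matrix (orth_proj (U ` F)) $ i $ j) \<in> borel_measurable \<mu>"
    proof (rule measurable_cong)
      fix F assume F: "F \<in> space \<mu>"
      have "U (inv U (axis j 1)) = axis j 1"
        using orthogonal_transformation_surj[OF U] by (rule surj_f_inv_f)
      then show "U (orth_proj F (inv U (axis j 1))) $ i = matrix (orth_proj (U ` F)) $ i $ j"
        using orth_proj_image[OF U subspace_space[OF F], of "inv U (axis j 1)"] by (simp add: matrix_def)
    qed
    finally show "(\<lambda>F. matrix (orth_proj (U ` F)) $ i $ j) \<in> borel_measurable \<mu>" .
  qed
qed

text \<open>A mixture over \<open>F\<close> of standard Gaussians on the
  \<open>n\<close>-dimensional spaces \<open>F\<^sup>\<bottom>\<close>. It takes the place of a net: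
  averages over it control, at once, most normal vectors of most subspaces.\<close>

definition normal_law :: "(real ^ 'N) measure" where
  "normal_law = distr (\<mu> \<Otimes>\<^sub>M std_gaussian) borel (\<lambda>(F, x). x - orth_proj F x)"

lemma measurable_normal [measurable]:
  "(\<lambda>(F, x). x - orth_proj F x) \<in> borel_measurable (\<mu> \<Otimes>\<^sub>M std_gaussian)"
  unfolding case_prod_beta' by (intro borel_measurable_diff measurable_orth_proj) simp_all

text \<open>The product of the Haar and the Gaussian measure is invariant under rotating subspace
  and vector simultaneously, and taking the normal component commutes with this action.\<close>

lemma rotation_invariant_normal_law: "rotation_invariant normal_law"
  unfolding rotation_invariant_def
proof (intro conjI allI impI)
  interpret P: pair_prob_space \<mu> "std_gaussian :: (real ^ 'N) measure" by standard
  show "prob_space normal_law" unfolding normal_law_def by (rule P.prob_space_distr) simp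
  show "sets normal_law = sets borel" by (simp add: normal_law_def)
  fix U :: "real ^ 'N \<Rightarrow> real ^ 'N" assume U: "orthogonal_transformation U"
  note [measurable] = measurable_image[OF U] borel_measurable_orthogonal[OF U]
  have mU: "U \<in> measurable std_gaussian std_gaussian" by simp
  have \<mu>U: "distr \<mu> \<mu> (\<lambda>F. U ` F) = \<mu>" using haar U by (simp add: grassmannian_haar_def)
  have gU: "distr std_gaussian std_gaussian U = std_gaussian"
    using distr_std_gaussian_orthogonal[OF U] by (simp cong: distr_cong)
  have "\<mu> \<Otimes>\<^sub>M std_gaussian = distr \<mu> \<mu> (\<lambda>F. U ` F) \<Otimes>\<^sub>M distr std_gaussian std_gaussian U"
    by (simp add: \<mu>U gU)
  also have "\<dots> = distr (\<mu> \<Otimes>\<^sub>M std_gaussian) (\<mu> \<Otimes>\<^sub>M std_gaussian) (\<lambda>(F, x). (U ` F, U x))"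
    by (intro pair_measure_distr measurable_image U mU) (simp add: gU std_gaussian.sigma_finite_measure_axioms)
  finally have inv: "distr (\<mu> \<Otimes>\<^sub>M std_gaussian) (\<mu> \<Otimes>\<^sub>M std_gaussian) (\<lambda>(F, x). (U ` F, U x)) = \<mu> \<Otimes>\<^sub>M std_gaussian" ..
  have "distr normal_law borel U = distr (\<mu> \<Otimes>\<^sub>M std_gaussian) borel (\<lambda>p. U (snd p - orth_proj (fst p) (snd p)))"
    unfolding normal_law_def by (subst distr_distr) (simp_all add: o_def case_prod_beta')
  also have "\<dots> = distr (\<mu> \<Otimes>\<^sub>M std_gaussian) borel (\<lambda>p. U (snd p) - orth_proj (U ` fst p) (U (snd p)))"
    by (intro distr_cong refl)
       (auto simp: space_pair_measure orth_proj_image[OF U subspace_space] linear_diff[OF orthogonal_transformation_linear[OF U]])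
  also have "\<dots> = distr (distr (\<mu> \<Otimes>\<^sub>M std_gaussian) (\<mu> \<Otimes>\<^sub>M std_gaussian) (\<lambda>(F, x). (U ` F, U x))) borel (\<lambda>(F, x). x - orth_proj F x)"
    by (subst distr_distr) (simp_all add: o_def case_prod_beta')
  also have "\<dots> = normal_law" by (simp add: inv normal_law_def)
  finally show "distr normal_law borel U = normal_law" .
qed

lemma
  assumes Q: "Q \<in> sets borel"
  shows measurable_slice: "(\<lambda>F. measure std_gaussian {x. x - orth_proj F x \<in> Q}) \<in> borel_measurable \<mu>"
    and emeasure_normal_law: "emeasure normal_law Q = (\<integral>\<^sup>+F. ennreal (measure std_gaussian {x. x - orth_proj F x \<in> Q}) \<partial>\<mu>)"
proof -
  define S where "S = (\<lambda>(F, x). x - orth_proj F x) -` Q \<inter> space (\<mu> \<Otimes>\<^sub>M std_gaussian)"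
  have S: "S \<in> sets (\<mu> \<Otimes>\<^sub>M std_gaussian)" unfolding S_def by (rule measurable_sets[OF measurable_normal Q])
  have slice: "emeasure std_gaussian (Pair F -` S) = ennreal (measure std_gaussian {x. x - orth_proj F x \<in> Q})"
    if "F \<in> space \<mu>" for F
  proof -
    have "Pair F -` S = {x. x - orth_proj F x \<in> Q}" using that by (auto simp: S_def space_pair_measure)
    then show ?thesis by (simp add: std_gaussian.emeasure_eq_measure)
  qed
  have "emeasure normal_law Q = emeasure (\<mu> \<Otimes>\<^sub>M std_gaussian) S"
    unfolding normal_law_def S_def using Q by (subst emeasure_distr) simp_all
  also have "\<dots> = (\<integral>\<^sup>+F. emeasure std_gaussian (Pair F -` S) \<partial>\<mu>)"
    by (rule std_gaussian.emeasure_pair_measure_alt[OF S])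
  also have "\<dots> = (\<integral>\<^sup>+F. ennreal (measure std_gaussian {x. x - orth_proj F x \<in> Q}) \<partial>\<mu>)"
    by (intro nn_integral_cong slice)
  finally show "emeasure normal_law Q = (\<integral>\<^sup>+F. ennreal (measure std_gaussian {x. x - orth_proj F x \<in> Q}) \<partial>\<mu>)" .
  have "(\<lambda>F. enn2real (emeasure std_gaussian (Pair F -` S))) \<in> borel_measurable \<mu>"
    using std_gaussian.measurable_emeasure_Pair[OF S] by simp
  also have "?this \<longleftrightarrow> (\<lambda>F. measure std_gaussian {x. x - orth_proj F x \<in> Q}) \<in> borel_measurable \<mu>"
    by (intro measurable_cong) (simp add: slice)
  finally show "(\<lambda>F. measure std_gaussian {x. x - orth_proj F x \<in> Q}) \<in> borel_measurable \<mu>" .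
qed

lemma normal_law_Markov:
  assumes Q: "Q \<in> sets borel" and S: "S \<in> sets \<mu>" and c: "0 \<le> c"
    and le: "\<And>F. F \<in> S \<Longrightarrow> c \<le> measure std_gaussian {x. x - orth_proj F x \<in> Q}"
  shows "c * measure \<mu> S \<le> measure normal_law Q"
proof -
  interpret L: prob_space normal_law using rotation_invariant_normal_law by (simp add: rotation_invariant_def)
  have "ennreal (c * measure \<mu> S) = (\<integral>\<^sup>+F. ennreal c * indicator S F \<partial>\<mu>)"
    using S c by (simp add: nn_integral_cmult_indicator emeasure_eq_measure ennreal_mult)
  also have "\<dots> \<le> (\<integral>\<^sup>+F. ennreal (measure std_gaussian {x. x - orth_proj F x \<in> Q}) \<partial>\<mu>)"
    using le by (intro nn_integral_mono) (auto simp: indicator_def intro!: ennreal_leI)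
  also have "\<dots> = ennreal (measure normal_law Q)"
    by (simp add: emeasure_normal_law[OF Q, symmetric] L.emeasure_eq_measure)
  finally show ?thesis by simp
qed

lemma normal_law_const:
  assumes Q: "Q \<in> sets borel" and c: "0 \<le> c"
    and eq: "\<And>F. F \<in> space \<mu> \<Longrightarrow> measure std_gaussian {x. x - orth_proj F x \<in> Q} = c"
  shows "measure normal_law Q = c"
proof -
  have "emeasure normal_law Q = (\<integral>\<^sup>+F. ennreal c \<partial>\<mu>)"
    unfolding emeasure_normal_law[OF Q] by (intro nn_integral_cong) (simp add: eq)
  also have "\<dots> = ennreal c" by (simp add: emeasure_space_1)
  finally show ?thesis using c by (simp add: measure_def)
qed

end

text \<open>The shifted density is the original one times
  \<open>exp (- (norm v)\<^sup>2 / 2) * exp (- (v \<bullet> x))\<close>. By symmetry of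
  \<open>D\<close> the last factor may be averaged with its reflection, and the average is a
  hyperbolic cosine, hence at least 1.\<close>

lemma std_gaussian_shift:
  fixes D :: "(real ^ 'N) set"
  assumes D: "D \<in> sets borel" and sym: "\<And>x. x \<in> D \<Longrightarrow> - x \<in> D"
  shows "exp (- (norm v)\<^sup>2 / 2) * measure std_gaussian D \<le> measure std_gaussian {x. x - v \<in> D}"
proof -
  define d :: "real ^ 'N \<Rightarrow> real" where "d x = (1 / sqrt (2 * pi)) ^ CARD('N) * exp (- (norm x)\<^sup>2 / 2)" for x
  have dnn: "0 \<le> d x" for x by (simp add: d_def)
  have [measurable]: "d \<in> borel_measurable borel" unfolding d_def by measurable
  have [measurable]: "D \<in> sets borel" by fact
  have D': "{x. x - v \<in> D} \<in> sets borel" by measurable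
  have dv: "d (v + x) = exp (- (norm v)\<^sup>2 / 2) * (d x * exp (- (v \<bullet> x)))" for x
  proof -
    have "(norm (v + x))\<^sup>2 = (norm v)\<^sup>2 + (norm x)\<^sup>2 + 2 * (v \<bullet> x)"
      by (simp add: power2_norm_eq_inner inner_add_left inner_add_right inner_commute)
    then have "- (norm (v + x))\<^sup>2 / 2 = - (norm v)\<^sup>2 / 2 + (- (norm x)\<^sup>2 / 2 + - (v \<bullet> x))" by (simp add: field_simps)
    then have "exp (- (norm (v + x))\<^sup>2 / 2) = exp (- (norm v)\<^sup>2 / 2) * (exp (- (norm x)\<^sup>2 / 2) * exp (- (v \<bullet> x)))"
      by (simp only: exp_add)
    then show ?thesis by (simp only: d_def) simp
  qed
  have sym': "indicator D (- x) = (indicator D x :: ennreal)" for x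
    using sym[of x] sym[of "- x"] by (auto simp: indicator_def)
  let ?J = "\<lambda>s. \<integral>\<^sup>+x. ennreal (exp (s * (v \<bullet> x))) * indicator D x \<partial>std_gaussian"
  have "ennreal (measure std_gaussian {x. x - v \<in> D}) = (\<integral>\<^sup>+x. indicator {x. x - v \<in> D} x \<partial>std_gaussian)"
    using D' by (simp add: std_gaussian.emeasure_eq_measure)
  also have "\<dots> = (\<integral>\<^sup>+x. ennreal (d x) * indicator {x. x - v \<in> D} x \<partial>lborel)"
    unfolding d_def by (rule nn_integral_std_gaussian) (use D' in measurable)
  also have "\<dots> = (\<integral>\<^sup>+x. ennreal (d (v + x)) * indicator {x. x - v \<in> D} (v + x) \<partial>lborel)"
    by (rule nn_integral_lborel_translation[symmetric]) (use D' in measurable)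
  also have "\<dots> = (\<integral>\<^sup>+x. ennreal (exp (- (norm v)\<^sup>2 / 2)) * (ennreal (d x) * (ennreal (exp ((- 1) * (v \<bullet> x))) * indicator D x)) \<partial>lborel)"
    by (intro nn_integral_cong) (simp add: dv dnn ennreal_mult indicator_def)
  also have "\<dots> = ennreal (exp (- (norm v)\<^sup>2 / 2)) * (\<integral>\<^sup>+x. ennreal (d x) * (ennreal (exp ((- 1) * (v \<bullet> x))) * indicator D x) \<partial>lborel)"
    by (rule nn_integral_cmult) measurable
  also have "(\<integral>\<^sup>+x. ennreal (d x) * (ennreal (exp ((- 1) * (v \<bullet> x))) * indicator D x) \<partial>lborel) = ?J (- 1)"
    unfolding d_def by (rule nn_integral_std_gaussian[symmetric]) measurable
  finally have eq: "ennreal (measure std_gaussian {x. x - v \<in> D}) = ennreal (exp (- (norm v)\<^sup>2 / 2)) * ?J (- 1)" .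
  have U: "orthogonal_transformation (uminus :: real ^ 'N \<Rightarrow> real ^ 'N)"
    by (simp add: orthogonal_transformation linear_uminus)
  have "?J (- 1) = (\<integral>\<^sup>+x. ennreal (exp ((- 1) * (v \<bullet> (- x)))) * indicator D (- x) \<partial>std_gaussian)"
    by (rule nn_integral_std_gaussian_orthogonal[OF U, symmetric]) measurable
  then have J: "?J (- 1) = ?J 1" by (simp add: sym')
  have "2 * emeasure std_gaussian D = (\<integral>\<^sup>+x. 2 * indicator D x \<partial>std_gaussian)"
    by (subst nn_integral_cmult) auto
  also have "\<dots> \<le> (\<integral>\<^sup>+x. ennreal (exp ((- 1) * (v \<bullet> x))) * indicator D x + ennreal (exp (1 * (v \<bullet> x))) * indicator D x \<partial>std_gaussian)"
  proof (intro nn_integral_mono)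
    fix x
    have "2 \<le> exp (- (v \<bullet> x)) + exp (v \<bullet> x)"
      using exp_ge_add_one_self[of "v \<bullet> x"] exp_ge_add_one_self[of "- (v \<bullet> x)"] by linarith
    then have "ennreal 2 \<le> ennreal (exp (- (v \<bullet> x)) + exp (v \<bullet> x))" by (rule ennreal_leI)
    then show "2 * indicator D x \<le> ennreal (exp ((- 1) * (v \<bullet> x))) * indicator D x + ennreal (exp (1 * (v \<bullet> x))) * indicator D x"
      by (simp add: indicator_def)
  qed
  also have "\<dots> = ?J (- 1) + ?J 1" by (rule nn_integral_add) measurable
  finally have "2 * emeasure std_gaussian D \<le> 2 * ?J (- 1)" by (simp only: J mult_2)
  then have "emeasure std_gaussian D \<le> ?J (- 1)" by (subst (asm) ennreal_mult_le_mult_iff) auto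
  then have "ennreal (exp (- (norm v)\<^sup>2 / 2)) * emeasure std_gaussian D \<le> ennreal (measure std_gaussian {x. x - v \<in> D})"
    unfolding eq by (rule mult_left_mono) simp
  then show ?thesis
    by (simp add: std_gaussian.emeasure_eq_measure ennreal_mult[symmetric])
qed

section \<open>Subspaces with a normal vector of nonpositive width\<close>

text \<open>If \<open>h\<close> is nonpositive at a unit vector \<open>u\<close> normal to \<open>F\<close>, then by subadditivity it is small
  on a whole ball around \<open>s u\<close>, except where it is large on the ball around \<open>0\<close>.\<close>

lemma small_near_bad_direction:
  fixes h :: "real ^ 'N \<Rightarrow> real"
  assumes F: "subspace F" and u: "u \<in> F\<^sup>\<bottom>" "norm u = 1" "h u \<le> 0"
    and h: "homogeneous_lipschitz h" and sub: "\<And>x y. h (x + y) \<le> h x + h y"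
    and s: "0 \<le> s"
    and good: "measure std_gaussian {x. norm (x - orth_proj F x) \<le> r \<and> h (x - orth_proj F x) > \<eta>}
        \<le> measure std_gaussian {x. norm (x - orth_proj F x) \<le> r} / 4"
  shows "exp (- s\<^sup>2 / 2) * (measure std_gaussian {x. norm (x - orth_proj F x) \<le> r} / 2)
    \<le> measure std_gaussian {x. s - r \<le> norm (x - orth_proj F x) \<and> h (x - orth_proj F x) \<le> \<eta>}"
proof -
  interpret homogeneous_lipschitz h by fact
  define P where "P x = x - orth_proj F x" for x
  note lo = linear_orth_proj[OF F]
  have Pm: "P (- x) = - P x" for x by (simp add: P_def linear_neg[OF lo])
  \<comment> \<open>As \<open>u\<close> is normal to \<open>F\<close>, shifting \<open>x\<close> by
    \<open>s *\<^sub>R u\<close> shifts its normal component by the same vector.\<close>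
  have Pshift: "P x = s *\<^sub>R u + P (x - s *\<^sub>R u)" for x
    by (simp add: P_def linear_diff[OF lo] linear_scale[OF lo] orth_proj_comp_0[OF F u(1)])
  have [measurable]: "orth_proj F \<in> borel_measurable borel"
    by (intro borel_measurable_continuous_onI linear_continuous_on linear_conv_bounded_linear[THEN iffD1] lo)
  have [measurable]: "P \<in> borel_measurable borel"
    unfolding P_def[abs_def] by measurable
  define D where "D = {x. norm (P x) \<le> r}"
  define A where "A = {x. norm (P x) \<le> r \<and> h (P x) > \<eta>}"
  \<comment> \<open>Both signs are imposed to make the set symmetric, as the shift estimate demands.
    The exceptional set and its reflection each take at most a quarter of \<open>D\<close>, so half
    of it remains.\<close>
  define D' where "D' = {x. norm (P x) \<le> r \<and> h (P x) \<le> \<eta> \<and> h (- P x) \<le> \<eta>}"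
  have [measurable]: "D \<in> sets borel" "A \<in> sets borel" "D' \<in> sets borel"
    unfolding D_def A_def D'_def by measurable
  have U: "orthogonal_transformation (uminus :: real ^ 'N \<Rightarrow> real ^ 'N)"
    by (simp add: orthogonal_transformation linear_uminus)
  have "{x. - x \<in> A} \<in> sets borel" by measurable
  then have mA: "uminus -` A \<in> sets borel" by (simp add: vimage_def)
  have A': "measure std_gaussian (uminus -` A) = measure std_gaussian A"
    using orthogonal_preserves_std_gaussian[OF U \<open>A \<in> sets borel\<close>] by (simp add: measure_def)
  have gA: "measure std_gaussian A \<le> measure std_gaussian D / 4"
    using good by (simp add: A_def D_def P_def)
  have "measure std_gaussian D \<le> measure std_gaussian (D' \<union> (A \<union> uminus -` A))"
    using mA by (intro std_gaussian.finite_measure_mono) (auto simp: D_def D'_def A_def Pm)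
  also have "\<dots> \<le> measure std_gaussian D' + measure std_gaussian (A \<union> uminus -` A)"
    using mA by (intro measure_Un_le) auto
  also have "measure std_gaussian (A \<union> uminus -` A) \<le> measure std_gaussian A + measure std_gaussian (uminus -` A)"
    using mA by (intro measure_Un_le) auto
  finally have half: "measure std_gaussian D / 2 \<le> measure std_gaussian D'"
    using gA A' by linarith
  have "exp (- s\<^sup>2 / 2) * (measure std_gaussian D / 2) \<le> exp (- (norm (s *\<^sub>R u))\<^sup>2 / 2) * measure std_gaussian D'"
    using half s u(2) by (intro mult_mono) auto
  also have "\<dots> \<le> measure std_gaussian {x. x - s *\<^sub>R u \<in> D'}"
    by (rule std_gaussian_shift) (auto simp: D'_def Pm)
  also have "\<dots> \<le> measure std_gaussian {x. s - r \<le> norm (P x) \<and> h (P x) \<le> \<eta>}"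
  proof (intro std_gaussian.finite_measure_mono)
    show "{x. x - s *\<^sub>R u \<in> D'} \<subseteq> {x. s - r \<le> norm (P x) \<and> h (P x) \<le> \<eta>}"
    proof safe
      fix x assume x: "x - s *\<^sub>R u \<in> D'"
      have "s = norm (s *\<^sub>R u)" using s u(2) by simp
      also have "\<dots> \<le> norm (P x) + norm (P (x - s *\<^sub>R u))"
        using norm_triangle_ineq4[of "P x" "P (x - s *\<^sub>R u)"] Pshift[of x] by simp
      finally show "s - r \<le> norm (P x)" using x by (simp add: D'_def)
      have "h (P x) \<le> h (s *\<^sub>R u) + h (P (x - s *\<^sub>R u))"
        using sub Pshift[of x] by metis
      also have "h (s *\<^sub>R u) \<le> 0" using homogeneous[OF s] s u(3) by (simp add: mult_nonneg_nonpos)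
      finally show "h (P x) \<le> \<eta>" using x by (simp add: D'_def)
    qed
    show "{x. s - r \<le> norm (P x) \<and> h (P x) \<le> \<eta>} \<in> std_gaussian.events"
      by measurable
  qed
  finally show ?thesis by (simp add: D_def P_def)
qed

text \<open>The rate is \<open>2.7\<^sup>2 / 2 = 3.645\<close>. Its surplus of 1.645 over the target
  rate 2 absorbs the factor 4 already for \<open>n = 1\<close>.\<close>

lemma four_exp_bound:
  assumes "1 \<le> n"
  shows "4 * exp (- (27 / 10 * sqrt (real n))\<^sup>2 / 2) \<le> exp (- 2 * real n)"
proof -
  have "2 \<le> exp (329 / 400 :: real)"
    using exp_lower_Taylor_quadratic[of "329 / 400"] by (simp add: power2_eq_square)
  then have "2 * 2 \<le> exp (329 / 400 :: real) * exp (329 / 400)" by (intro mult_mono) auto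
  then have "4 \<le> exp (1645 / 1000 :: real)" by (simp add: exp_add[symmetric])
  also have "\<dots> \<le> exp (1645 / 1000 * real n)" using assms by simp
  finally have "4 * exp (- (729 / 200 * real n)) \<le> exp (1645 / 1000 * real n) * exp (- (729 / 200 * real n))"
    by (rule mult_right_mono) simp
  also have "\<dots> = exp (- 2 * real n)" by (simp add: exp_add[symmetric])
  also have "729 / 200 * real n = (27 / 10 * sqrt (real n))\<^sup>2 / 2"
    by (simp add: power_mult_distrib power_divide)
  finally show ?thesis by simp
qed

text \<open>Since \<open>60 \<le> exp (47 / 10)\<close>, the prefactors cost at most
  \<open>1 / 2 + 4.7\<close> per dimension, against a gain of \<open>3.8\<^sup>2 / 2 = 7.22\<close>;
  the remainder 2.02 just exceeds the required rate 2.\<close>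

lemma thirty_power_exp_bound:
  assumes n: "1 \<le> n" and t: "38 / 10 * sqrt (real n) \<le> t"
  shows "2 * exp (real n / 2) * 30 ^ n * exp (- t\<^sup>2 / 2) \<le> exp (- 2 * real n)"
proof -
  have e1: "(2 :: real) \<le> exp 1" using exp_ge_add_one_self[of 1] by simp
  have e4: "64 \<le> exp (47 / 10 :: real)"
  proof -
    have "13 / 8 \<le> exp (1 / 2 :: real)"
      using exp_lower_Taylor_quadratic[of "1 / 2"] by (simp add: power2_eq_square)
    then have "13 / 8 * (13 / 8) \<le> exp (1 / 2 :: real) * exp (1 / 2)" by (intro mult_mono) auto
    then have e: "26 / 10 \<le> exp (1 :: real)" by (simp add: exp_add[symmetric])
    have "(64 :: real) \<le> (26 / 10) ^ 4 * (1 + 7 / 10)" by (simp add: power_divide)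
    also have "\<dots> \<le> exp 1 ^ 4 * exp (7 / 10)"
      using exp_ge_add_one_self[of "7 / 10"] e by (intro mult_mono power_mono) auto
    also have "\<dots> = exp (47 / 10 :: real)" by (simp add: exp_of_nat_mult[symmetric] exp_add[symmetric])
    finally show ?thesis .
  qed
  have "2 * 30 ^ n \<le> 2 ^ n * (30 :: real) ^ n"
    using n self_le_power[of 2 n] by simp
  also have "\<dots> = 60 ^ n" by (simp add: power_mult_distrib[symmetric])
  also have "\<dots> \<le> exp (47 / 10) ^ n" using e4 by (intro power_mono) auto
  also have "\<dots> = exp (47 / 10 * real n)" by (simp add: exp_of_nat_mult[symmetric] mult.commute)
  finally have a: "2 * 30 ^ n \<le> exp (47 / 10 * real n)" .
  have "(38 / 10 * sqrt (real n))\<^sup>2 \<le> t\<^sup>2" using t by (intro power_mono) auto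
  then have "722 / 100 * real n \<le> t\<^sup>2 / 2" by (simp add: power_mult_distrib power_divide)
  then have b: "exp (- t\<^sup>2 / 2) \<le> exp (- (722 / 100 * real n))" by simp
  have "2 * exp (real n / 2) * 30 ^ n * exp (- t\<^sup>2 / 2) = exp (real n / 2) * ((2 * 30 ^ n) * exp (- t\<^sup>2 / 2))" by simp
  also have "\<dots> \<le> exp (real n / 2) * (exp (47 / 10 * real n) * exp (- (722 / 100 * real n)))"
    using a b by (intro mult_left_mono mult_mono) auto
  also have "\<dots> = exp (- (202 / 100) * real n)" by (simp add: exp_add[symmetric])
  also have "\<dots> \<le> exp (- 2 * real n)" by simp
  finally show ?thesis .
qed

context grassmannian
begin

lemma measure_nonpositive_normal_le:
  fixes h :: "real ^ 'N \<Rightarrow> real"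
  assumes n: "1 \<le> n" "n \<le> CARD('N)"
    and h: "homogeneous_lipschitz h" and sub: "\<And>x y. h (x + y) \<le> h x + h y"
    and width: "42 / 10 * sqrt (real n) \<le> (\<integral>x. h x \<partial>std_gaussian)"
    and B: "B \<in> sets \<mu>" and bad: "\<And>F. F \<in> B \<Longrightarrow> \<exists>u\<in>F\<^sup>\<bottom>. norm u = 1 \<and> h u \<le> 0"
  shows "measure \<mu> B \<le> 2 * exp (- 2 * real n)"
proof -
  interpret h: homogeneous_lipschitz h by fact
  interpret hm: homogeneous_lipschitz "\<lambda>x. - h x" by (rule h.uminus)
  interpret L: prob_space normal_law using rotation_invariant_normal_law by (simp add: rotation_invariant_def)
  have sL [simp, measurable_cong]: "sets normal_law = sets borel" using rotation_invariant_normal_law by (simp add: rotation_invariant_def)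
  define a where "a = (\<integral>y. norm y \<partial>(std_gaussian :: (real ^ 'N) measure))"
  define l where "l = (\<integral>x. h x \<partial>std_gaussian)"
  define s where "s = sqrt (real n)"
  define t1 where "t1 = 27 / 10 * s"
  \<comment> \<open>On \<open>Q2\<close> the norm is at least \<open>s - r = 19 * r\<close> while
    \<open>h\<close> is at most \<open>\<eta>\<close>, so
    \<open>a * h (sgn w) \<le> (l + t1) / 19\<close>. The value \<open>t\<close> is the resulting
    distance below the mean, \<open>l - (l + t1) / 19\<close>; for \<open>l = 4.2 * s\<close> it
    still exceeds \<open>3.8 * s\<close>.\<close>
  define t where "t = (18 * l - t1) / 19"
  define r where "r = s / 20"
  \<comment> \<open>The largest value of \<open>h\<close> on the ball of radius \<open>r\<close>
    unless the direction has an upper deviation of at least \<open>t1\<close>.\<close>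
  define \<eta> where "\<eta> = r * (l + t1) / a"
  have s: "1 \<le> s" using n by (simp add: s_def)
  have l: "42 / 10 * s \<le> l" using width by (simp add: l_def s_def)
  have t1: "0 \<le> t1" using s by (simp add: t1_def)
  have t: "38 / 10 * s \<le> t" using l s by (simp add: t_def t1_def)
  have r: "r > 0" using s by (simp add: r_def)
  have a: "a > 0"
  proof -
    have "l \<le> a"
      unfolding l_def a_def using h.abs_le_norm
      by (intro integral_mono h.integrable integrable_std_gaussian_norm) (use abs_le_D1 in blast)
    then show ?thesis using l s by linarith
  qed
  have \<eta>: "\<eta> \<ge> 0" using r a l s t1 by (simp add: \<eta>_def)
  obtain p where p: "p \<ge> (1 / 30) ^ n"
    "\<And>F :: (real ^ 'N) set. F \<in> codim_subspaces n \<Longrightarrow> measure std_gaussian {x. norm (x - orth_proj F x) \<le> sqrt (real n) / 20} = p"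
    using std_gaussian_proj_ball[OF n(2)] by metis
  have p_pos: "p > 0" using p(1) by (rule less_le_trans[rotated]) simp
  have pF: "measure std_gaussian {x. norm (x - orth_proj F x) \<le> r} = p" if "F \<in> space \<mu>" for F
    using p(2) that by (simp add: space_eq r_def s_def)

  define Q1 where "Q1 = {w. norm w \<le> r \<and> h w > \<eta>}"
  define Q2 where "Q2 = {w. s - r \<le> norm w \<and> h w \<le> \<eta>}"
  have Q: "Q1 \<in> sets borel" "Q2 \<in> sets borel" "{w :: real ^ 'N. norm w \<le> r} \<in> sets borel"
    unfolding Q1_def Q2_def by measurable
  note [measurable] = Q
  have bint: "integrable normal_law f" if "f \<in> borel_measurable borel" "\<And>x. \<bar>f x\<bar> \<le> 1" for f :: "real ^ 'N \<Rightarrow> real"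
    by (rule L.integrable_const_bound[of _ 1]) (use that in auto)

  have Q1: "measure normal_law Q1 \<le> exp (- t1\<^sup>2 / 2) * p"
  proof -
    \<comment> \<open>Weighting by this range of norms yields the tail bound relative to the measure
      \<open>p\<close> of the ball. The origin is left out to meet \<open>\<psi> 0 = 0\<close>; it
      is not in \<open>Q1\<close>, because \<open>\<eta> \<ge> 0\<close>.\<close>
    define \<psi> where "\<psi> x = (indicator {0<..r} x :: real)" for x :: real
    let ?T = "{x. a * h (sgn x) \<ge> l + t1}"
    have [measurable]: "\<psi> \<in> borel_measurable borel" "?T \<in> sets borel" unfolding \<psi>_def by measurable
    have "measure normal_law Q1 = (\<integral>x. indicator Q1 x \<partial>normal_law)" using Q by simp
    also have "\<dots> \<le> (\<integral>x. \<psi> (norm x) * indicator ?T x \<partial>normal_law)"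
    proof (rule integral_mono)
      show "indicator Q1 x \<le> \<psi> (norm x) * indicator ?T x" for x
      proof (cases "x \<in> Q1")
        case True
        then have x: "norm x \<le> r" "\<eta> < h x" by (auto simp: Q1_def)
        then have nz: "norm x > 0" using \<eta> by auto
        have "0 < h (sgn x)" using h.sgn_eq[of x] x \<eta> nz by (metis less_le_trans le_less_trans zero_less_mult_pos)
        then have "\<eta> < r * h (sgn x)" using x h.sgn_eq[of x] by (smt (verit) mult_right_mono)
        then have "r * (l + t1) < r * (a * h (sgn x))" using a by (simp add: \<eta>_def field_simps)
        then have "l + t1 < a * h (sgn x)" using r by simp
        then show ?thesis using x nz by (simp add: \<psi>_def indicator_def)
      qed (simp add: \<psi>_def)
    qed (auto intro!: bint simp: \<psi>_def indicator_def)
    also have "\<dots> \<le> exp (- t1\<^sup>2 / 2) * (\<integral>x. \<psi> (norm x) \<partial>normal_law)"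
      unfolding a_def l_def
      by (rule h.spherical_tail[OF rotation_invariant_normal_law]) (auto intro!: bint t1 simp: \<psi>_def indicator_def)
    also have "(\<integral>x. \<psi> (norm x) \<partial>normal_law) \<le> (\<integral>x. indicator {w. norm w \<le> r} x \<partial>normal_law)"
      by (rule integral_mono) (auto intro!: bint simp: \<psi>_def indicator_def)
    also have "\<dots> = measure normal_law {w. norm w \<le> r}" using Q by simp
    also have "\<dots> = p"
      by (rule normal_law_const[OF Q(3)]) (use p_pos pF in auto)
    finally show ?thesis by simp
  qed
  have Q2: "measure normal_law Q2 \<le> exp (- t\<^sup>2 / 2)"
  proof -
    define \<psi> where "\<psi> x = (indicator {0<..} x :: real)" for x :: real
    \<comment> \<open>A lower deviation of \<open>h\<close> is an upper deviation of
      \<open>- h\<close>, whose Gaussian mean is \<open>- l\<close>.\<close>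
    let ?T = "{x. a * - h (sgn x) \<ge> (\<integral>x. - h x \<partial>std_gaussian) + t}"
    have m: "(\<integral>x. - h x \<partial>std_gaussian) = - l" by (simp add: l_def)
    have [measurable]: "\<psi> \<in> borel_measurable borel" "?T \<in> sets borel" unfolding \<psi>_def by measurable
    have "measure normal_law Q2 = (\<integral>x. indicator Q2 x \<partial>normal_law)" using Q by simp
    also have "\<dots> \<le> (\<integral>x. \<psi> (norm x) * indicator ?T x \<partial>normal_law)"
    proof (rule integral_mono)
      show "indicator Q2 x \<le> \<psi> (norm x) * indicator ?T x" for x
      proof (cases "x \<in> Q2")
        case True
        then have x: "19 * r \<le> norm x" "h x \<le> \<eta>" by (auto simp: Q2_def r_def)
        then have nz: "norm x > 0" using r by linarith
        have "19 * r * h (sgn x) \<le> \<eta>"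
        proof (cases "h (sgn x) \<le> 0")
          case True
          then show ?thesis using \<eta> r by (smt (verit) mult_nonneg_nonpos)
        next
          case False
          then have "19 * r * h (sgn x) \<le> norm x * h (sgn x)" using x by (intro mult_right_mono) auto
          then show ?thesis using x h.sgn_eq[of x] by simp
        qed
        then have "r * (19 * (a * h (sgn x))) \<le> r * (l + t1)" using a by (simp add: \<eta>_def field_simps)
        then have "19 * (a * h (sgn x)) \<le> l + t1" using r by simp
        moreover have "19 * t = 18 * l - t1" by (simp add: t_def)
        ultimately have "- l + t \<le> - (a * h (sgn x))" by linarith
        then have "- l + t \<le> a * - h (sgn x)" by simp
        then show ?thesis using nz m by (simp add: \<psi>_def indicator_def)
      qed (simp add: \<psi>_def)
    qed (auto intro!: bint simp: \<psi>_def indicator_def)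
    also have "\<dots> \<le> exp (- t\<^sup>2 / 2) * (\<integral>x. \<psi> (norm x) \<partial>normal_law)"
      unfolding a_def
      by (rule hm.spherical_tail[OF rotation_invariant_normal_law])
         (use t s in \<open>auto intro!: bint simp: \<psi>_def indicator_def\<close>)
    also have "(\<integral>x. \<psi> (norm x) \<partial>normal_law) \<le> (\<integral>x. 1 \<partial>normal_law)"
      by (rule integral_mono) (auto intro!: bint simp: \<psi>_def indicator_def)
    finally show ?thesis by (simp add: L.prob_space)
  qed

  \<comment> \<open>The subspaces that violate the quarter condition of
    \<open>small_near_bad_direction\<close>. In the Markov estimate \<open>p\<close> occurs on both
    sides and cancels.\<close>
  define NG where "NG = {F \<in> space \<mu>. p / 4 < measure std_gaussian {x. x - orth_proj F x \<in> Q1}}"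
  have NG: "NG \<in> sets \<mu>"
    unfolding NG_def using measurable_slice[OF Q(1)] by measurable
  have "p / 4 * measure \<mu> NG \<le> measure normal_law Q1"
    by (rule normal_law_Markov[OF Q(1) NG]) (use p_pos in \<open>auto simp: NG_def\<close>)
  also note Q1
  finally have "p * measure \<mu> NG \<le> p * (4 * exp (- t1\<^sup>2 / 2))" by (simp add: mult_ac)
  then have 1: "measure \<mu> NG \<le> 4 * exp (- t1\<^sup>2 / 2)" using p_pos by simp

  \<comment> \<open>Each remaining bad subspace puts at least this fixed mass on \<open>Q2\<close>,
    because \<open>s\<^sup>2 = n\<close>, while the total mass of \<open>Q2\<close> is a rare lower
    deviation. Here nothing cancels \<open>p\<close>, and \<open>30 ^ n\<close> enters.\<close>
  have "exp (- real n / 2) * (p / 2) * measure \<mu> (B - NG) \<le> measure normal_law Q2"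
  proof (rule normal_law_Markov[OF Q(2)])
    fix F assume F: "F \<in> B - NG"
    then have Fs: "F \<in> space \<mu>" using B sets.sets_into_space by blast
    obtain u where u: "u \<in> F\<^sup>\<bottom>" "norm u = 1" "h u \<le> 0" using bad F by blast
    have "exp (- s\<^sup>2 / 2) * (measure std_gaussian {x. norm (x - orth_proj F x) \<le> r} / 2)
      \<le> measure std_gaussian {x. s - r \<le> norm (x - orth_proj F x) \<and> h (x - orth_proj F x) \<le> \<eta>}"
    proof (rule small_near_bad_direction[OF subspace_space[OF Fs] u h sub])
      show "measure std_gaussian {x. norm (x - orth_proj F x) \<le> r \<and> h (x - orth_proj F x) > \<eta>}
        \<le> measure std_gaussian {x. norm (x - orth_proj F x) \<le> r} / 4"
        using F Fs by (simp add: NG_def Q1_def pF)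
    qed (use s in auto)
    then show "exp (- real n / 2) * (p / 2) \<le> measure std_gaussian {x. x - orth_proj F x \<in> Q2}"
      by (simp add: pF[OF Fs] Q2_def s_def)
  qed (use B NG p_pos in auto)
  also note Q2
  finally have "p * measure \<mu> (B - NG) \<le> 2 * exp (real n / 2) * exp (- t\<^sup>2 / 2)"
    by (simp add: exp_minus field_simps)
  moreover have "(1 / 30) ^ n * measure \<mu> (B - NG) \<le> p * measure \<mu> (B - NG)"
    using p by (intro mult_right_mono) auto
  ultimately have "(1 / 30) ^ n * measure \<mu> (B - NG) \<le> 2 * exp (real n / 2) * exp (- t\<^sup>2 / 2)" by linarith
  then have "30 ^ n * ((1 / 30) ^ n * measure \<mu> (B - NG)) \<le> 30 ^ n * (2 * exp (real n / 2) * exp (- t\<^sup>2 / 2))"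
    by (rule mult_left_mono) simp
  also have "30 ^ n * ((1 / 30) ^ n * measure \<mu> (B - NG)) = (30 * (1 / 30)) ^ n * measure \<mu> (B - NG)"
    by (simp only: power_mult_distrib mult.assoc)
  finally have 2: "measure \<mu> (B - NG) \<le> 2 * exp (real n / 2) * 30 ^ n * exp (- t\<^sup>2 / 2)"
    by (simp add: mult_ac)

  have "measure \<mu> B \<le> measure \<mu> (NG \<union> (B - NG))"
    using B NG by (intro finite_measure_mono) auto
  also have "\<dots> \<le> measure \<mu> NG + measure \<mu> (B - NG)"
    using B NG by (intro measure_Un_le) auto
  also have "\<dots> \<le> exp (- 2 * real n) + exp (- 2 * real n)"
  proof (rule add_mono)
    show "measure \<mu> NG \<le> exp (- 2 * real n)"
      using 1 four_exp_bound[OF n(1)] by (simp add: t1_def s_def)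
    show "measure \<mu> (B - NG) \<le> exp (- 2 * real n)"
      using 2 thirty_power_exp_bound[OF n(1), of t] t by (simp add: s_def)
  qed
  finally show ?thesis by simp
qed

end

section \<open>Support functions and sections of convex bodies\<close>

definition support_fun :: "(real ^ 'N) set \<Rightarrow> real ^ 'N \<Rightarrow> real" where
  "support_fun T x = (SUP t\<in>T. x \<bullet> t)"

locale bounded_nonempty =
  fixes T :: "(real ^ 'N) set" and \<rho> :: real
  assumes nonempty: "T \<noteq> {}" and bound: "\<And>t. t \<in> T \<Longrightarrow> norm t \<le> \<rho>"
begin

lemma bdd: "bdd_above ((\<lambda>t. x \<bullet> t) ` T)"
proof (rule bdd_aboveI2)
  fix t assume "t \<in> T"
  then show "x \<bullet> t \<le> norm x * \<rho>"
    using norm_cauchy_schwarz[of x t] bound[of t] mult_left_mono[of "norm t" \<rho> "norm x"] by simp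
qed

lemma upper: "t \<in> T \<Longrightarrow> x \<bullet> t \<le> support_fun T x"
  unfolding support_fun_def by (rule cSUP_upper[OF _ bdd])

lemma least: "(\<And>t. t \<in> T \<Longrightarrow> x \<bullet> t \<le> c) \<Longrightarrow> support_fun T x \<le> c"
  unfolding support_fun_def by (rule cSUP_least[OF nonempty])

lemma subadditive: "support_fun T (x + y) \<le> support_fun T x + support_fun T y"
  using upper by (intro least) (simp add: inner_add_left add_mono)

lemma diff_le: "support_fun T x - support_fun T y \<le> \<rho> * norm (x - y)"
proof -
  have "support_fun T x \<le> support_fun T y + \<rho> * norm (x - y)"
  proof (rule least)
    fix t assume t: "t \<in> T"
    have "x \<bullet> t = y \<bullet> t + (x - y) \<bullet> t" by (simp add: inner_diff_left)
    also have "(x - y) \<bullet> t \<le> norm (x - y) * norm t" by (rule norm_cauchy_schwarz)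
    also have "\<dots> \<le> norm (x - y) * \<rho>" using bound[OF t] by (intro mult_left_mono) auto
    finally show "x \<bullet> t \<le> support_fun T y + \<rho> * norm (x - y)"
      using upper[OF t, of y] by (simp add: mult.commute)
  qed
  then show ?thesis by simp
qed

lemma abs_diff_le: "\<bar>support_fun T x - support_fun T y\<bar> \<le> \<rho> * norm (x - y)"
  using diff_le[of x y] diff_le[of y x] by (simp add: abs_le_iff norm_minus_commute)

lemma zero: "support_fun T 0 = 0"
  using nonempty by (simp add: support_fun_def)

lemma homogeneous:
  assumes c: "0 \<le> c"
  shows "support_fun T (c *\<^sub>R x) = c * support_fun T x"
proof (cases "c = 0")
  case False
  then have c: "c > 0" using c by simp
  show ?thesis
  proof (rule antisym)
    show "support_fun T (c *\<^sub>R x) \<le> c * support_fun T x"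
      using c upper by (intro least) simp
    have "support_fun T x \<le> support_fun T (c *\<^sub>R x) / c"
      using c upper[of _ "c *\<^sub>R x"] by (intro least) (simp add: field_simps)
    then show "c * support_fun T x \<le> support_fun T (c *\<^sub>R x)" using c by (simp add: field_simps)
  qed
qed (simp add: zero)

lemma continuous: "continuous_on UNIV (support_fun T)"
proof (rule continuous_onI)
  fix x :: "real ^ 'N" and e :: real assume e: "e > 0"
  have r: "\<rho> * d \<le> \<bar>\<rho>\<bar> * d" if "0 \<le> d" for d using that by (intro mult_right_mono) auto
  show "\<exists>d>0. \<forall>y\<in>UNIV. dist y x < d \<longrightarrow> dist (support_fun T y) (support_fun T x) \<le> e"
  proof (intro exI[of _ "e / (\<bar>\<rho>\<bar> + 1)"] conjI ballI impI)
    fix y assume y: "dist y x < e / (\<bar>\<rho>\<bar> + 1)"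
    have "dist (support_fun T y) (support_fun T x) \<le> \<bar>\<rho>\<bar> * dist y x"
      using abs_diff_le[of y x] r[of "norm (y - x)"] by (simp add: dist_norm)
    also have "\<dots> \<le> \<bar>\<rho>\<bar> * (e / (\<bar>\<rho>\<bar> + 1))" using y by (intro mult_left_mono) auto
    also have "\<dots> \<le> e" using e by (simp add: field_simps)
    finally show "dist (support_fun T y) (support_fun T x) \<le> e" .
  qed (use e in simp)
qed

lemma measurable [measurable]: "support_fun T \<in> borel_measurable borel"
  using continuous by (rule borel_measurable_continuous_onI)

lemma integrable: "integrable std_gaussian (support_fun T)"
  using abs_diff_le[of _ 0] by (intro integrable_std_gaussian_norm_bound[of _ \<rho>]) (simp_all add: zero)

lemma translate: "support_fun ((\<lambda>t. t + v) ` T) x = support_fun T x + x \<bullet> v"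
proof -
  have eq: "support_fun ((\<lambda>t. t + v) ` T) x = (SUP t\<in>T. x \<bullet> t + x \<bullet> v)"
    by (simp add: support_fun_def image_image inner_add_right)
  have b: "bdd_above ((\<lambda>t. x \<bullet> t + x \<bullet> v) ` T)"
    using upper by (intro bdd_aboveI2[of _ _ "support_fun T x + x \<bullet> v"]) simp
  have "support_fun T x \<le> (SUP t\<in>T. x \<bullet> t + x \<bullet> v) - x \<bullet> v"
    using cSUP_upper[OF _ b] by (intro least) (simp add: le_diff_eq)
  moreover have "(SUP t\<in>T. x \<bullet> t + x \<bullet> v) \<le> support_fun T x + x \<bullet> v"
    using upper nonempty by (intro cSUP_least) simp_all
  ultimately show ?thesis unfolding eq by linarith
qed

end

lemma radius_upper: "compact T \<Longrightarrow> y \<in> T \<Longrightarrow> norm y \<le> radius T"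
  unfolding radius_def
  by (rule cSUP_upper) (auto intro!: bounded_imp_bdd_above compact_imp_bounded compact_continuous_image continuous_intros)

lemma radius_attained:
  assumes "compact T" "T \<noteq> {}"
  obtains y where "y \<in> T" "norm y = radius T"
proof -
  obtain y where y: "y \<in> T" "\<And>z. z \<in> T \<Longrightarrow> norm z \<le> norm y"
    using continuous_attains_sup[OF assms, of norm] by (auto intro: continuous_intros)
  have "radius T \<le> norm y" unfolding radius_def using y assms by (intro cSUP_least) auto
  with radius_upper[OF assms(1) y(1)] y(1) that show thesis by force
qed

lemma convex_body_subspace_nonzero:
  fixes K :: "(real ^ 'N) set"
  assumes K: "convex_body K" and V: "subspace V" "dim V \<ge> 1"
  obtains x where "x \<in> K" "x \<in> V" "x \<noteq> 0"
proof -
  obtain v where v: "v \<in> V" "v \<noteq> 0"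
    using V(2) dim_eq_0[of V] by fastforce
  obtain e where e: "e > 0" "ball 0 e \<subseteq> K"
    using K by (auto simp: convex_body_def mem_interior)
  define x where "x = (e / (2 * norm v)) *\<^sub>R v"
  have "x \<in> ball 0 e" using v e by (simp add: x_def)
  moreover have "x \<in> V" unfolding x_def using V(1) v(1) by (rule subspace_scale)
  moreover have "x \<noteq> 0" using v e by (simp add: x_def)
  ultimately show thesis using that e by blast
qed

text \<open>The infimum is a positive minimum. Admissible factors exist because \<open>K\<close>
  contains a ball; they stay away from 0 because a nonzero point of \<open>K \<inter> E\<close> is
  fixed by the projection and \<open>K\<close> is bounded; and the infimum is attained because
  \<open>K \<inter> E\<close> is closed.\<close>

lemma section_delta:
  fixes K E :: "(real ^ 'N) set"
  assumes K: "convex_body K" and E: "subspace E" "dim E \<ge> 1"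
  shows "section_delta E K > 0" "orth_proj E ` K \<subseteq> (*\<^sub>R) (section_delta E K) ` (K \<inter> E)"
proof -
  define C where "C = {c. 0 < c \<and> orth_proj E ` K \<subseteq> (*\<^sub>R) c ` (K \<inter> E)}"
  define d where "d = section_delta E K"
  have dC: "d = Inf C" by (simp add: d_def section_delta_def C_def)
  have cK: "compact K" using K by (simp add: convex_body_def)
  have cT: "compact (orth_proj E ` K)"
    using cK linear_orth_proj[OF E(1)]
    by (intro compact_continuous_image linear_continuous_on) (simp add: linear_conv_bounded_linear)
  obtain M where M: "M > 0" "\<And>x. x \<in> K \<Longrightarrow> norm x \<le> M"
    using compact_imp_bounded[OF cK] unfolding bounded_pos by blast
  obtain R where R: "R > 0" "\<And>x. x \<in> orth_proj E ` K \<Longrightarrow> norm x \<le> R"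
    using compact_imp_bounded[OF cT] unfolding bounded_pos by blast
  obtain x0 where x0: "x0 \<in> K" "x0 \<in> E" "x0 \<noteq> 0" using convex_body_subspace_nonzero[OF K E] .
  obtain e where e: "e > 0" "ball 0 e \<subseteq> K"
    using K by (auto simp: convex_body_def mem_interior)
  have "2 * R / e \<in> C"
    unfolding C_def
  proof (intro CollectI conjI subsetI)
    show "0 < 2 * R / e" using R e by simp
    fix t assume t: "t \<in> orth_proj E ` K"
    define y where "y = (e / (2 * R)) *\<^sub>R t"
    have "norm y < e" using R(2)[OF t] R(1) e(1) by (simp add: y_def field_simps)
    then have "y \<in> K" using e(2) by auto
    moreover have "y \<in> E" using t orth_proj_mem[OF E(1)] E(1) by (auto simp: y_def intro: subspace_scale)
    moreover have "t = (2 * R / e) *\<^sub>R y" using R e by (simp add: y_def)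
    ultimately show "t \<in> (*\<^sub>R) (2 * R / e) ` (K \<inter> E)" by blast
  qed
  then have Cne: "C \<noteq> {}" by blast
  have low: "norm x0 / M \<le> c" if "c \<in> C" for c
  proof -
    have "x0 \<in> orth_proj E ` K" using x0 orth_proj_id[OF E(1)] by force
    then have "x0 \<in> (*\<^sub>R) c ` (K \<inter> E)" using that unfolding C_def by blast
    then obtain y where "y \<in> K" "x0 = c *\<^sub>R y" by blast
    then have "norm x0 \<le> c * M" using that M(2)[of y] by (auto simp: C_def mult_left_mono)
    then show ?thesis using M(1) by (simp add: field_simps)
  qed
  have "norm x0 / M \<le> d" unfolding dC by (rule cInf_greatest[OF Cne low])
  moreover have "0 < norm x0 / M" using x0(3) M(1) by simp
  ultimately show d0: "section_delta E K > 0" unfolding d_def by linarith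
  have bdd: "bdd_below C" by (rule bdd_belowI[of _ 0]) (simp add: C_def)
  show "orth_proj E ` K \<subseteq> (*\<^sub>R) (section_delta E K) ` (K \<inter> E)"
  proof
    fix t assume t: "t \<in> orth_proj E ` K"
    have "\<exists>c. c \<in> C \<and> d \<le> c \<and> c < d + 1 / real (Suc j)" for j
    proof -
      have "Inf C < d + 1 / real (Suc j)" by (simp add: dC)
      then obtain c where "c \<in> C" "c < d + 1 / real (Suc j)" using cInf_lessD[OF Cne] by blast
      then show ?thesis using cInf_lower[OF _ bdd, of c] by (auto simp: dC)
    qed
    then obtain c where c: "\<And>j. c j \<in> C" "\<And>j. d \<le> c j" "\<And>j. c j < d + 1 / real (Suc j)" by metis
    have "c \<longlonglongrightarrow> d"
    proof (rule tendsto_sandwich[of "\<lambda>_. d" _ _ "\<lambda>j. d + 1 / real (Suc j)"])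
      have "(\<lambda>j. d + 1 / real (Suc j)) \<longlonglongrightarrow> d + 0" by (intro tendsto_intros LIMSEQ_Suc[OF lim_1_over_n])
      then show "(\<lambda>j. d + 1 / real (Suc j)) \<longlonglongrightarrow> d" by simp
    qed (use c in \<open>auto intro!: always_eventually less_imp_le\<close>)
    then have lim: "(\<lambda>j. inverse (c j) *\<^sub>R t) \<longlonglongrightarrow> inverse d *\<^sub>R t"
      using d0 by (intro tendsto_intros) (auto simp: d_def)
    have "inverse (c j) *\<^sub>R t \<in> K \<inter> E" for j
    proof -
      obtain y where "y \<in> K \<inter> E" "t = c j *\<^sub>R y" using c(1)[of j] t by (auto simp: C_def)
      moreover have "c j > 0" using c(1)[of j] by (simp add: C_def)
      ultimately show ?thesis by simp
    qed
    moreover have "closed (K \<inter> E)" using cK E by (intro closed_Int compact_imp_closed closed_subspace)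
    ultimately have "inverse d *\<^sub>R t \<in> K \<inter> E" using lim by (metis closed_sequentially)
    moreover have "t = d *\<^sub>R (inverse d *\<^sub>R t)" using d0 by (simp add: d_def)
    ultimately show "t \<in> (*\<^sub>R) (section_delta E K) ` (K \<inter> E)" unfolding d_def by blast
  qed
qed

text \<open>A linear functional bounded above on a subspace vanishes there, and the bound is
  positive because the subspace contains 0. The functional is thus positive on \<open>T\<close>; its
  negative, normalised, is \<open>u\<close>.\<close>

lemma separate_subspace:
  fixes F T :: "(real ^ 'N) set"
  assumes F: "subspace F" and T: "convex T" "compact T" "T \<noteq> {}" and disj: "F \<inter> T = {}"
  obtains u where "u \<in> F\<^sup>\<bottom>" "norm u = 1" "\<And>t. t \<in> T \<Longrightarrow> u \<bullet> t \<le> 0"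
proof -
  obtain a b where ab: "\<And>x. x \<in> F \<Longrightarrow> a \<bullet> x < b" "\<And>t. t \<in> T \<Longrightarrow> a \<bullet> t > b"
    using separating_hyperplane_closed_compact[OF subspace_imp_convex[OF F] closed_subspace[OF F] T disj] by blast
  have b: "b > 0" using ab(1)[OF subspace_0[OF F]] by simp
  have orth: "a \<bullet> x = 0" if x: "x \<in> F" for x
  proof (rule ccontr)
    assume nz: "a \<bullet> x \<noteq> 0"
    have "a \<bullet> ((b / (a \<bullet> x)) *\<^sub>R x) < b" by (intro ab subspace_scale F x)
    then show False using nz by simp
  qed
  have a: "a \<noteq> 0" using ab(2) b T(3) by force
  define u where "u = - (inverse (norm a)) *\<^sub>R a"
  have "u \<in> F\<^sup>\<bottom>" by (auto simp: orthogonal_comp_def orthogonal_def u_def inner_commute[of _ a] orth)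
  moreover have "norm u = 1" using a by (simp add: u_def)
  moreover have "u \<bullet> t \<le> 0" if "t \<in> T" for t
  proof -
    have "a \<bullet> t > 0" using ab(2)[OF that] b by linarith
    then show ?thesis by (simp add: u_def)
  qed
  ultimately show thesis by (rule that)
qed

section \<open>Measurability of the random radius\<close>

lemma random_radius_ge_iff:
  fixes K F :: "(real ^ 'N) set"
  assumes K: "compact K" "0 \<in> K" and F: "subspace F"
  shows "c \<le> random_radius K F \<longleftrightarrow> (\<exists>y\<in>K \<inter> {y. c \<le> norm y}. matrix (orth_proj F) *v y = y)"
proof -
  have fixed: "matrix (orth_proj F) *v y = y \<longleftrightarrow> y \<in> F" for y
    using orth_proj_id[OF F, of y] orth_proj_mem[OF F, of y] by (auto simp: matrix_works linear_orth_proj[OF F])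
  have cFK: "compact (F \<inter> K)" using K(1) F by (simp add: closed_Int_compact closed_subspace)
  have "F \<inter> K \<noteq> {}" using K(2) subspace_0[OF F] by blast
  then obtain y where y: "y \<in> F \<inter> K" "norm y = radius (F \<inter> K)" using radius_attained[OF cFK] by blast
  show ?thesis
  proof
    assume "c \<le> random_radius K F"
    then show "\<exists>y\<in>K \<inter> {y. c \<le> norm y}. matrix (orth_proj F) *v y = y"
      using y by (intro bexI[of _ y]) (auto simp: fixed random_radius_def)
  next
    assume "\<exists>y\<in>K \<inter> {y. c \<le> norm y}. matrix (orth_proj F) *v y = y"
    then obtain z where "z \<in> K" "c \<le> norm z" "z \<in> F" by (auto simp: fixed)
    then show "c \<le> random_radius K F"
      using radius_upper[OF cFK, of z] by (simp add: random_radius_def)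
  qed
qed

text \<open>Projecting a closed set of pairs along the compact factor \<open>K\<close> keeps it
  closed. Restricted to the points of \<open>K\<close> of norm at least \<open>c\<close>, this
  exhibits the event that the random radius is at least \<open>c\<close> as the preimage of a closed
  set of matrices.\<close>

lemma closed_fixing_matrices:
  fixes K :: "(real ^ 'N) set"
  assumes "compact K"
  shows "closed {M :: real ^ 'N ^ 'N. \<exists>y\<in>K. M *v y = y}"
proof -
  have "closed {p :: (real ^ 'N) \<times> (real ^ 'N ^ 'N). snd p *v fst p = fst p}"
    unfolding matrix_vector_mult_def vec_eq_iff
    by (intro closed_Collect_all closed_Collect_eq) (simp_all add: continuous_intros)
  from closed_compact_projection[OF assms this] show ?thesis by (simp add: Bex_def)
qed

lemma (in grassmannian) measurable_random_radius_ge: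
  assumes K: "compact K" "0 \<in> K"
  shows "{F \<in> space \<mu>. c \<le> random_radius K F} \<in> sets \<mu>"
proof -
  let ?C = "{M :: real ^ 'N ^ 'N. \<exists>y\<in>K \<inter> {y. c \<le> norm y}. M *v y = y}"
  have "closed {y :: real ^ 'N. c \<le> norm y}" by (intro closed_Collect_le continuous_intros)
  then have "closed ?C" using K by (intro closed_fixing_matrices compact_Int_closed)
  then have "(\<lambda>F. matrix (orth_proj F)) -` ?C \<inter> space \<mu> \<in> sets \<mu>"
    by (intro measurable_sets[OF measurable_matrix_orth_proj] borel_closed)
  also have "(\<lambda>F. matrix (orth_proj F)) -` ?C \<inter> space \<mu> = {F \<in> space \<mu>. c \<le> random_radius K F}"
    using random_radius_ge_iff[OF K subspace_space] by auto
  finally show ?thesis .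
qed

lemma inverse_sum_ge_min:
  fixes a b :: real
  assumes "a > 0" "b > 0"
  shows "1 / 2 * min a b \<le> inverse (1 / a + 1 / b)"
proof -
  have "1 / a + 1 / b \<le> 1 / min a b + 1 / min a b"
    using assms by (intro add_mono divide_left_mono) auto
  then have "inverse (2 / min a b) \<le> inverse (1 / a + 1 / b)"
    using assms by (intro le_imp_inverse_le) (auto intro: add_pos_pos)
  then show ?thesis by simp
qed


theorem theorem1p8:
  fixes K E :: "(real ^ 'N) set" and n k :: nat and \<mu> :: "(real ^ 'N) set measure"
  assumes "1 \<le> n" and "n < CARD('N)"
    and "convex_body K"
    and "1 \<le> k" and "k < CARD('N)"
    and "E \<in> codim_subspaces k"
    and "ell_star (orth_proj E ` K) \<ge> 6 * sqrt (real n) * radius (orth_proj E ` K)"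
    and "grassmannian_haar n \<mu>"
  shows "measure \<mu> {F \<in> space \<mu>. random_radius K F \<ge>
             inverse (1 / radius (K \<inter> E\<^sup>\<bottom>)
               + 6 * section_delta E K * sqrt (real n) / ell_star (orth_proj E ` K))}
           \<ge> 1 - 2 * exp (- 2 * real n)
       \<and> inverse (1 / radius (K \<inter> E\<^sup>\<bottom>)
               + 6 * section_delta E K * sqrt (real n) / ell_star (orth_proj E ` K))
           \<ge> 1 / 2 * min (radius (K \<inter> E\<^sup>\<bottom>))
               (ell_star (orth_proj E ` K) / (6 * section_delta E K * sqrt (real n)))"
proof -
  interpret grassmannian n \<mu> by unfold_locales fact
  define T where "T = orth_proj E ` K"
  define L where "L = ell_star T"
  define d where "d = section_delta E K"
  define R where "R = radius (K \<inter> E\<^sup>\<bottom>)"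
  define s where "s = sqrt (real n)"
  \<comment> \<open>The width hypothesis says precisely that \<open>c1\<close> bounds the norms in
    \<open>T\<close>, and the shift gets the same length. Moreover
    \<open>6 * d * s / L = d / c1\<close>, so \<open>c0\<close> is half the harmonic mean of
    \<open>R\<close> and \<open>c1 / d\<close>.\<close>
  define c1 where "c1 = L / (6 * s)"
  define c0 where "c0 = inverse (1 / R + 6 * d * s / L)"
  have s: "1 \<le> s" using assms(1) by (simp add: s_def)
  have E: "subspace E" "dim E \<ge> 1" using assms(5,6) by (auto simp: codim_subspaces_def)
  have E': "subspace (E\<^sup>\<bottom>)" "dim (E\<^sup>\<bottom>) \<ge> 1"
    using dim_orthogonal_comp_codim[OF assms(6)] assms(4) by (auto simp: subspace_orthogonal_comp)
  have K: "compact K" "convex K" "0 \<in> K"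
    using assms(3) interior_subset[of K] by (auto simp: convex_body_def)
  note lin = linear_orth_proj[OF E(1)]
  have T: "compact T" "convex T" "T \<noteq> {}"
    using K lin unfolding T_def
    by (auto intro!: compact_continuous_image linear_continuous_on convex_linear_image simp: linear_conv_bounded_linear)
  have TE: "t \<in> E" if "t \<in> T" for t using that orth_proj_mem[OF E(1)] by (auto simp: T_def)
  have T_bound: "norm t \<le> c1" if "t \<in> T" for t
  proof -
    have "norm t \<le> radius T" using radius_upper[OF T(1) that] .
    also have "6 * s * radius T \<le> L" using assms(7) by (simp add: L_def T_def s_def)
    then have "radius T \<le> c1" using s by (simp add: c1_def field_simps)
    finally show ?thesis .
  qed
  \<comment> \<open>\<open>K\<close> contains a ball around 0, so \<open>T\<close> has a nonzero
    point; this guards the divisions by \<open>L\<close> and \<open>c1\<close>.\<close>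
  have c1: "c1 > 0"
  proof -
    obtain x where "x \<in> K" "x \<in> E" "x \<noteq> 0" using convex_body_subspace_nonzero[OF assms(3) E] .
    moreover from this have "x \<in> T" using orth_proj_id[OF E(1)] by (force simp: T_def)
    ultimately show ?thesis using T_bound[of x] by (meson less_le_trans zero_less_norm_iff)
  qed
  then have L: "L > 0" using s by (simp add: c1_def zero_less_divide_iff)
  have d: "d > 0" "T \<subseteq> (*\<^sub>R) d ` (K \<inter> E)"
    using section_delta[OF assms(3) E] by (simp_all add: d_def T_def)
  have cKE: "compact (K \<inter> E\<^sup>\<bottom>)" using K(1) E'(1) by (simp add: compact_Int_closed closed_subspace)
  obtain z where z: "z \<in> K" "z \<in> E\<^sup>\<bottom>" "z \<noteq> 0" using convex_body_subspace_nonzero[OF assms(3) E'] .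
  obtain x0 where x0: "x0 \<in> K" "x0 \<in> E\<^sup>\<bottom>" "norm x0 = R"
    using radius_attained[OF cKE] z by (auto simp: R_def)
  have R: "R > 0"
    using radius_upper[OF cKE, of z] z by (simp add: R_def less_le_trans[of 0 "norm z"])

  define v where "v = (c1 / R) *\<^sub>R x0"
  have v: "norm v = c1" "v \<in> E\<^sup>\<bottom>"
    using R c1 x0 E'(1) by (auto simp: v_def intro: subspace_scale)
  define T' where "T' = (\<lambda>t. t + v) ` T"
  have T': "compact T'" "convex T'" "T' \<noteq> {}"
    using T convex_translation[of T v] unfolding T'_def
    by (auto intro!: compact_continuous_image continuous_intros simp: add.commute)
  \<comment> \<open>The shift is orthogonal to \<open>T\<close>, so Pythagoras applies. The triangle
    inequality would give \<open>2 * c1\<close> and a relative width of only \<open>3 * s\<close>,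
    short of the required \<open>42 / 10 * s\<close>.\<close>
  define q where "q = sqrt 2 * c1"
  have q: "q > 0" using c1 by (simp add: q_def)
  interpret S: bounded_nonempty T c1 by unfold_locales (use T T_bound in auto)
  interpret S': bounded_nonempty T' q
  proof
    fix t assume "t \<in> T'"
    then obtain w where w: "w \<in> T" "t = w + v" by (auto simp: T'_def)
    have "(norm t)\<^sup>2 = (norm w)\<^sup>2 + (norm v)\<^sup>2"
      unfolding w(2) using inner_orth_comp[OF TE[OF w(1)] v(2)] by (intro norm_add_Pythagorean) (simp add: orthogonal_def)
    also have "\<dots> \<le> c1\<^sup>2 + c1\<^sup>2" using T_bound[OF w(1)] v(1) by (intro add_mono power_mono) auto
    also have "\<dots> = q\<^sup>2" by (simp add: q_def power_mult_distrib)
    finally show "norm t \<le> q" using q by (simp add: power2_le_iff_abs_le)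
  qed (fact T'(3))
  define h where "h x = support_fun T' x / q" for x
  have h: "homogeneous_lipschitz h"
  proof
    show "h (c *\<^sub>R x) = c * h x" if "0 \<le> c" for c x
      using S'.homogeneous[OF that] by (simp add: h_def)
    show "\<bar>h x - h y\<bar> \<le> norm (x - y)" for x y
      using S'.abs_diff_le[of x y] q by (simp add: h_def diff_divide_distrib[symmetric] field_simps)
  qed
  have sub: "h (x + y) \<le> h x + h y" for x y
    using S'.subadditive[of x y] q by (simp add: h_def add_divide_distrib[symmetric] divide_right_mono)
  have width: "(\<integral>x. h x \<partial>std_gaussian) = L / q"
  proof -
    have odd: "(\<integral>x. x \<bullet> v \<partial>std_gaussian) = 0"
      by (rule integral_std_gaussian_odd) simp_all
    have i: "integrable std_gaussian (\<lambda>x. x \<bullet> v)"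
      using Cauchy_Schwarz_ineq2[of _ v]
      by (intro integrable_std_gaussian_norm_bound[of _ "norm v"]) (simp_all add: mult.commute)
    have "(\<integral>x. support_fun T' x \<partial>std_gaussian) = (\<integral>x. support_fun T x + x \<bullet> v \<partial>std_gaussian)"
      by (simp add: T'_def S.translate)
    also have "\<dots> = (\<integral>x. support_fun T x \<partial>std_gaussian)"
      using S.integrable i odd by simp
    also have "\<dots> = L" by (simp add: L_def ell_star_def support_fun_def)
    finally show ?thesis by (simp add: h_def)
  qed
  have "42 / 10 * s \<le> L / q"
  proof -
    \<comment> \<open>The bound \<open>10 / 7\<close> is the one for which
      \<open>42 / 10 * (10 / 7) = 6\<close>.\<close>
    have "sqrt 2 \<le> 10 / 7" by (rule real_le_lsqrt) (auto simp: power2_eq_square)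
    then have "42 / 10 * s * sqrt 2 \<le> 42 / 10 * s * (10 / 7)" using s by (intro mult_left_mono) auto
    then have "42 / 10 * s * sqrt 2 * c1 \<le> 6 * s * c1" using c1 by (intro mult_right_mono) auto
    also have "6 * s * c1 = L" using s by (simp add: c1_def)
    finally show ?thesis using q by (simp add: q_def field_simps)
  qed
  then have wide: "42 / 10 * sqrt (real n) \<le> (\<integral>x. h x \<partial>std_gaussian)"
    by (simp add: width s_def)

  have meets: "c0 \<le> random_radius K F" if F: "subspace F" and y: "t \<in> T" "t + v \<in> F" for F t
  proof -
    obtain w where w: "w \<in> K" "w \<in> E" "t = d *\<^sub>R w" using d(2) y(1) by blast
    \<comment> \<open>The weights \<open>c1 / D\<close> and \<open>d * R / D\<close> are determined
      by summing to 1 and by making the combination of \<open>x0\<close> and \<open>w\<close> a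
      multiple of \<open>t + v\<close>, hence a point of \<open>F\<close>.\<close>
    define D where "D = c1 + d * R"
    have D: "D > 0" using c1 d R by (simp add: D_def add_pos_pos)
    define y where "y = (c1 / D) *\<^sub>R x0 + (d * R / D) *\<^sub>R w"
    have "c1 / D + d * R / D = 1" using D by (simp add: D_def add_divide_distrib[symmetric])
    then have yK: "y \<in> K"
      unfolding y_def using c1 d R D by (intro convexD[OF K(2) x0(1) w(1)]) auto
    have "y = (R / D) *\<^sub>R (t + v)"
      using R by (simp add: y_def v_def w(3) scaleR_add_right mult.commute)
    then have yF: "y \<in> F" using subspace_scale[OF F that(3)] by simp
    \<comment> \<open>The component of \<open>y\<close> in \<open>E\<close> cannot shorten it, so
      the component along \<open>x0\<close>, of length \<open>c1 * R / D = c0\<close>, is a lower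
      bound for the norm.\<close>
    have "orthogonal ((d * R / D) *\<^sub>R w) ((c1 / D) *\<^sub>R x0)"
      using inner_orth_comp[OF w(2) x0(2)] by (simp add: orthogonal_def)
    then have "(norm y)\<^sup>2 = (norm ((d * R / D) *\<^sub>R w))\<^sup>2 + (norm ((c1 / D) *\<^sub>R x0))\<^sup>2"
      unfolding y_def by (subst add.commute) (rule norm_add_Pythagorean)
    then have "(norm ((c1 / D) *\<^sub>R x0))\<^sup>2 \<le> (norm y)\<^sup>2" by simp
    then have "norm ((c1 / D) *\<^sub>R x0) \<le> norm y" by (rule power2_le_imp_le) simp
    moreover have "norm ((c1 / D) *\<^sub>R x0) = c1 * R / D" using c1 D by (simp add: x0(3))
    moreover have "c1 * R / D = c0"
    proof -
      have "6 * d * s / L = d / c1" using s L by (simp add: c1_def)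
      then have "1 / R + 6 * d * s / L = 1 / R + d / c1" by (simp only:)
      also have "\<dots> = D / (c1 * R)" using R c1 by (simp add: D_def field_simps)
      finally have "1 / R + 6 * d * s / L = D / (c1 * R)" .
      then show ?thesis by (simp add: c0_def)
    qed
    ultimately have "c0 \<le> norm y" by simp
    also have "\<dots> \<le> radius (F \<inter> K)"
      using yK yF K(1) F by (intro radius_upper) (auto simp: closed_Int_compact closed_subspace)
    finally show ?thesis by (simp add: random_radius_def)
  qed

  define G where "G = {F \<in> space \<mu>. c0 \<le> random_radius K F}"
  have G: "G \<in> sets \<mu>" unfolding G_def by (rule measurable_random_radius_ge[OF K(1,3)])
  have "measure \<mu> (space \<mu> - G) \<le> 2 * exp (- 2 * real n)"
  proof (rule measure_nonpositive_normal_le[OF assms(1) _ h sub wide])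
    fix F assume F: "F \<in> space \<mu> - G"
    then have sF: "subspace F" using subspace_space by blast
    have "F \<inter> T' = {}"
      using meets[OF sF] F by (auto simp: T'_def G_def)
    then obtain u where u: "u \<in> F\<^sup>\<bottom>" "norm u = 1" "\<And>t. t \<in> T' \<Longrightarrow> u \<bullet> t \<le> 0"
      using separate_subspace[OF sF T'(2,1,3)] by metis
    then have "h u \<le> 0" using S'.least[of u 0] q by (simp add: h_def divide_le_0_iff)
    then show "\<exists>u\<in>F\<^sup>\<bottom>. norm u = 1 \<and> h u \<le> 0" using u by blast
  qed (use G assms(2) in auto)
  then have "1 - 2 * exp (- 2 * real n) \<le> measure \<mu> G"
    using prob_compl[OF G] by simp
  moreover have "1 / 2 * min R (L / (6 * d * s)) \<le> c0"
    using inverse_sum_ge_min[OF R, of "L / (6 * d * s)"] L d s by (simp add: c0_def)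
  ultimately show ?thesis
    by (simp only: G_def c0_def R_def d_def L_def T_def s_def)
qed

end
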